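(* Let $n\ge 1$, $A\in\mathbb{R}^{n\times n}$, $B\in\mathbb{R}^{n\times 1}$, $K\in\mathbb{R}^{1\times n}$, $c>0$ and $c_0>0$. Consider the coupled ODE–string system $$\dot X(t)=AX(t)+Bu(1,t),\quad u_{tt}(x,t)=c^2u_{xx}(x,t),\quad u(0,t)=KX(t),\quad u_x(1,t)=-c_0u_t(1,t),$$ for $x\in[0,1]$, $t\ge 0$, with initial conditions $X(0)=X^0$, $u(\cdot,0)=u^0$, $u_t(\cdot,0)=v^0$, where $(X^0,u^0,v^0)\in\mathcal{D}(T)$. Let $N\in\mathbb{N}$ (with $N=0$ allowed). Define $\tilde B=\frac{1}{2c}B\begin{bmatrix}1 & -1\end{bmatrix}\in\mathbb{R}^{n\times2}$, $g=\begin{bmatrix}0 & 1 \\ 1+cc_0 & 0\end{bmatrix}$, $h=\begin{bmatrix}1-cc_0 & 0 \\ 0 & -1\end{bmatrix}$, the block matrices $$L_N=\left[\ell_{k,j}I_2\right]_{0\le k,j\le N}\in\mathbb{R}^{2(N+1)\times2(N+1)},\quad \ell_{k,j}=\begin{cases}(2j+1)(1-(-1)^{j+k}) & j\le k \\ 0 & j>k\end{cases},$$ $$\mathbb{1}_N=\begin{bmatrix} I_2 \\ I_2 \\ \vdots \\ I_2 \end{bmatrix},\qquad \bar{\mathbb{1}}_N=\begin{bmatrix} I_2 \\ -I_2 \\ \vdots \\ (-1)^N I_2 \end{bmatrix}\in\mathbb{R}^{2(N+1)\times2},$$ and $$F_N=\begin{bmatrix}I_{n+2(N+1)} & 0_{n+2(N+1),2}\end{bmatrix},\qquad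 \mathcal{N}_N=\begin{bmatrix}A+BK & \tilde B & 0_{n,2(N+1)}\end{bmatrix},$$ $$G_N=\begin{bmatrix}0_{2,n+2(N+1)} & g\end{bmatrix}+\begin{bmatrix} K \\ 0_{1,n} \end{bmatrix}\mathcal{N}_N,\qquad H_N=\begin{bmatrix}0_{2,n+2(N+1)} & h\end{bmatrix}+\begin{bmatrix} 0_{1,n} \\ K \end{bmatrix}\mathcal{N}_N,$$ $$\mathcal{Z}_N=\mathbb{1}_NH_N-\bar{\mathbb{1}}_NG_N-\begin{bmatrix}0_{2N+2,n} & L_N & 0_{2N+2,2}\end{bmatrix},\qquad Z_N=\begin{bmatrix} \mathcal{N}_N \\ c\,\mathcal{Z}_N \end{bmatrix},$$ $$\tilde R_N=\mathrm{diag}\left(0_n,R,3R,\dots,(2N+1)R,0_2\right).$$ Assume that there exist symmetric positive definite matrices $P_N\in\mathbb{R}^{(n+2(N+1))\times(n+2(N+1))}$ and $S,R\in\mathbb{R}^{2\times2}$ such that $$\Psi_N=\mathrm{He}\left(Z_N^\top P_NF_N\right)-c\tilde R_N+c\left(H_N^\top(S+R)H_N-G_N^\top SG_N\right)\prec0 .$$ Then the coupled system is exponentially stable in the sense of the norm $\|\cdot\|_{\mathcal{H}}$: there exist $\gamma>1$ and $\delta>0$ (independent of the initial conditions) such that for every $(X^0,u^0,v^0)\in\mathcal{D}(T)$ every solution with these initial conditions satisfies, for all $t>0$, $$\|(X(t),u(t),u_t(t))\|_{\mathcal{H}}^2\le\gamma e^{-\delta t}\|(X^0,u^0,v^0)\|_{\mathcal{H}}^2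 .$$
   Context: $L^2=L^2([0,1];\mathbb{R})$ with norm $\|\cdot\|$, and $H^m$ denotes the usual Sobolev space on $[0,1]$ ($H^0=L^2$). $\mathcal{H}=\mathbb{R}^n\times H^1\times L^2$ with norm $\|(X,u,v)\|_{\mathcal{H}}^2=|X|_n^2+\|u\|^2+c^2\|u_x\|^2+\|v\|^2$, where $|\cdot|_n$ is the Euclidean norm on $\mathbb{R}^n$. $\mathcal{D}(T)=\{(X,u,v)\in\mathbb{R}^n\times H^2\times H^1:\ u(0)=KX,\ u_x(1)=-c_0v(1)\}$. $\mathrm{He}(M)=M+M^\top$; $\mathrm{diag}$ is the block-diagonal matrix; $0_{p,q}$ is the $p\times q$ zero matrix, $0_p=0_{p,p}$, $I_p$ the identity; $M\prec 0$ means symmetric negative definite. Notion of solution: a pair $(X,u)$ with $(X,u,u_t)\in C([0,+\infty);\mathcal{H})$ (so $u\in C([0,\infty);H^1)\cap C^1([0,\infty);L^2)$), $X\in C^1$, satisfying the initial conditions, the ODE, $u(0,t)=KX(t)$ for all $t$, and the wave equation with the boundary condition at $x=1$ in the weak sense: for every $\varphi\in H^1$ with $\varphi(0)=0$, the function $t\mapsto\int_0^1u_t(x,t)\varphi(x)\,dx+c^2c_0\,u(1,t)\varphi(1)$ is $C^1$ with derivative $-c^2\int_0^1u_x(x,t)\varphi_x(x)\,dx$. *)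

theory Defs
  imports "HOL-Analysis.Analysis" "Jordan_Normal_Form.Matrix"
begin

text \<open>The symbols for vector indexing and the scalar product refer to the dimension-free
  matrices of \<^theory>\<open>Jordan_Normal_Form.Matrix\<close>, not to the type-indexed ones.\<close>

unbundle no vec_syntax

section \<open>Lebesgue and Sobolev spaces on the unit interval\<close>

text \<open>Elements of function spaces are represented by functions \<open>real \<Rightarrow> real\<close> of which only the
  values on \<open>{0..1}\<close> matter.\<close>

abbreviation leb01 :: "real measure" where
  "leb01 \<equiv> lebesgue_on {0..1}"

definition L2 :: "(real \<Rightarrow> real) set" where
  "L2 = {f. f \<in> borel_measurable leb01 \<and> integrable leb01 (\<lambda>x. (f x)\<^sup>2)}"

definition L2_nrm :: "(real \<Rightarrow> real) \<Rightarrow> real" where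
  "L2_nrm f = sqrt (LINT x|leb01. (f x)\<^sup>2)"

text \<open>\<open>test_fun \<phi> \<phi>'\<close>: \<open>\<phi>\<close> is continuously differentiable with compact support in the open
  interval (0, 1), and \<open>\<phi>'\<close> is its derivative.\<close>

definition test_fun :: "(real \<Rightarrow> real) \<Rightarrow> (real \<Rightarrow> real) \<Rightarrow> bool" where
  "test_fun \<phi> \<phi>' \<longleftrightarrow>
     (\<forall>x. (\<phi> has_real_derivative \<phi>' x) (at x)) \<and> continuous_on UNIV \<phi>' \<and>
     (\<exists>a b. 0 < a \<and> a < b \<and> b < 1 \<and> (\<forall>x. x \<notin> {a..b} \<longrightarrow> \<phi> x = 0))"

definition is_weak_deriv :: "(real \<Rightarrow> real) \<Rightarrow> (real \<Rightarrow> real) \<Rightarrow> bool" where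
  "is_weak_deriv u w \<longleftrightarrow>
     (\<forall>\<phi> \<phi>'. test_fun \<phi> \<phi>' \<longrightarrow>
        (LINT x|leb01. u x * \<phi>' x) = - (LINT x|leb01. w x * \<phi> x))"

text \<open>\<open>sobolev m\<close> is the space usually written \<open>H\<^sup>m\<close>. For \<open>m \<ge> 1\<close> each class has a unique continuous
  representative on \<open>{0..1}\<close>, and that representative is taken, so that \<open>u 0\<close> and \<open>u 1\<close> are the
  boundary traces; likewise for the weak derivatives of order less than \<open>m\<close>.\<close>

primrec sobolev :: "nat \<Rightarrow> (real \<Rightarrow> real) set" where
  "sobolev 0 = L2"
| "sobolev (Suc m) =
     {u. u \<in> L2 \<and> continuous_on {0..1} u \<and> (\<exists>w \<in> sobolev m. is_weak_deriv u w)}"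

text \<open>A weak derivative in \<open>L\<^sup>2\<close>; it is determined only up to null sets, so use it only under integrals.\<close>

definition wderiv :: "(real \<Rightarrow> real) \<Rightarrow> real \<Rightarrow> real" where
  "wderiv u = (SOME w. w \<in> L2 \<and> is_weak_deriv u w)"

section \<open>The coupled ODE--string system\<close>

definition Hspace :: "nat \<Rightarrow> (real vec \<times> (real \<Rightarrow> real) \<times> (real \<Rightarrow> real)) set" where
  "Hspace n = carrier_vec n \<times> sobolev 1 \<times> L2"

definition Hnrm :: "real \<Rightarrow> real vec \<times> (real \<Rightarrow> real) \<times> (real \<Rightarrow> real) \<Rightarrow> real" where
  "Hnrm c = (\<lambda>(X, u, v).
     sqrt (X \<bullet> X + (L2_nrm u)\<^sup>2 + c\<^sup>2 * (L2_nrm (wderiv u))\<^sup>2 + (L2_nrm v)\<^sup>2))"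

definition DT ::
  "nat \<Rightarrow> real mat \<Rightarrow> real \<Rightarrow> (real vec \<times> (real \<Rightarrow> real) \<times> (real \<Rightarrow> real)) set" where
  "DT n K c0 = {(X, u, v). X \<in> carrier_vec n \<and> u \<in> sobolev 2 \<and> v \<in> sobolev 1 \<and>
     u 0 = (K *\<^sub>v X) $ 0 \<and>
     (\<exists>ux \<in> sobolev 1. is_weak_deriv u ux \<and> ux 1 = - c0 * v 1)}"

text \<open>In \<open>is_solution\<close> the state \<open>u t\<close> is the function written \<open>u(\<cdot>,t)\<close>, and \<open>v\<close> is \<open>u\<^sub>t\<close>, the
  time derivative of \<open>u\<close> as an \<open>L\<^sup>2\<close>-valued function (unique up to null sets for each \<open>t \<ge> 0\<close>).\<close>

definition is_solution ::
  "nat \<Rightarrow> real mat \<Rightarrow> real mat \<Rightarrow> real mat \<Rightarrow> real \<Rightarrow> real \<Rightarrow>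
   real vec \<Rightarrow> (real \<Rightarrow> real) \<Rightarrow> (real \<Rightarrow> real) \<Rightarrow>
   (real \<Rightarrow> real vec) \<Rightarrow> (real \<Rightarrow> real \<Rightarrow> real) \<Rightarrow> (real \<Rightarrow> real \<Rightarrow> real) \<Rightarrow> bool" where
  "is_solution n A B K c c0 X0 u0 v0 X u v \<longleftrightarrow>
     \<comment> \<open>\<open>(X, u, u\<^sub>t)\<close> is continuous with values in the energy space\<close>
     (\<forall>t\<ge>0. (X t, u t, v t) \<in> Hspace n) \<and>
     (\<forall>t\<ge>0. ((\<lambda>s. Hnrm c (X s - X t, \<lambda>x. u s x - u t x, \<lambda>x. v s x - v t x)) \<longlongrightarrow> 0)
               (at t within {0..})) \<and>
     (\<forall>t\<ge>0. ((\<lambda>s. L2_nrm (\<lambda>x. (u s x - u t x) / (s - t) - v t x)) \<longlongrightarrow> 0)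
               (at t within {0..})) \<and>
     \<comment> \<open>\<open>X\<close> is continuously differentiable and satisfies the ODE\<close>
     (\<exists>X'. (\<forall>t\<ge>0. \<forall>i<n. ((\<lambda>s. X s $ i) has_real_derivative X' t $ i) (at t within {0..})) \<and>
           (\<forall>i<n. continuous_on {0..} (\<lambda>t. X' t $ i)) \<and>
           (\<forall>t\<ge>0. X' t = A *\<^sub>v X t + B *\<^sub>v vec_of_list [u t 1])) \<and>
     \<comment> \<open>initial conditions\<close>
     X 0 = X0 \<and> (\<forall>x\<in>{0..1}. u 0 x = u0 x) \<and> (AE x in leb01. v 0 x = v0 x) \<and>
     \<comment> \<open>boundary condition at \<open>x = 0\<close>\<close>
     (\<forall>t\<ge>0. u t 0 = (K *\<^sub>v X t) $ 0) \<and>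
     \<comment> \<open>weak form of the wave equation and of the boundary condition at \<open>x = 1\<close>\<close>
     (\<forall>\<phi> \<in> sobolev 1. \<phi> 0 = 0 \<longrightarrow>
        (\<forall>t\<ge>0. ((\<lambda>s. (LINT x|leb01. v s x * \<phi> x) + c\<^sup>2 * c0 * u s 1 * \<phi> 1)
                  has_real_derivative - c\<^sup>2 * (LINT x|leb01. wderiv (u t) x * wderiv \<phi> x))
                (at t within {0..})) \<and>
        continuous_on {0..} (\<lambda>t. - c\<^sup>2 * (LINT x|leb01. wderiv (u t) x * wderiv \<phi> x)))"

section \<open>The matrix inequality\<close>

definition append_cols :: "'a :: zero mat \<Rightarrow> 'a mat \<Rightarrow> 'a mat" (infixr \<open>@\<^sub>c\<close> 65) where
  "M @\<^sub>c M' = four_block_mat M M' (0\<^sub>m 0 (dim_col M)) (0\<^sub>m 0 (dim_col M'))"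

definition sym_pos_def :: "nat \<Rightarrow> real mat \<Rightarrow> bool" where
  "sym_pos_def d M \<longleftrightarrow> M \<in> carrier_mat d d \<and> transpose_mat M = M \<and>
     (\<forall>x \<in> carrier_vec d. x \<noteq> 0\<^sub>v d \<longrightarrow> 0 < x \<bullet> (M *\<^sub>v x))"

definition sym_neg_def :: "nat \<Rightarrow> real mat \<Rightarrow> bool" where
  "sym_neg_def d M \<longleftrightarrow> M \<in> carrier_mat d d \<and> transpose_mat M = M \<and>
     (\<forall>x \<in> carrier_vec d. x \<noteq> 0\<^sub>v d \<longrightarrow> x \<bullet> (M *\<^sub>v x) < 0)"

definition He :: "real mat \<Rightarrow> real mat" where
  "He M = M + transpose_mat M"

definition B_tilde :: "real mat \<Rightarrow> real \<Rightarrow> real mat" where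
  "B_tilde B c = (1 / (2 * c)) \<cdot>\<^sub>m (B * mat_of_rows_list 2 [[1, - 1]])"

definition g_mat :: "real \<Rightarrow> real \<Rightarrow> real mat" where
  "g_mat c c0 = mat_of_rows_list 2 [[0, 1], [1 + c * c0, 0]]"

definition h_mat :: "real \<Rightarrow> real \<Rightarrow> real mat" where
  "h_mat c c0 = mat_of_rows_list 2 [[1 - c * c0, 0], [0, - 1]]"

definition ell :: "nat \<Rightarrow> nat \<Rightarrow> real" where
  "ell k j = (if j \<le> k then (2 * real j + 1) * (1 - (- 1) ^ (j + k)) else 0)"

text \<open>Matrices made of \<open>2 \<times> 2\<close> blocks that are multiples of the identity: entry \<open>(i, j)\<close> lies
  in block \<open>(i div 2, j div 2)\<close> and, inside it, at position \<open>(i mod 2, j mod 2)\<close>.\<close>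

definition L_mat :: "nat \<Rightarrow> real mat" where
  "L_mat N = mat (2 * (N + 1)) (2 * (N + 1))
     (\<lambda>(i, j). if i mod 2 = j mod 2 then ell (i div 2) (j div 2) else 0)"

definition one_mat_N :: "nat \<Rightarrow> real mat" where
  "one_mat_N N = mat (2 * (N + 1)) 2 (\<lambda>(i, j). if i mod 2 = j then 1 else 0)"

definition one_bar_mat_N :: "nat \<Rightarrow> real mat" where
  "one_bar_mat_N N = mat (2 * (N + 1)) 2 (\<lambda>(i, j). if i mod 2 = j then (- 1) ^ (i div 2) else 0)"

definition F_mat :: "nat \<Rightarrow> nat \<Rightarrow> real mat" where
  "F_mat n N = 1\<^sub>m (n + 2 * (N + 1)) @\<^sub>c 0\<^sub>m (n + 2 * (N + 1)) 2"

text \<open>\<open>NN_mat\<close> and \<open>ZZ_mat\<close> are the calligraphic matrices, \<open>Z_mat\<close> the upright one.\<close>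

definition NN_mat :: "nat \<Rightarrow> nat \<Rightarrow> real mat \<Rightarrow> real mat \<Rightarrow> real mat \<Rightarrow> real \<Rightarrow> real mat" where
  "NN_mat n N A B K c = (A + B * K) @\<^sub>c B_tilde B c @\<^sub>c 0\<^sub>m n (2 * (N + 1))"

definition G_mat ::
  "nat \<Rightarrow> nat \<Rightarrow> real mat \<Rightarrow> real mat \<Rightarrow> real mat \<Rightarrow> real \<Rightarrow> real \<Rightarrow> real mat" where
  "G_mat n N A B K c c0 =
     (0\<^sub>m 2 (n + 2 * (N + 1)) @\<^sub>c g_mat c c0) + (K @\<^sub>r 0\<^sub>m 1 n) * NN_mat n N A B K c"

definition H_mat ::
  "nat \<Rightarrow> nat \<Rightarrow> real mat \<Rightarrow> real mat \<Rightarrow> real mat \<Rightarrow> real \<Rightarrow> real \<Rightarrow> real mat" where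
  "H_mat n N A B K c c0 =
     (0\<^sub>m 2 (n + 2 * (N + 1)) @\<^sub>c h_mat c c0) + (0\<^sub>m 1 n @\<^sub>r K) * NN_mat n N A B K c"

definition ZZ_mat ::
  "nat \<Rightarrow> nat \<Rightarrow> real mat \<Rightarrow> real mat \<Rightarrow> real mat \<Rightarrow> real \<Rightarrow> real \<Rightarrow> real mat" where
  "ZZ_mat n N A B K c c0 =
     one_mat_N N * H_mat n N A B K c c0 - one_bar_mat_N N * G_mat n N A B K c c0
     - (0\<^sub>m (2 * N + 2) n @\<^sub>c L_mat N @\<^sub>c 0\<^sub>m (2 * N + 2) 2)"

definition Z_mat ::
  "nat \<Rightarrow> nat \<Rightarrow> real mat \<Rightarrow> real mat \<Rightarrow> real mat \<Rightarrow> real \<Rightarrow> real \<Rightarrow> real mat" where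
  "Z_mat n N A B K c c0 = NN_mat n N A B K c @\<^sub>r (c \<cdot>\<^sub>m ZZ_mat n N A B K c c0)"

definition R_tilde :: "nat \<Rightarrow> nat \<Rightarrow> real mat \<Rightarrow> real mat" where
  "R_tilde n N R =
     diag_block_mat ([0\<^sub>m n n] @ map (\<lambda>k. real (2 * k + 1) \<cdot>\<^sub>m R) [0..<N + 1] @ [0\<^sub>m 2 2])"

definition Psi_mat ::
  "nat \<Rightarrow> nat \<Rightarrow> real mat \<Rightarrow> real mat \<Rightarrow> real mat \<Rightarrow> real \<Rightarrow> real \<Rightarrow>
   real mat \<Rightarrow> real mat \<Rightarrow> real mat \<Rightarrow> real mat" where
  "Psi_mat n N A B K c c0 P S R =
     He (transpose_mat (Z_mat n N A B K c c0) * P * F_mat n N)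
     - c \<cdot>\<^sub>m R_tilde n N R
     + c \<cdot>\<^sub>m (transpose_mat (H_mat n N A B K c c0) * (S + R) * H_mat n N A B K c c0
              - transpose_mat (G_mat n N A B K c c0) * S * G_mat n N A B K c c0)"

end

theory Submission
  imports Defs
begin

text \<open>
  Write \<open>v = u\<^sub>t\<close> and \<open>w = u\<^sub>x\<close>. The Riemann coordinates \<open>\<chi>\<^sub>0(x) = v(x) + c w(x)\<close> and
  \<open>\<chi>\<^sub>1(x) = v(1 - x) - c w(1 - x)\<close> both satisfy \<open>\<chi>\<^sub>t = c \<chi>\<^sub>x\<close>: the string is a pair of transport
  equations running from \<open>x = 1\<close> to \<open>x = 0\<close>, and the boundary conditions express the traces at both
  ends through \<open>X\<close>, the moments of \<open>\<chi>\<close> and the two numbers \<open>\<zeta> = (v(1), c w(0))\<close>. The Lyapunov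
  functional is \<open>V = z\<^sup>T P z + \<integral> \<chi>\<^sup>T (S + x R) \<chi>\<close>, where \<open>z\<close> consists of \<open>X\<close> and of the Legendre moments of
  \<open>\<chi>\<close> up to order \<open>N\<close>. The matrices of the statement are the maps from \<open>\<xi> = (z, \<zeta>)\<close> to the traces
  \<open>\<chi>(0)\<close> and \<open>\<chi>(1)\<close> and to the time derivative of \<open>z\<close>, so that integration by parts in \<open>x\<close> gives
  \<open>V' = \<xi>\<^sup>T \<Psi> \<xi> - c (\<integral> \<chi>\<^sup>T R \<chi> - \<Sum> (2k + 1) y\<^sub>k\<^sup>T R y\<^sub>k)\<close>, with \<open>y\<^sub>k\<close> the \<open>k\<close>-th moment (\<open>Psi_xi\<close>).
  The first term is at most \<open>- \<epsilon> |\<xi>|\<^sup>2\<close>. The bracket is nonnegative by Bessel's inequality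
  (\<open>bessel_quadratic\<close>), and applying that inequality to \<open>R - \<theta> I\<close> instead of \<open>R\<close> leaves over a negative
  multiple of \<open>\<integral> |\<chi>|\<^sup>2\<close>; together they bound \<open>V'\<close> by a negative multiple of the energy
  (\<open>dissipation\<close>). Since \<open>V\<close> is equivalent to the energy (\<open>lyap_lower\<close>, \<open>lyap_upper\<close>), it decays
  exponentially (\<open>regular_decay\<close>). The norm of \<open>u\<close> itself is controlled by \<open>u(0) = K X\<close> and \<open>u\<^sub>x\<close>.

  For a weak solution \<open>v\<close> and \<open>w\<close> have no traces, and the integration by parts is not available.
  Averaging over the time window from \<open>t\<close> to \<open>t + h\<close> repairs this. The average of \<open>v\<close> is
  \<open>(u(t + h) - u(t)) / h\<close>, hence in \<open>H\<^sup>1\<close>; and the weak formulation, integrated over the window, says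
  that the average of \<open>w\<close> is in \<open>H\<^sup>1\<close> too, with derivative \<open>(v(t + h) - v(t)) / (c\<^sup>2 h)\<close> and with the
  boundary value prescribed at \<open>x = 1\<close> (\<open>moll_w_avg\<close>). The system is linear and autonomous, so the averages
  form a regular solution, to which the computation applies with constants that do not depend
  on \<open>h\<close>. Letting \<open>h\<close> tend to \<open>0\<close> yields the decay of \<open>V\<close> along the weak solution (\<open>solution_decay\<close>).
\<close>

section \<open>Square-integrable functions on the unit interval\<close>

definition ip :: "(real \<Rightarrow> real) \<Rightarrow> (real \<Rightarrow> real) \<Rightarrow> real" where
  "ip f g = (LINT x|leb01. f x * g x)"

lemma ip_commute: "ip f g = ip g f"
  unfolding ip_def by (simp add: mult.commute)

lemma L2_mult_integrable:
  assumes "f \<in> L2" "g \<in> L2"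
  shows "integrable leb01 (\<lambda>x. f x * g x)"
proof (rule Bochner_Integration.integrable_bound)
  show "integrable leb01 (\<lambda>x. (f x)\<^sup>2 + (g x)\<^sup>2)"
    using assms by (auto simp: L2_def)
  show "(\<lambda>x. f x * g x) \<in> borel_measurable leb01"
    using assms by (auto simp: L2_def)
  have "\<bar>f x * g x\<bar> \<le> (f x)\<^sup>2 + (g x)\<^sup>2" for x
  proof -
    have "0 \<le> (\<bar>f x\<bar> - \<bar>g x\<bar>)\<^sup>2" by simp
    then have "2 * (\<bar>f x\<bar> * \<bar>g x\<bar>) \<le> (f x)\<^sup>2 + (g x)\<^sup>2"
      by (simp add: power2_eq_square algebra_simps)
    moreover have "0 \<le> \<bar>f x\<bar> * \<bar>g x\<bar>" by simp
    ultimately show ?thesis unfolding abs_mult by linarith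
  qed
  then have "norm (f x * g x) \<le> norm ((f x)\<^sup>2 + (g x)\<^sup>2)" for x
    using abs_ge_self[of "(f x)\<^sup>2 + (g x)\<^sup>2"] order_trans unfolding real_norm_def by blast
  then show "AE x in leb01. norm (f x * g x) \<le> norm ((f x)\<^sup>2 + (g x)\<^sup>2)"
    by (intro AE_I2)
qed

lemma L2_I:
  assumes "f \<in> borel_measurable leb01" "integrable leb01 (\<lambda>x. (f x)\<^sup>2)"
  shows "f \<in> L2"
  using assms by (simp add: L2_def)

lemma L2_add [intro]: assumes "f \<in> L2" "g \<in> L2" shows "(\<lambda>x. f x + g x) \<in> L2"
proof (rule L2_I)
  show "(\<lambda>x. f x + g x) \<in> borel_measurable leb01"
    using assms by (auto simp: L2_def)
  have "integrable leb01 (\<lambda>x. (f x)\<^sup>2 + (g x)\<^sup>2 + 2 * (f x * g x))"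
    using assms L2_mult_integrable[OF assms] by (auto simp: L2_def)
  then show "integrable leb01 (\<lambda>x. (f x + g x)\<^sup>2)"
    by (simp add: power2_sum mult.assoc)
qed

lemma L2_cmult [intro]: assumes "f \<in> L2" shows "(\<lambda>x. a * f x) \<in> L2"
  using assms by (auto simp: L2_def power_mult_distrib)

lemma L2_cmult' [intro]: assumes "f \<in> L2" shows "(\<lambda>x. f x * a) \<in> L2"
  using L2_cmult[OF assms, of a] by (simp add: mult.commute)

lemma L2_divide [intro]: assumes "f \<in> L2" shows "(\<lambda>x. f x / a) \<in> L2"
  using L2_cmult'[OF assms, of "1/a"] by simp

lemma L2_uminus [intro]: assumes "f \<in> L2" shows "(\<lambda>x. - f x) \<in> L2"
  using L2_cmult[OF assms, of "-1"] by simp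

lemma L2_diff [intro]: assumes "f \<in> L2" "g \<in> L2" shows "(\<lambda>x. f x - g x) \<in> L2"
  using L2_add[OF assms(1) L2_uminus[OF assms(2)]] by simp

lemma L2_sum [intro]:
  assumes "\<And>k. k \<in> I \<Longrightarrow> f k \<in> L2" shows "(\<lambda>x. \<Sum>k\<in>I. f k x) \<in> L2"
proof (cases "finite I")
  case True
  then show ?thesis using assms
  proof (induction I rule: finite_induct)
    case empty show ?case by (auto intro!: L2_I)
  next
    case (insert a I) then show ?case by auto
  qed
next
  case False then show ?thesis by (auto intro!: L2_I)
qed

lemma continuous_on_unit_bounded:
  fixes \<rho> :: "real \<Rightarrow> real" assumes \<rho>: "continuous_on {0..1} \<rho>"
  obtains M where "\<And>x. x \<in> {0..1} \<Longrightarrow> \<bar>\<rho> x\<bar> \<le> M"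
proof -
  have "bounded (\<rho> ` {0..1})"
    using compact_continuous_image[OF \<rho>] compact_imp_bounded by blast
  then obtain M where "\<forall>y\<in>\<rho> ` {0..1}. norm y \<le> M" unfolding bounded_iff by blast
  then have "\<bar>\<rho> x\<bar> \<le> M" if "x \<in> {0..1}" for x using that by simp
  then show ?thesis by (rule that)
qed

lemma L2_mult_continuous:
  assumes f: "f \<in> L2" and \<rho>: "continuous_on {0..1} \<rho>"
  shows "(\<lambda>x. \<rho> x * f x) \<in> L2"
proof (rule L2_I)
  have m: "\<rho> \<in> borel_measurable leb01"
    by (rule continuous_imp_measurable_on_sets_lebesgue[OF \<rho>]) auto
  show 1: "(\<lambda>x. \<rho> x * f x) \<in> borel_measurable leb01"
    using f m by (auto simp: L2_def)
  obtain M where M: "\<And>x. x \<in> {0..1} \<Longrightarrow> \<bar>\<rho> x\<bar> \<le> M"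
    using continuous_on_unit_bounded[OF \<rho>] by blast
  show "integrable leb01 (\<lambda>x. (\<rho> x * f x)\<^sup>2)"
  proof (rule Bochner_Integration.integrable_bound)
    show "integrable leb01 (\<lambda>x. M\<^sup>2 * (f x)\<^sup>2)" using f by (auto simp: L2_def)
    show "(\<lambda>x. (\<rho> x * f x)\<^sup>2) \<in> borel_measurable leb01" using 1 by simp
    show "AE x in leb01. norm ((\<rho> x * f x)\<^sup>2) \<le> norm (M\<^sup>2 * (f x)\<^sup>2)"
    proof (rule AE_I2)
      fix x assume "x \<in> space leb01"
      then have "\<bar>\<rho> x\<bar> \<le> M" using M by simp
      then have "(\<rho> x)\<^sup>2 \<le> M\<^sup>2" by (simp add: abs_le_square_iff[symmetric])
      then show "norm ((\<rho> x * f x)\<^sup>2) \<le> norm (M\<^sup>2 * (f x)\<^sup>2)"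
        by (simp add: power_mult_distrib mult_right_mono)
    qed
  qed
qed

lemma L2_const [intro]: "(\<lambda>x. a) \<in> L2"
  by (auto intro!: L2_I)

lemma L2_continuous: "continuous_on {0..1} f \<Longrightarrow> f \<in> L2"
  using L2_mult_continuous[OF L2_const[of 1], of f] by simp

lemma L2_integrable: "f \<in> L2 \<Longrightarrow> integrable leb01 f"
  using L2_mult_integrable[OF _ L2_const[of 1], of f] by simp

lemma ip_cong:
  assumes "\<And>x. x \<in> {0..1} \<Longrightarrow> f x * g x = f' x * g' x" shows "ip f g = ip f' g'"
  unfolding ip_def using assms by (intro Bochner_Integration.integral_cong) auto

lemma ip_add_left: "f \<in> L2 \<Longrightarrow> g \<in> L2 \<Longrightarrow> k \<in> L2 \<Longrightarrow> ip (\<lambda>x. f x + g x) k = ip f k + ip g k"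
  unfolding ip_def by (simp add: distrib_right L2_mult_integrable)

lemma ip_diff_left: "f \<in> L2 \<Longrightarrow> g \<in> L2 \<Longrightarrow> k \<in> L2 \<Longrightarrow> ip (\<lambda>x. f x - g x) k = ip f k - ip g k"
  unfolding ip_def by (simp add: left_diff_distrib L2_mult_integrable)

lemma ip_add_right: "f \<in> L2 \<Longrightarrow> g \<in> L2 \<Longrightarrow> k \<in> L2 \<Longrightarrow> ip k (\<lambda>x. f x + g x) = ip k f + ip k g"
  by (simp add: ip_commute[of k] ip_add_left)

lemma ip_diff_right: "f \<in> L2 \<Longrightarrow> g \<in> L2 \<Longrightarrow> k \<in> L2 \<Longrightarrow> ip k (\<lambda>x. f x - g x) = ip k f - ip k g"
  by (simp add: ip_commute[of k] ip_diff_left)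

lemma ip_cmult_left: "ip (\<lambda>x. a * f x) k = a * ip f k"
  unfolding ip_def by (simp add: mult.assoc)

lemma ip_cmult_right: "ip k (\<lambda>x. a * f x) = a * ip k f"
  by (simp add: ip_commute[of k] ip_cmult_left)

lemma ip_divide_left: "ip (\<lambda>x. f x / a) k = ip f k / a"
  using ip_cmult_left[of "1/a" f k] by simp

lemma ip_divide_right: "ip k (\<lambda>x. f x / a) = ip k f / a"
  using ip_cmult_right[of k "1/a" f] by simp

lemma ip_sum_left:
  assumes "\<And>k. k \<in> I \<Longrightarrow> f k \<in> L2" "g \<in> L2"
  shows "ip (\<lambda>x. \<Sum>k\<in>I. f k x) g = (\<Sum>k\<in>I. ip (f k) g)"
  unfolding ip_def sum_distrib_right
  by (rule Bochner_Integration.integral_sum) (use assms L2_mult_integrable in auto)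

lemma ip_self_nonneg: "0 \<le> ip f f"
  unfolding ip_def by simp

lemma L2_nrm_nonneg [simp]: "0 \<le> L2_nrm f"
  unfolding L2_nrm_def by simp

lemma L2_nrm_sq: "(L2_nrm f)\<^sup>2 = ip f f"
  unfolding L2_nrm_def ip_def by (simp add: power2_eq_square)

lemma L2_nrm_cong: assumes "\<And>x. x \<in> {0..1} \<Longrightarrow> f x = g x" shows "L2_nrm f = L2_nrm g"
  unfolding L2_nrm_def using assms by (intro arg_cong[where f=sqrt] Bochner_Integration.integral_cong) auto

lemma L2_nrm_cmult: "L2_nrm (\<lambda>x. a * f x) = \<bar>a\<bar> * L2_nrm f"
  unfolding L2_nrm_def by (simp add: power_mult_distrib real_sqrt_mult)

lemma cauchy_schwarz:
  assumes "f \<in> L2" "g \<in> L2" shows "\<bar>ip f g\<bar> \<le> L2_nrm f * L2_nrm g"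
proof -
  have q: "0 \<le> ip f f - 2 * a * ip f g + a\<^sup>2 * ip g g" for a
  proof -
    have "0 \<le> ip (\<lambda>x. f x - a * g x) (\<lambda>x. f x - a * g x)" by (rule ip_self_nonneg)
    also have "\<dots> = ip f f - 2 * a * ip f g + a\<^sup>2 * ip g g"
      using assms
      by (simp add: ip_diff_left ip_diff_right L2_diff L2_cmult ip_cmult_left ip_cmult_right
            ip_commute[of g f] power2_eq_square algebra_simps)
    finally show ?thesis .
  qed
  have "(ip f g)\<^sup>2 \<le> ip f f * ip g g"
  proof (cases "ip g g = 0")
    case True
    have "ip f g = 0"
    proof (rule ccontr)
      assume "ip f g \<noteq> 0"
      then show False
        using q[of "(ip f f + 1) / (2 * ip f g)"] True by (simp add: field_simps)
    qed
    then show ?thesis using True by simp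
  next
    case False
    then have "0 < ip g g" using ip_self_nonneg[of g] by simp
    then show ?thesis
      using q[of "ip f g / ip g g"] by (simp add: field_simps power2_eq_square)
  qed
  then have "(ip f g)\<^sup>2 \<le> (L2_nrm f * L2_nrm g)\<^sup>2"
    by (simp add: power_mult_distrib L2_nrm_sq)
  then show ?thesis
    by (simp add: abs_le_square_iff[symmetric])
qed

lemma L2_nrm_triangle:
  assumes "f \<in> L2" "g \<in> L2" shows "L2_nrm (\<lambda>x. f x + g x) \<le> L2_nrm f + L2_nrm g"
proof (rule power2_le_imp_le)
  have "(L2_nrm (\<lambda>x. f x + g x))\<^sup>2 = (L2_nrm f)\<^sup>2 + 2 * ip f g + (L2_nrm g)\<^sup>2"
    using assms by (simp add: L2_nrm_sq ip_add_left ip_add_right L2_add ip_commute[of g f])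
  also have "\<dots> \<le> (L2_nrm f + L2_nrm g)\<^sup>2"
    using cauchy_schwarz[OF assms] by (simp add: power2_sum)
  finally show "(L2_nrm (\<lambda>x. f x + g x))\<^sup>2 \<le> (L2_nrm f + L2_nrm g)\<^sup>2" .
qed simp

lemma leb01_reflect:
  "has_bochner_integral leb01 (\<lambda>x. f (1 - x)) i \<longleftrightarrow> has_bochner_integral leb01 f (i::real)"
proof -
  have eq: "indicator {0..1} (1 + (-1) * x) *\<^sub>R f (1 + (-1) * x) = indicator {0..1::real} x *\<^sub>R f (1 - x)" for x
    by (auto simp: indicator_def)
  show ?thesis
    using has_bochner_integral_lebesgue_real_affine_iff [of "-1" "\<lambda>x. indicator {0..1} x *\<^sub>R f x" i 1]
    unfolding eq by (simp add: has_bochner_integral_restrict_space)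
qed

lemma integral_leb01_reflect: "(LINT x|leb01. f (1 - x)) = (LINT x|leb01. (f x :: real))"
  using leb01_reflect[of f] by (metis has_bochner_integral_iff not_integrable_integral_eq)

lemma L2_reflect: assumes "f \<in> L2" shows "(\<lambda>x. f (1 - x)) \<in> L2"
proof (rule L2_I)
  have "integrable leb01 f" by (rule L2_integrable[OF assms])
  then have "integrable leb01 (\<lambda>x. f (1 - x))"
    using leb01_reflect[of f] by (metis has_bochner_integral_iff)
  then show "(\<lambda>x. f (1 - x)) \<in> borel_measurable leb01" by auto
  have "integrable leb01 (\<lambda>x. (f x)\<^sup>2)" using assms by (simp add: L2_def)
  then show "integrable leb01 (\<lambda>x. (f (1 - x))\<^sup>2)"
    using leb01_reflect[of "\<lambda>x. (f x)\<^sup>2"] by (metis has_bochner_integral_iff)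
qed

lemma L2_nrm_reflect: "L2_nrm (\<lambda>x. f (1 - x)) = L2_nrm f"
  unfolding L2_nrm_def using integral_leb01_reflect[of "\<lambda>x. (f x)\<^sup>2"] by simp

section \<open>Convergence and differentiation in \<open>L2\<close>\<close>

text \<open>Membership in \<open>L2\<close> is required only eventually: difference quotients and time averages are
  square-integrable only for the admissible parameters.\<close>

definition L2_tendsto :: "('a \<Rightarrow> real \<Rightarrow> real) \<Rightarrow> (real \<Rightarrow> real) \<Rightarrow> 'a filter \<Rightarrow> bool" where
  "L2_tendsto f g F \<longleftrightarrow> g \<in> L2 \<and> (\<forall>\<^sub>F s in F. f s \<in> L2) \<and>
     ((\<lambda>s. L2_nrm (\<lambda>x. f s x - g x)) \<longlongrightarrow> 0) F"

lemma L2_tendsto_add: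
  assumes "L2_tendsto f f' F" "L2_tendsto g g' F"
  shows "L2_tendsto (\<lambda>s x. f s x + g s x) (\<lambda>x. f' x + g' x) F"
  unfolding L2_tendsto_def
proof (intro conjI)
  show "(\<lambda>x. f' x + g' x) \<in> L2" using assms by (auto simp: L2_tendsto_def)
  have ev: "\<forall>\<^sub>F s in F. f s \<in> L2" "\<forall>\<^sub>F s in F. g s \<in> L2" using assms by (auto simp: L2_tendsto_def)
  show "\<forall>\<^sub>F s in F. (\<lambda>x. f s x + g s x) \<in> L2"
    using ev by eventually_elim auto
  show "((\<lambda>s. L2_nrm (\<lambda>x. f s x + g s x - (f' x + g' x))) \<longlongrightarrow> 0) F"
  proof (rule tendsto_sandwich[where f="\<lambda>_. 0"])
    show "((\<lambda>s. L2_nrm (\<lambda>x. f s x - f' x) + L2_nrm (\<lambda>x. g s x - g' x)) \<longlongrightarrow> 0) F"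
      using assms by (auto simp: L2_tendsto_def intro!: tendsto_add_zero)
    show "\<forall>\<^sub>F s in F. L2_nrm (\<lambda>x. f s x + g s x - (f' x + g' x))
        \<le> L2_nrm (\<lambda>x. f s x - f' x) + L2_nrm (\<lambda>x. g s x - g' x)"
      using ev
    proof eventually_elim
      case (elim s)
      have "L2_nrm (\<lambda>x. (f s x - f' x) + (g s x - g' x))
        \<le> L2_nrm (\<lambda>x. f s x - f' x) + L2_nrm (\<lambda>x. g s x - g' x)"
        using elim assms by (intro L2_nrm_triangle) (auto simp: L2_tendsto_def)
      then show ?case by (simp add: algebra_simps)
    qed
  qed auto
qed

lemma L2_tendsto_const: "g \<in> L2 \<Longrightarrow> L2_tendsto (\<lambda>s. g) g F"
  by (simp add: L2_tendsto_def L2_nrm_def)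

lemma L2_tendsto_reflect:
  assumes "L2_tendsto f g F" shows "L2_tendsto (\<lambda>s x. f s (1 - x)) (\<lambda>x. g (1 - x)) F"
  unfolding L2_tendsto_def
proof (intro conjI)
  show "(\<lambda>x. g (1 - x)) \<in> L2" using assms L2_reflect by (auto simp: L2_tendsto_def)
  show "\<forall>\<^sub>F s in F. (\<lambda>x. f s (1 - x)) \<in> L2"
    using assms L2_reflect by (auto simp: L2_tendsto_def elim!: eventually_mono)
  show "((\<lambda>s. L2_nrm (\<lambda>x. f s (1 - x) - g (1 - x))) \<longlongrightarrow> 0) F"
    using assms L2_nrm_reflect[of "\<lambda>x. f s x - g x" for s] by (auto simp: L2_tendsto_def)
qed

lemma L2_tendsto_weight:
  assumes f: "L2_tendsto f f' F" and \<rho>: "continuous_on {0..1} \<rho>"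
  shows "L2_tendsto (\<lambda>s x. \<rho> x * f s x) (\<lambda>x. \<rho> x * f' x) F"
proof -
  obtain M where M: "\<And>x. x \<in> {0..1} \<Longrightarrow> \<bar>\<rho> x\<bar> \<le> M"
    using continuous_on_unit_bounded[OF \<rho>] by blast
  have "\<bar>\<rho> 0\<bar> \<le> M" by (rule M) simp
  then have "0 \<le> M" by linarith
  have b: "L2_nrm (\<lambda>x. \<rho> x * g x) \<le> M * L2_nrm g" if g: "g \<in> L2" for g
  proof -
    have "(LINT x|leb01. (\<rho> x * g x)\<^sup>2) \<le> (LINT x|leb01. (M * g x)\<^sup>2)"
    proof (rule integral_mono)
      show "integrable leb01 (\<lambda>x. (\<rho> x * g x)\<^sup>2)" "integrable leb01 (\<lambda>x. (M * g x)\<^sup>2)"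
        using L2_mult_continuous[OF g \<rho>] L2_cmult[OF g] by (auto simp: L2_def)
      fix x assume "x \<in> space leb01"
      then show "(\<rho> x * g x)\<^sup>2 \<le> (M * g x)\<^sup>2"
        unfolding power_mult_distrib using M[of x] \<open>0 \<le> M\<close>
        by (intro mult_right_mono) (auto simp: abs_le_square_iff[symmetric])
    qed
    then have "L2_nrm (\<lambda>x. \<rho> x * g x) \<le> L2_nrm (\<lambda>x. M * g x)"
      unfolding L2_nrm_def by simp
    then show ?thesis using \<open>0 \<le> M\<close> by (simp add: L2_nrm_cmult)
  qed
  have ev: "\<forall>\<^sub>F s in F. f s \<in> L2" "f' \<in> L2" using f by (auto simp: L2_tendsto_def)
  show ?thesis unfolding L2_tendsto_def
  proof (intro conjI)
    show "(\<lambda>x. \<rho> x * f' x) \<in> L2" using ev \<rho> L2_mult_continuous by auto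
    show "\<forall>\<^sub>F s in F. (\<lambda>x. \<rho> x * f s x) \<in> L2"
      using ev(1) by eventually_elim (use \<rho> L2_mult_continuous in auto)
    show "((\<lambda>s. L2_nrm (\<lambda>x. \<rho> x * f s x - \<rho> x * f' x)) \<longlongrightarrow> 0) F"
    proof (rule tendsto_sandwich[where f="\<lambda>_. 0"])
      show "((\<lambda>s. M * L2_nrm (\<lambda>x. f s x - f' x)) \<longlongrightarrow> 0) F"
        using f by (auto simp: L2_tendsto_def intro!: tendsto_mult_right_zero)
      show "\<forall>\<^sub>F s in F. L2_nrm (\<lambda>x. \<rho> x * f s x - \<rho> x * f' x) \<le> M * L2_nrm (\<lambda>x. f s x - f' x)"
        using ev(1)
      proof eventually_elim
        case (elim s)
        then show ?case using b[of "\<lambda>x. f s x - f' x"] ev(2) by (auto simp: algebra_simps)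
      qed
    qed auto
  qed
qed

lemmas L2_tendsto_cmult = L2_tendsto_weight[OF _ continuous_on_const]

lemma L2_tendsto_ip:
  assumes f: "L2_tendsto f f' F" and g: "L2_tendsto g g' F"
  shows "((\<lambda>s. ip (f s) (g s)) \<longlongrightarrow> ip f' g') F"
proof -
  have ev: "\<forall>\<^sub>F s in F. f s \<in> L2" "f' \<in> L2" "\<forall>\<^sub>F s in F. g s \<in> L2" "g' \<in> L2"
    using f g by (auto simp: L2_tendsto_def)
  let ?a = "\<lambda>s. L2_nrm (\<lambda>x. f s x - f' x)" and ?b = "\<lambda>s. L2_nrm (\<lambda>x. g s x - g' x)"
  have "((\<lambda>s. ip (f s) (g s) - ip f' g') \<longlongrightarrow> 0) F"
  proof (rule Lim_null_comparison)
    have ab: "(?a \<longlongrightarrow> 0) F" "(?b \<longlongrightarrow> 0) F" using f g by (auto simp: L2_tendsto_def)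
    show "((\<lambda>s. ?a s * ?b s + L2_nrm f' * ?b s + ?a s * L2_nrm g') \<longlongrightarrow> 0) F"
      using tendsto_add[OF tendsto_add[OF tendsto_mult[OF ab] tendsto_mult[OF tendsto_const[of "L2_nrm f'"] ab(2)]]
         tendsto_mult[OF ab(1) tendsto_const[of "L2_nrm g'"]]] by simp
    show "\<forall>\<^sub>F s in F. norm (ip (f s) (g s) - ip f' g') \<le> ?a s * ?b s + L2_nrm f' * ?b s + ?a s * L2_nrm g'"
      using ev(1,3)
    proof eventually_elim
      case (elim s)
      let ?p = "\<lambda>x. f s x - f' x" and ?q = "\<lambda>x. g s x - g' x"
      have L: "?p \<in> L2" "?q \<in> L2" using elim ev by auto
      have "ip (f s) (g s) - ip f' g' = ip ?p ?q + ip f' ?q + ip ?p g'"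
        using elim ev by (simp add: ip_diff_left ip_diff_right L2_diff)
      then show ?case
        using cauchy_schwarz[OF L] cauchy_schwarz[OF ev(2) L(2)] cauchy_schwarz[OF L(1) ev(4)]
        by simp
    qed
  qed
  then show ?thesis by (simp add: LIM_zero_iff)
qed

text \<open>Differentiability of an \<open>L2\<close>-valued curve on the half-line, hence one-sided at time \<open>0\<close>.\<close>

definition L2_deriv :: "(real \<Rightarrow> real \<Rightarrow> real) \<Rightarrow> (real \<Rightarrow> real) \<Rightarrow> real \<Rightarrow> bool" where
  "L2_deriv f f' t \<longleftrightarrow> (\<forall>s\<ge>0. f s \<in> L2) \<and>
     L2_tendsto (\<lambda>s x. (f s x - f t x) / (s - t)) f' (at t within {0..})"

lemma L2_deriv_imp_tendsto:
  assumes d: "L2_deriv f f' t" and t: "0 \<le> t"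
  shows "L2_tendsto f (f t) (at t within {0..})"
proof -
  have L: "f' \<in> L2" "\<And>s. 0 \<le> s \<Longrightarrow> f s \<in> L2" using d by (auto simp: L2_deriv_def L2_tendsto_def)
  have ev: "\<forall>\<^sub>F s in at t within {0..}. f s \<in> L2"
    by (auto simp: eventually_at_filter L intro!: always_eventually)
  show ?thesis unfolding L2_tendsto_def
  proof (intro conjI)
    show "f t \<in> L2" using L t by simp
    show "\<forall>\<^sub>F s in at t within {0..}. f s \<in> L2" by (rule ev)
    show "((\<lambda>s. L2_nrm (\<lambda>x. f s x - f t x)) \<longlongrightarrow> 0) (at t within {0..})"
    proof (rule tendsto_sandwich[where f="\<lambda>_. 0"])
      let ?e = "\<lambda>s. L2_nrm (\<lambda>x. (f s x - f t x) / (s - t) - f' x)"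
      have "((\<lambda>s. \<bar>s - t\<bar> * (?e s + L2_nrm f')) \<longlongrightarrow> \<bar>t - t\<bar> * (0 + L2_nrm f')) (at t within {0..})"
        using d by (intro tendsto_intros) (auto simp: L2_deriv_def L2_tendsto_def)
      then show "((\<lambda>s. \<bar>s - t\<bar> * (?e s + L2_nrm f')) \<longlongrightarrow> 0) (at t within {0..})" by simp
      have "\<forall>\<^sub>F s in at t within {0..}. s \<noteq> t" by (auto simp: eventually_at_filter)
      then show "\<forall>\<^sub>F s in at t within {0..}. L2_nrm (\<lambda>x. f s x - f t x) \<le> \<bar>s - t\<bar> * (?e s + L2_nrm f')"
        using ev
      proof eventually_elim
        case (elim s)
        have "L2_nrm (\<lambda>x. f s x - f t x) = L2_nrm (\<lambda>x. (s - t) * ((((f s x - f t x) / (s - t)) - f' x) + f' x))"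
          using elim by (intro L2_nrm_cong) simp
        also have "\<dots> = \<bar>s - t\<bar> * L2_nrm (\<lambda>x. (((f s x - f t x) / (s - t)) - f' x) + f' x)"
          by (rule L2_nrm_cmult)
        also have "\<dots> \<le> \<bar>s - t\<bar> * (?e s + L2_nrm f')"
          using elim L t by (intro mult_left_mono L2_nrm_triangle L2_diff L2_divide) auto
        finally show ?case .
      qed
    qed auto
  qed
qed

lemma L2_deriv_ip:
  assumes f: "L2_deriv f f' t" and g: "L2_deriv g g' t" and t: "0 \<le> t"
  shows "((\<lambda>s. ip (f s) (g s)) has_real_derivative (ip f' (g t) + ip (f t) g')) (at t within {0..})"
  unfolding has_field_derivative_iff
proof -
  let ?F = "at t within {0..}"
  have L: "\<And>s. 0 \<le> s \<Longrightarrow> f s \<in> L2" "\<And>s. 0 \<le> s \<Longrightarrow> g s \<in> L2"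
    using f g by (auto simp: L2_deriv_def)
  have "((\<lambda>s. ip (\<lambda>x. (f s x - f t x) / (s - t)) (g s) + ip (f t) (\<lambda>x. (g s x - g t x) / (s - t)))
     \<longlongrightarrow> ip f' (g t) + ip (f t) g') ?F"
    using f g L2_deriv_imp_tendsto[OF g t] L(1)[OF t]
    by (intro tendsto_add L2_tendsto_ip L2_tendsto_const) (auto simp: L2_deriv_def)
  moreover have "\<forall>\<^sub>F s in ?F. ip (\<lambda>x. (f s x - f t x) / (s - t)) (g s) + ip (f t) (\<lambda>x. (g s x - g t x) / (s - t))
     = (ip (f s) (g s) - ip (f t) (g t)) / (s - t)"
    unfolding eventually_at_filter
  proof (intro always_eventually allI impI)
    fix s assume "s \<noteq> t" "s \<in> {0..}"
    then show "ip (\<lambda>x. (f s x - f t x) / (s - t)) (g s) + ip (f t) (\<lambda>x. (g s x - g t x) / (s - t))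
     = (ip (f s) (g s) - ip (f t) (g t)) / (s - t)"
      using L t by (simp add: ip_divide_left ip_divide_right ip_diff_left ip_diff_right
         add_divide_distrib[symmetric])
  qed
  ultimately show "((\<lambda>s. (ip (f s) (g s) - ip (f t) (g t)) / (s - t)) \<longlongrightarrow> ip f' (g t) + ip (f t) g') ?F"
    by (rule Lim_transform_eventually)
qed

lemma L2_deriv_add:
  assumes "L2_deriv f f' t" "L2_deriv g g' t"
  shows "L2_deriv (\<lambda>s x. f s x + g s x) (\<lambda>x. f' x + g' x) t"
proof -
  have "L2_tendsto (\<lambda>s x. (f s x - f t x) / (s - t) + (g s x - g t x) / (s - t)) (\<lambda>x. f' x + g' x) (at t within {0..})"
    using assms L2_tendsto_add by (auto simp: L2_deriv_def)
  moreover have "(\<lambda>s x. (f s x - f t x) / (s - t) + (g s x - g t x) / (s - t))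
     = (\<lambda>s x. (f s x + g s x - (f t x + g t x)) / (s - t))"
    by (auto simp: fun_eq_iff add_divide_distrib[symmetric] algebra_simps)
  ultimately show ?thesis using assms by (auto simp: L2_deriv_def)
qed

lemma L2_deriv_weight:
  assumes "L2_deriv f f' t" "continuous_on {0..1} \<rho>"
  shows "L2_deriv (\<lambda>s x. \<rho> x * f s x) (\<lambda>x. \<rho> x * f' x) t"
proof -
  have "L2_tendsto (\<lambda>s x. \<rho> x * ((f s x - f t x) / (s - t))) (\<lambda>x. \<rho> x * f' x) (at t within {0..})"
    using assms by (intro L2_tendsto_weight) (simp_all add: L2_deriv_def)
  moreover have "(\<lambda>s x. \<rho> x * ((f s x - f t x) / (s - t))) = (\<lambda>s x. (\<rho> x * f s x - \<rho> x * f t x) / (s - t))"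
    by (auto simp: fun_eq_iff algebra_simps)
  ultimately show ?thesis using assms L2_mult_continuous by (auto simp: L2_deriv_def)
qed

lemmas L2_deriv_cmult = L2_deriv_weight[OF _ continuous_on_const]

lemma L2_deriv_reflect:
  assumes "L2_deriv f f' t" shows "L2_deriv (\<lambda>s x. f s (1 - x)) (\<lambda>x. f' (1 - x)) t"
  unfolding L2_deriv_def
proof
  show "\<forall>s\<ge>0. (\<lambda>x. f s (1 - x)) \<in> L2"
    using assms L2_reflect unfolding L2_deriv_def by blast
  have "L2_tendsto (\<lambda>s x. (f s x - f t x) / (s - t)) f' (at t within {0..})"
    using assms unfolding L2_deriv_def by blast
  from L2_tendsto_reflect[OF this]
  show "L2_tendsto (\<lambda>s x. (f s (1 - x) - f t (1 - x)) / (s - t)) (\<lambda>x. f' (1 - x)) (at t within {0..})" .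
qed

lemma L2_tendsto_neighbourhood:
  fixes t :: real
  assumes "L2_tendsto g (g t) (at t within {0..})" "0 < e"
  obtains d where "d > 0" "\<And>s. 0 \<le> s \<Longrightarrow> \<bar>s - t\<bar> < d \<Longrightarrow> L2_nrm (\<lambda>x. g s x - g t x) \<le> e"
proof -
  have "\<forall>\<^sub>F s in at t within {0..}. L2_nrm (\<lambda>x. g s x - g t x) < e"
    using assms by (intro order_tendstoD(2)[of _ 0]) (auto simp: L2_tendsto_def)
  then obtain d where d: "d > 0"
    "\<And>s. 0 \<le> s \<Longrightarrow> s \<noteq> t \<Longrightarrow> \<bar>s - t\<bar> < d \<Longrightarrow> L2_nrm (\<lambda>x. g s x - g t x) < e"
    unfolding eventually_at dist_real_def by auto
  have "L2_nrm (\<lambda>x. g s x - g t x) \<le> e" if "0 \<le> s" "\<bar>s - t\<bar> < d" for s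
  proof (cases "s = t")
    case True then show ?thesis using assms(2) by (simp add: L2_nrm_def)
  next
    case False then show ?thesis using d(2)[of s] that by simp
  qed
  then show ?thesis using d(1) that by blast
qed

lemma ip_diff_bound:
  assumes "f \<in> L2" "g \<in> L2" "\<psi> \<in> L2"
  shows "\<bar>ip f \<psi> - ip g \<psi>\<bar> \<le> L2_nrm (\<lambda>x. f x - g x) * L2_nrm \<psi>"
  unfolding ip_diff_left[OF assms, symmetric] by (rule cauchy_schwarz[OF L2_diff[OF assms(1,2)] assms(3)])

lemma L2_nrm_le_if_dual:
  assumes "(L2_nrm f)\<^sup>2 \<le> e * L2_nrm f" "0 \<le> e" shows "L2_nrm f \<le> e"
proof (cases "L2_nrm f = 0")
  case False
  then have "0 < L2_nrm f" by (simp add: less_le)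
  then show ?thesis using assms(1) by (simp add: power2_eq_square)
qed (use assms(2) in simp)

section \<open>Primitives and weak derivatives\<close>

lemma L2_abs_integrable: "f \<in> L2 \<Longrightarrow> f absolutely_integrable_on {0..1}"
  using L2_integrable[of f] by (simp add: absolutely_integrable_measurable comp_def)

lemma L2_integrable_on:
  assumes "f \<in> L2" "0 \<le> a" "b \<le> 1" shows "f integrable_on {a..b}"
proof -
  have "f integrable_on {0..1}"
    using L2_abs_integrable[OF assms(1)] by (simp add: absolutely_integrable_on_def)
  then show ?thesis by (rule integrable_on_subinterval) (use assms in auto)
qed

lemma L2_sq_integrable_on:
  assumes "f \<in> L2" "g \<in> L2" "0 \<le> a" "b \<le> 1" shows "(\<lambda>x. f x * g x) integrable_on {a..b}"
proof -
  have "(\<lambda>x. f x * g x) integrable_on {0..1}"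
    by (rule integrable_on_lebesgue_on[OF L2_mult_integrable[OF assms(1,2)]]) simp
  then show ?thesis by (rule integrable_on_subinterval) (use assms in auto)
qed

lemma L2_abs: "f \<in> L2 \<Longrightarrow> (\<lambda>x. \<bar>f x\<bar>) \<in> L2"
  by (auto simp: L2_def)

lemma ip_eq_integral:
  assumes "f \<in> L2" "g \<in> L2" shows "ip f g = integral {0..1} (\<lambda>x. f x * g x)"
  unfolding ip_def by (rule lebesgue_integral_eq_integral[OF L2_mult_integrable[OF assms]]) simp

lemma ip_one_eq_integral: "f \<in> L2 \<Longrightarrow> ip f (\<lambda>x. 1) = integral {0..1} f"
  by (simp add: ip_eq_integral L2_const)

text \<open>\<open>f\<close> is the absolutely continuous function with the square-integrable derivative \<open>g\<close>. For
  continuous \<open>f\<close> this is the same as having \<open>g\<close> as weak derivative (\<open>weak_deriv_primitive\<close>), but it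
  gives access to point values.\<close>

definition primitive :: "(real \<Rightarrow> real) \<Rightarrow> (real \<Rightarrow> real) \<Rightarrow> bool" where
  "primitive f g \<longleftrightarrow> g \<in> L2 \<and> (\<forall>x\<in>{0..1}. f x = f 0 + integral {0..x} g)"

lemma primitive_L2: "primitive f g \<Longrightarrow> g \<in> L2"
  by (simp add: primitive_def)

lemma primitiveD: "primitive f g \<Longrightarrow> x \<in> {0..1} \<Longrightarrow> f x = f 0 + integral {0..x} g"
  unfolding primitive_def by blast

lemma primitive_integral: "g \<in> L2 \<Longrightarrow> primitive (\<lambda>x. a + integral {0..x} g) g"
  by (simp add: primitive_def)

lemma primitive_diff_eq:
  assumes "primitive f g" "0 \<le> x" "x \<le> y" "y \<le> 1"
  shows "f y - f x = integral {x..y} g"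
proof -
  have "integral {0..x} g + integral {x..y} g = integral {0..y} g"
    using assms(2-) primitive_L2[OF assms(1)]
    by (intro Henstock_Kurzweil_Integration.integral_combine L2_integrable_on) auto
  moreover have "f x = f 0 + integral {0..x} g" "f y = f 0 + integral {0..y} g"
    using primitiveD[OF assms(1), of x] primitiveD[OF assms(1), of y] assms(2-) by auto
  ultimately show ?thesis by simp
qed

lemma primitive_continuous: assumes "primitive f g" shows "continuous_on {0..1} f"
proof -
  have "continuous_on {0..1} (\<lambda>x. f 0 + integral {0..x} g)"
    using primitive_L2[OF assms]
    by (intro continuous_on_add continuous_on_const indefinite_integral_continuous_1 L2_integrable_on) auto
  then show ?thesis
    by (rule continuous_on_eq) (rule primitiveD[OF assms, symmetric])
qed

lemma primitive_in_L2: "primitive f g \<Longrightarrow> f \<in> L2"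
  by (intro L2_continuous primitive_continuous)

lemma primitive_add:
  assumes "primitive f f'" "primitive g g'"
  shows "primitive (\<lambda>x. f x + g x) (\<lambda>x. f' x + g' x)"
  unfolding primitive_def
proof
  have L: "f' \<in> L2" "g' \<in> L2" using assms primitive_L2 by blast+
  show "(\<lambda>x. f' x + g' x) \<in> L2" using L by (rule L2_add)
  show "\<forall>x\<in>{0..1}. f x + g x = f 0 + g 0 + integral {0..x} (\<lambda>x. f' x + g' x)"
  proof
    fix x :: real assume x: "x \<in> {0..1}"
    have "integral {0..x} (\<lambda>x. f' x + g' x) = integral {0..x} f' + integral {0..x} g'"
      using x L by (intro Henstock_Kurzweil_Integration.integral_add L2_integrable_on) auto
    moreover have "f x = f 0 + integral {0..x} f'" "g x = g 0 + integral {0..x} g'"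
      using primitiveD[OF assms(1) x] primitiveD[OF assms(2) x] .
    ultimately show "f x + g x = f 0 + g 0 + integral {0..x} (\<lambda>x. f' x + g' x)" by simp
  qed
qed

lemma primitive_cmult:
  assumes "primitive f f'" shows "primitive (\<lambda>x. a * f x) (\<lambda>x. a * f' x)"
  unfolding primitive_def
proof
  show "(\<lambda>x. a * f' x) \<in> L2" using primitive_L2[OF assms] by (rule L2_cmult)
  show "\<forall>x\<in>{0..1}. a * f x = a * f 0 + integral {0..x} (\<lambda>x. a * f' x)"
  proof
    fix x :: real assume x: "x \<in> {0..1}"
    show "a * f x = a * f 0 + integral {0..x} (\<lambda>x. a * f' x)"
      unfolding primitiveD[OF assms x] by (simp add: distrib_left)
  qed
qed

lemma primitive_diff:
  assumes "primitive f f'" "primitive g g'"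
  shows "primitive (\<lambda>x. f x - g x) (\<lambda>x. f' x - g' x)"
  using primitive_add[OF assms(1) primitive_cmult[OF assms(2), of "-1"]] by simp

lemma primitive_C1:
  assumes "\<And>x. x \<in> {0..1} \<Longrightarrow> (f has_real_derivative g x) (at x)" "continuous_on {0..1} g"
  shows "primitive f g"
  unfolding primitive_def
proof
  show "g \<in> L2" by (rule L2_continuous[OF assms(2)])
  show "\<forall>x\<in>{0..1}. f x = f 0 + integral {0..x} g"
  proof
    fix x :: real assume x: "x \<in> {0..1}"
    have "(g has_integral f x - f 0) {0..x}"
      using x assms(1)
      by (intro fundamental_theorem_of_calculus)
        (auto simp: has_real_derivative_iff_has_vector_derivative[symmetric]
          intro: has_field_derivative_at_within)
    then show "f x = f 0 + integral {0..x} g" by (simp add: integral_unique)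
  qed
qed

lemma primitive_reflect:
  assumes "primitive f g" shows "primitive (\<lambda>x. f (1 - x)) (\<lambda>x. - g (1 - x))"
  unfolding primitive_def
proof
  have g: "g \<in> L2" by (rule primitive_L2[OF assms])
  show "(\<lambda>x. - g (1 - x)) \<in> L2" by (intro L2_uminus L2_reflect g)
  show "\<forall>x\<in>{0..1}. f (1 - x) = f (1 - 0) + integral {0..x} (\<lambda>x. - g (1 - x))"
  proof
    fix x :: real assume x: "x \<in> {0..1}"
    have "(g has_integral (f 1 - f (1 - x))) {1 - x..1}"
      using primitive_diff_eq[OF assms, of "1 - x" 1] x L2_integrable_on[OF g, of "1 - x" 1]
      by (simp add: has_integral_iff)
    from has_integral_affinity[OF this[folded cbox_interval], of "-1" 1]
    have "((\<lambda>x. g (1 - x)) has_integral (f 1 - f (1 - x))) {0..x}"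
      using x by (simp add: image_affinity_cbox[of "-1::real", simplified] cong: if_cong)
    then have "integral {0..x} (\<lambda>x. - g (1 - x)) = - (f 1 - f (1 - x))"
      by (simp add: integral_unique)
    then show "f (1 - x) = f (1 - 0) + integral {0..x} (\<lambda>x. - g (1 - x))" by simp
  qed
qed

text \<open>Nonnegativity of the integral of \<open>(|g| - a)\<^sup>2\<close>, with \<open>a\<close> the mean of \<open>|g|\<close>. The factor \<open>y - x\<close> is what
  produces a vanishing derivative in the next lemma.\<close>

lemma integral_abs_sq_le:
  assumes g: "g \<in> L2" and xy: "0 \<le> x" "x < y" "y \<le> 1"
  shows "(integral {x..y} (\<lambda>s. \<bar>g s\<bar>))\<^sup>2 \<le> (y - x) * integral {x..y} (\<lambda>s. (g s)\<^sup>2)"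
proof -
  let ?\<phi> = "integral {x..y} (\<lambda>s. \<bar>g s\<bar>)" and ?E = "integral {x..y} (\<lambda>s. (g s)\<^sup>2)"
  \<comment> \<open>the mean value of \<open>|g|\<close>\<close>
  define a where "a = ?\<phi> / (y - x)"
  have 1: "((\<lambda>s. \<bar>g s\<bar>) has_integral ?\<phi>) {x..y}"
    using L2_integrable_on[OF L2_abs[OF g]] xy by (simp add: has_integral_iff)
  have 2: "((\<lambda>s. (g s)\<^sup>2) has_integral ?E) {x..y}"
    using L2_sq_integrable_on[OF g g] xy by (simp add: has_integral_iff power2_eq_square)
  have 3: "((\<lambda>s. a\<^sup>2) has_integral (y - x) * a\<^sup>2) {x..y}"
    using has_integral_const_real[of "a\<^sup>2" x y] xy by simp
  have "((\<lambda>s. ((g s)\<^sup>2 - (2 * a) * \<bar>g s\<bar>) + a\<^sup>2) has_integral ((?E - (2 * a) * ?\<phi>) + (y - x) * a\<^sup>2)) {x..y}"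
    by (intro has_integral_add has_integral_diff has_integral_mult_right 1 2 3)
  then have "0 \<le> (?E - (2 * a) * ?\<phi>) + (y - x) * a\<^sup>2"
  proof (rule has_integral_nonneg)
    fix s
    have "0 \<le> (\<bar>g s\<bar> - a)\<^sup>2" by simp
    then show "0 \<le> (g s)\<^sup>2 - (2 * a) * \<bar>g s\<bar> + a\<^sup>2"
      by (simp add: power2_diff algebra_simps)
  qed
  then have "0 \<le> (y - x) * ((?E - (2 * a) * ?\<phi>) + (y - x) * a\<^sup>2)" using xy by simp
  also have "\<dots> = (y - x) * ?E - 2 * (a * (y - x)) * ?\<phi> + (a * (y - x))\<^sup>2"
    by (simp add: power2_eq_square algebra_simps)
  also have "\<dots> = (y - x) * ?E - ?\<phi>\<^sup>2"
  proof -
    have a: "a * (y - x) = ?\<phi>" using xy by (simp add: a_def)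
    show ?thesis unfolding a by (simp add: power2_eq_square)
  qed
  finally show ?thesis by simp
qed

text \<open>There is no pointwise derivative of \<open>f\<close> to differentiate. Instead, let \<open>h\<close> be the difference of \<open>f\<^sup>2\<close>
  and the primitive of \<open>2 f g\<close>, and \<open>E\<close> the primitive of \<open>g\<^sup>2\<close>. Writing the increment of \<open>h\<close> as an integral of
  \<open>(f x + f y - 2 f s) g s\<close> shows \<open>|h y - h x| \<le> 2 |y - x| |E y - E x|\<close>, and \<open>E\<close> is continuous: \<open>h\<close> has
  derivative \<open>0\<close> everywhere and is constant.\<close>

lemma primitive_square:
  assumes f: "primitive f g" shows "primitive (\<lambda>x. (f x)\<^sup>2) (\<lambda>x. 2 * f x * g x)"
proof -
  have g: "g \<in> L2" by (rule primitive_L2[OF f])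
  have cf: "continuous_on {0..1} f" by (rule primitive_continuous[OF f])
  have fg: "(\<lambda>x. 2 * f x * g x) \<in> L2"
    by (intro L2_mult_continuous g continuous_intros cf)
  define h where "h x = (f x)\<^sup>2 - integral {0..x} (\<lambda>s. 2 * f s * g s)" for x
  define E where "E x = integral {0..x} (\<lambda>s. (g s)\<^sup>2)" for x
  have cE: "continuous_on {0..1} E"
    unfolding E_def
    using L2_sq_integrable_on[OF g g, of 0 1]
    by (intro indefinite_integral_continuous_1) (simp add: power2_eq_square)
  have key: "\<bar>h y - h x\<bar> \<le> 2 * (y - x) * (E y - E x)" if xy: "0 \<le> x" "x < y" "y \<le> 1" for x y
  proof -
    let ?\<phi> = "integral {x..y} (\<lambda>s. \<bar>g s\<bar>)"
    have ia: "(\<lambda>s. \<bar>g s\<bar>) integrable_on {a..b}" if "0 \<le> a" "b \<le> 1" for a b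
      using L2_integrable_on[OF L2_abs[OF g]] that by simp
    have sub: "\<bar>f q - f p\<bar> \<le> ?\<phi>" if "x \<le> p" "p \<le> q" "q \<le> y" for p q
    proof -
      have "\<bar>f q - f p\<bar> = \<bar>integral {p..q} g\<bar>"
        using primitive_diff_eq[OF f] that xy by simp
      also have "\<dots> \<le> integral {p..q} (\<lambda>s. \<bar>g s\<bar>)"
        using L2_integrable_on[OF g, of p q] ia[of p q] that xy
        by (intro integral_norm_bound_integral[where 'a=real, unfolded real_norm_def]) auto
      also have "\<dots> \<le> ?\<phi>"
        using that xy by (intro integral_subset_le ia) auto
      finally show ?thesis .
    qed
    have I1: "(g has_integral (f y - f x)) {x..y}"
      using primitive_diff_eq[OF f, of x y] L2_integrable_on[OF g, of x y] xy by (simp add: has_integral_iff)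
    have I2: "((\<lambda>s. 2 * f s * g s) has_integral
        (integral {0..y} (\<lambda>s. 2 * f s * g s) - integral {0..x} (\<lambda>s. 2 * f s * g s))) {x..y}"
      using primitive_diff_eq[OF primitive_integral[OF fg, of 0], of x y] L2_integrable_on[OF fg, of x y] xy
      by (simp add: has_integral_iff)
    have "((\<lambda>s. (f x + f y) * g s - 2 * f s * g s) has_integral (h y - h x)) {x..y}"
    proof -
      have "(f x + f y) * (f y - f x) - (integral {0..y} (\<lambda>s. 2 * f s * g s) - integral {0..x} (\<lambda>s. 2 * f s * g s))
        = h y - h x" unfolding h_def by (simp add: power2_eq_square algebra_simps)
      then show ?thesis using has_integral_diff[OF has_integral_mult_right[OF I1, of "f x + f y"] I2] by simp
    qed
    then have I3: "h y - h x = integral {x..y} (\<lambda>s. (f x + f y) * g s - 2 * f s * g s)"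
       "(\<lambda>s. (f x + f y) * g s - 2 * f s * g s) integrable_on {x..y}"
      by (auto simp: has_integral_iff)
    have "\<bar>h y - h x\<bar> \<le> integral {x..y} (\<lambda>s. (2 * ?\<phi>) * \<bar>g s\<bar>)"
      unfolding I3(1)
    proof (rule integral_norm_bound_integral[where 'a=real, unfolded real_norm_def, OF I3(2)])
      show "(\<lambda>s. (2 * ?\<phi>) * \<bar>g s\<bar>) integrable_on {x..y}"
        using ia[of x y] xy by (intro integrable_on_mult_right) auto
      fix s assume s: "s \<in> {x..y}"
      have "\<bar>f x + f y - 2 * f s\<bar> \<le> 2 * ?\<phi>"
        using sub[of x s] sub[of s y] s by simp
      moreover have "(f x + f y) * g s - 2 * f s * g s = (f x + f y - 2 * f s) * g s"
        by (simp add: algebra_simps)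
      ultimately show "\<bar>(f x + f y) * g s - 2 * f s * g s\<bar> \<le> (2 * ?\<phi>) * \<bar>g s\<bar>"
        by (simp only: abs_mult mult_right_mono abs_ge_zero)
    qed
    also have "\<dots> = 2 * ?\<phi>\<^sup>2" by (simp add: power2_eq_square)
    also have "\<dots> \<le> 2 * ((y - x) * integral {x..y} (\<lambda>s. (g s)\<^sup>2))"
      using integral_abs_sq_le[OF g xy] by simp
    also have "integral {x..y} (\<lambda>s. (g s)\<^sup>2) = E y - E x"
      unfolding E_def
      using Henstock_Kurzweil_Integration.integral_combine[of 0 x y "\<lambda>s. (g s)\<^sup>2"]
        L2_sq_integrable_on[OF g g, of 0 y] xy by (simp add: power2_eq_square)
    finally show ?thesis by (simp only: mult.assoc)
  qed
  have "(h has_real_derivative 0) (at x within {0..1})" if x: "x \<in> {0..1}" for x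
    unfolding has_field_derivative_iff
  proof (rule Lim_null_comparison)
    have "((\<lambda>y. 2 * \<bar>E y - E x\<bar>) \<longlongrightarrow> 2 * \<bar>E x - E x\<bar>) (at x within {0..1})"
      using cE x by (intro tendsto_intros) (auto simp: continuous_on_def)
    then show "((\<lambda>y. 2 * \<bar>E y - E x\<bar>) \<longlongrightarrow> 0) (at x within {0..1})" by simp
    show "\<forall>\<^sub>F y in at x within {0..1}. norm ((h y - h x) / (y - x)) \<le> 2 * \<bar>E y - E x\<bar>"
      unfolding eventually_at_filter
    proof (intro always_eventually allI impI)
      fix y assume y: "y \<noteq> x" "y \<in> {0..1}"
      have "\<bar>h y - h x\<bar> \<le> 2 * \<bar>E y - E x\<bar> * \<bar>y - x\<bar>"
      proof (cases "x < y")
        case True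
        then have "\<bar>h y - h x\<bar> \<le> 2 * (y - x) * (E y - E x)" using key[of x y] x y by simp
        also have "\<dots> \<le> 2 * (y - x) * \<bar>E y - E x\<bar>" using True by (intro mult_left_mono) auto
        finally show ?thesis using True by (simp add: algebra_simps)
      next
        case False
        then have "y < x" using y by simp
        then have "\<bar>h x - h y\<bar> \<le> 2 * (x - y) * (E x - E y)" using key[of y x] x y by simp
        also have "\<dots> \<le> 2 * (x - y) * \<bar>E y - E x\<bar>" using \<open>y < x\<close> by (intro mult_left_mono) auto
        finally show ?thesis using \<open>y < x\<close> by (simp add: algebra_simps abs_minus_commute)
      qed
      then show "norm ((h y - h x) / (y - x)) \<le> 2 * \<bar>E y - E x\<bar>"
        using y by (simp add: field_simps)
    qed
  qed
  then have hc: "h x = h 0" if "x \<in> {0..1}" for x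
    using has_field_derivative_zero_constant[of "{0..1}" h] that by (metis atLeastAtMost_iff convex_real_interval(5) order_refl zero_le_one)
  show ?thesis unfolding primitive_def
  proof
    show "(\<lambda>x. 2 * f x * g x) \<in> L2" by (rule fg)
    show "\<forall>x\<in>{0..1}. (f x)\<^sup>2 = (f 0)\<^sup>2 + integral {0..x} (\<lambda>s. 2 * f s * g s)"
    proof
      fix x :: real assume "x \<in> {0..1}"
      from hc[OF this] show "(f x)\<^sup>2 = (f 0)\<^sup>2 + integral {0..x} (\<lambda>s. 2 * f s * g s)"
        unfolding h_def by simp
    qed
  qed
qed

lemma primitive_mult:
  assumes f: "primitive f f'" and g: "primitive g g'"
  shows "primitive (\<lambda>x. f x * g x) (\<lambda>x. f' x * g x + f x * g' x)"
proof -
  have "primitive (\<lambda>x. (1/4) * ((f x + g x)\<^sup>2 - (f x - g x)\<^sup>2))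
     (\<lambda>x. (1/4) * (2 * (f x + g x) * (f' x + g' x) - 2 * (f x - g x) * (f' x - g' x)))"
    by (intro primitive_cmult primitive_diff primitive_square primitive_add f g)
  moreover have "(\<lambda>x. (1/4) * ((f x + g x)\<^sup>2 - (f x - g x)\<^sup>2)) = (\<lambda>x. f x * g x)"
    by (auto simp: fun_eq_iff power2_eq_square algebra_simps)
  moreover have "(\<lambda>x. (1/4) * (2 * (f x + g x) * (f' x + g' x) - 2 * (f x - g x) * (f' x - g' x)))
      = (\<lambda>x. f' x * g x + f x * g' x)"
    by (auto simp: fun_eq_iff algebra_simps)
  ultimately show ?thesis by simp
qed

lemma ip_by_parts:
  assumes f: "primitive f f'" and g: "primitive g g'"
  shows "ip f' g + ip f g' = f 1 * g 1 - f 0 * g 0"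
proof -
  note m = primitive_mult[OF f g]
  have L: "f \<in> L2" "g \<in> L2" "f' \<in> L2" "g' \<in> L2"
    using f g primitive_in_L2 primitive_L2 by blast+
  have "ip f' g + ip f g' = integral {0..1} (\<lambda>x. f' x * g x) + integral {0..1} (\<lambda>x. f x * g' x)"
    using L by (simp add: ip_eq_integral)
  also have "\<dots> = integral {0..1} (\<lambda>x. f' x * g x + f x * g' x)"
    using L by (intro Henstock_Kurzweil_Integration.integral_add[symmetric] L2_sq_integrable_on) auto
  also have "\<dots> = f 1 * g 1 - f 0 * g 0"
    using primitive_diff_eq[OF m, of 0 1] by simp
  finally show ?thesis .
qed

text \<open>By Lebesgue differentiation, the means over shrinking intervals recover \<open>w\<close> almost everywhere.\<close>

lemma AE_zero_if_integrals_zero: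
  assumes w: "w \<in> L2" and z: "\<And>x. x \<in> {0..1} \<Longrightarrow> integral {0..x} w = 0"
  shows "AE x in leb01. w x = 0"
proof -
  let ?f = "\<lambda>x. if x \<in> {0..1} then w x else 0"
  have int: "?f integrable_on cbox a b" for a b
  proof -
    have "?f integrable_on UNIV"
      using L2_integrable_on[OF w, of 0 1] integrable_restrict_UNIV by fastforce
    then show ?thesis by (rule integrable_on_subcbox) simp
  qed
  obtain N where N: "negligible N"
    and lim: "\<And>x e. \<lbrakk>x \<notin> N; 0 < e\<rbrakk> \<Longrightarrow> \<exists>d>0. \<forall>h. 0 < h \<and> h < d \<longrightarrow>
       norm (integral (cbox x (x + h *\<^sub>R One)) ?f /\<^sub>R h ^ DIM(real) - ?f x) < e"
    using integrable_ccontinuous_explicit[of ?f, OF int] by blast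
  have zero: "w x = 0" if x: "x \<in> {0..1}" "x \<notin> N" "x \<noteq> 1" for x
  proof (rule ccontr)
    assume "w x \<noteq> 0"
    then obtain d where d: "d > 0" "\<And>h. 0 < h \<Longrightarrow> h < d \<Longrightarrow>
       norm (integral (cbox x (x + h *\<^sub>R One)) ?f /\<^sub>R h ^ DIM(real) - ?f x) < \<bar>w x\<bar>"
      using lim[of x "\<bar>w x\<bar>"] x by auto
    define h where "h = min (d / 2) (1 - x)"
    have h: "0 < h" "h < d" "x + h \<le> 1" using d x by (auto simp: h_def)
    have "integral {x..x+h} ?f = integral {x..x+h} w"
      using x h by (intro Henstock_Kurzweil_Integration.integral_cong) auto
    also have "\<dots> = integral {0..x+h} w - integral {0..x} w"
      using Henstock_Kurzweil_Integration.integral_combine[of 0 x "x+h" w] L2_integrable_on[OF w, of 0 "x+h"] x h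
      by simp
    also have "\<dots> = 0" using z x h by simp
    finally show False using d(2)[OF h(1,2)] x by simp
  qed
  have "N \<union> {1} \<in> null_sets lebesgue"
    using N by (simp add: negligible_iff_null_sets[symmetric])
  then have "AE x in lebesgue. x \<notin> N \<union> {1}" by (rule AE_not_in)
  then have "AE x in lebesgue. x \<in> {0..1} \<longrightarrow> w x = 0"
    by eventually_elim (use zero in auto)
  then show ?thesis by (simp add: AE_restrict_space_iff)
qed

lemma ip_cong_AE:
  assumes "AE x in leb01. f x = g x" "f \<in> L2" "g \<in> L2" "k \<in> L2" shows "ip f k = ip g k"
  unfolding ip_def using assms by (intro integral_cong_AE) (auto simp: L2_def)

lemma L2_nrm_cong_AE:
  assumes "AE x in leb01. f x = g x" "f \<in> L2" "g \<in> L2" shows "L2_nrm f = L2_nrm g"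
  unfolding L2_nrm_def using assms
  by (intro arg_cong[where f=sqrt] integral_cong_AE) (auto simp: L2_def)

lemma primitive_unique:
  assumes "primitive f g" "primitive f k" shows "AE x in leb01. g x = k x"
proof -
  have L: "g \<in> L2" "k \<in> L2" using assms primitive_L2 by blast+
  have "AE x in leb01. g x - k x = 0"
  proof (rule AE_zero_if_integrals_zero)
    show "(\<lambda>x. g x - k x) \<in> L2" using L by (rule L2_diff)
    fix x :: real assume x: "x \<in> {0..1}"
    have "integral {0..x} (\<lambda>x. g x - k x) = integral {0..x} g - integral {0..x} k"
      using L x by (intro Henstock_Kurzweil_Integration.integral_diff L2_integrable_on) auto
    then show "integral {0..x} (\<lambda>x. g x - k x) = 0"
      using primitiveD[OF assms(1) x] primitiveD[OF assms(2) x] by linarith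
  qed
  then show ?thesis by simp
qed

text \<open>A \<open>C\<^sup>1\<close> function whose second differences are primitives of tent functions; it provides explicit
  test functions.\<close>

definition ramp_sq :: "real \<Rightarrow> real" where "ramp_sq y = (max 0 y)\<^sup>2 / 2"

lemma ramp_sq_deriv: "(ramp_sq has_real_derivative max 0 y) (at y)"
proof -
  consider "y > 0" | "y < 0" | "y = 0" by linarith
  then show ?thesis
  proof cases
    case 1
    have "((\<lambda>y. y\<^sup>2 / 2) has_real_derivative max 0 y) (at y)"
      using 1 by (auto intro!: derivative_eq_intros)
    moreover have "\<forall>\<^sub>F z in nhds y. ramp_sq z = z\<^sup>2 / 2"
      using eventually_nhds_in_open[of "{0<..}" y] 1
      by (auto elim!: eventually_mono simp: ramp_sq_def)
    ultimately show ?thesis by (subst DERIV_cong_ev[OF refl _ refl])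
  next
    case 2
    have "((\<lambda>y. 0) has_real_derivative max 0 y) (at y)"
      using 2 by (auto intro!: derivative_eq_intros)
    moreover have "\<forall>\<^sub>F z in nhds y. ramp_sq z = 0"
      using eventually_nhds_in_open[of "{..<0}" y] 2
      by (auto elim!: eventually_mono simp: ramp_sq_def)
    ultimately show ?thesis by (subst DERIV_cong_ev[OF refl _ refl])
  next
    case 3
    have "((\<lambda>h. ramp_sq (0 + h) / h) \<longlongrightarrow> 0) (at 0)"
    proof (rule Lim_null_comparison)
      show "((\<lambda>h::real. \<bar>h\<bar>) \<longlongrightarrow> 0) (at 0)" by (intro tendsto_eq_intros) auto
      have "norm (ramp_sq (0 + h) / h) \<le> \<bar>h\<bar>" for h
        by (auto simp: ramp_sq_def power2_eq_square max_def field_simps)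
      then show "\<forall>\<^sub>F h in at 0. norm (ramp_sq (0 + h) / h) \<le> \<bar>h\<bar>" by simp
    qed
    then show ?thesis using 3 by (simp add: DERIV_def ramp_sq_def)
  qed
qed

text \<open>The tent of height and half-width \<open>d\<close>, as a second difference of the ramp; its primitive
  \<open>bump_prim\<close> below climbs from \<open>0\<close> to \<open>d\<^sup>2\<close>.\<close>

definition bump :: "real \<Rightarrow> real \<Rightarrow> real" where
  "bump d y = max 0 (y + d) - 2 * max 0 y + max 0 (y - d)"

definition bump_prim :: "real \<Rightarrow> real \<Rightarrow> real" where
  "bump_prim d y = ramp_sq (y + d) - 2 * ramp_sq y + ramp_sq (y - d)"

lemma bump_prim_deriv: "((\<lambda>x. bump_prim d (x - p)) has_real_derivative bump d (x - p)) (at x)"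
  unfolding bump_prim_def bump_def
  by (auto intro!: derivative_eq_intros DERIV_chain2[OF ramp_sq_deriv])

lemma bump_prim_values:
  assumes "0 < d" shows "y \<le> - d \<Longrightarrow> bump_prim d y = 0" "d \<le> y \<Longrightarrow> bump_prim d y = d\<^sup>2"
  using assms by (auto simp: bump_prim_def ramp_sq_def max_def power2_eq_square field_simps)

lemma bump_nonneg: "0 < d \<Longrightarrow> 0 \<le> bump d y"
  and bump_zero: "0 < d \<Longrightarrow> \<bar>y\<bar> \<ge> d \<Longrightarrow> bump d y = 0"
  by (auto simp: bump_def max_def)

lemma ip_bump:
  assumes d: "0 < d" "d \<le> p" "p + d \<le> 1"
  shows "ip (\<lambda>x. bump d (x - p)) (\<lambda>x. 1) = d\<^sup>2"
proof -
  have "primitive (\<lambda>x. bump_prim d (x - p)) (\<lambda>x. bump d (x - p))"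
    by (rule primitive_C1[OF bump_prim_deriv]) (auto simp: bump_def intro!: continuous_intros)
  from ip_by_parts[OF this primitive_C1[of "\<lambda>x. 1" "\<lambda>x. 0"]]
  show ?thesis using d by (simp add: bump_prim_values ip_def)
qed

lemma ip_mono:
  assumes "f \<in> L2" "g \<in> L2" "k \<in> L2" "\<And>x. x \<in> {0..1} \<Longrightarrow> f x * k x \<le> g x * k x"
  shows "ip f k \<le> ip g k"
  unfolding ip_def using assms by (intro integral_mono L2_mult_integrable) auto

text \<open>The lemma of du Bois-Reymond. The difference \<open>r\<close> of \<open>u\<close> and the primitive of \<open>w\<close> is orthogonal to the
  derivatives of all test functions. The difference of two bumps centred at \<open>p\<close> and \<open>q\<close> is such a
  derivative, so the local means of \<open>r\<close> at \<open>p\<close> and at \<open>q\<close> agree, and by continuity so do its values.\<close>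

lemma weak_deriv_primitive:
  assumes cu: "continuous_on {0..1} u" and w: "w \<in> L2" and wd: "is_weak_deriv u w"
  shows "primitive u w"
proof -
  define W where "W x = integral {0..x} w" for x
  have PW: "primitive W w" using primitive_integral[OF w, of 0] by (simp add: W_def[abs_def])
  define r where "r x = u x - W x" for x
  have cr: "continuous_on {0..1} r"
    unfolding r_def by (intro continuous_intros cu primitive_continuous[OF PW])
  have orth: "ip r \<phi>' = 0" if t: "test_fun \<phi> \<phi>'" for \<phi> \<phi>'
  proof -
    have c: "continuous_on {0..1} \<phi>'"
      using t unfolding test_fun_def by (meson continuous_on_subset subset_UNIV)
    have P: "primitive \<phi> \<phi>'" using t c by (intro primitive_C1) (auto simp: test_fun_def)
    have z: "\<phi> 0 = 0" "\<phi> 1 = 0" using t by (force simp: test_fun_def)+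
    have "ip u \<phi>' = - ip w \<phi>" using wd t by (auto simp: is_weak_deriv_def ip_def)
    moreover have "ip w \<phi> + ip W \<phi>' = 0" using ip_by_parts[OF PW P] z by simp
    ultimately show ?thesis
      using L2_continuous[OF cu] primitive_in_L2[OF PW] L2_continuous[OF c]
      by (simp add: r_def[abs_def] ip_diff_left)
  qed
  have less: "r p \<le> r q" if pq: "p \<in> {0<..<1}" "q \<in> {0<..<1}" for p q
  proof (rule ccontr)
    assume "\<not> r p \<le> r q"
    define e where "e = (r p - r q) / 3"
    have e: "e > 0" using \<open>\<not> r p \<le> r q\<close> by (simp add: e_def)
    have near: "\<exists>d>0. \<forall>x\<in>{0..1}. \<bar>x - s\<bar> < d \<longrightarrow> \<bar>r x - r s\<bar> < e" if "s \<in> {0<..<1}" for s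
    proof -
      have "s \<in> {0..1}" using that by simp
      then show ?thesis using cr e unfolding continuous_on_iff dist_real_def by blast
    qed
    obtain d1 where d1: "d1 > 0" "\<And>x. x \<in> {0..1} \<Longrightarrow> \<bar>x - p\<bar> < d1 \<Longrightarrow> \<bar>r x - r p\<bar> < e"
      using near[OF pq(1)] by blast
    obtain d2 where d2: "d2 > 0" "\<And>x. x \<in> {0..1} \<Longrightarrow> \<bar>x - q\<bar> < d2 \<Longrightarrow> \<bar>r x - r q\<bar> < e"
      using near[OF pq(2)] by blast
    \<comment> \<open>small enough that \<open>r\<close> varies by less than \<open>e\<close> on both bumps and that these lie inside the unit interval\<close>
    define d where "d = Min {d1, d2, p / 2, q / 2, (1 - p) / 2, (1 - q) / 2}"
    have "0 < d"
      unfolding d_def by (subst Min_gr_iff) (use d1(1) d2(1) pq in auto)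
    moreover have "d \<le> y" if "y \<in> {d1, d2, p / 2, q / 2, (1 - p) / 2, (1 - q) / 2}" for y
      unfolding d_def by (rule Min_le) (use that in auto)
    ultimately have d: "0 < d" "d \<le> d1" "d \<le> d2" "d \<le> p / 2" "d \<le> q / 2" "d \<le> (1 - p) / 2" "d \<le> (1 - q) / 2"
      by blast+
    let ?P = "\<lambda>x. bump d (x - p)" and ?Q = "\<lambda>x. bump d (x - q)"
    have cPQ: "continuous_on S ?P" "continuous_on S ?Q" for S
      unfolding bump_def by (intro continuous_intros)+
    have L: "r \<in> L2" "?P \<in> L2" "?Q \<in> L2"
      using cr cPQ by (auto intro: L2_continuous)
    have "test_fun (\<lambda>x. bump_prim d (x - p) - bump_prim d (x - q)) (\<lambda>x. ?P x - ?Q x)"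
      unfolding test_fun_def
    proof (intro conjI exI allI impI)
      fix x
      show "((\<lambda>x. bump_prim d (x - p) - bump_prim d (x - q)) has_real_derivative ?P x - ?Q x) (at x)"
        by (intro DERIV_diff bump_prim_deriv)
    next
      show "continuous_on UNIV (\<lambda>x. ?P x - ?Q x)" by (intro continuous_intros cPQ)
      show "0 < min p q / 2" "min p q / 2 < 1 - (1 - max p q) / 2" "1 - (1 - max p q) / 2 < 1"
        using pq by (auto simp: min_def max_def field_simps)
      fix x assume "x \<notin> {min p q / 2..1 - (1 - max p q) / 2}"
      then consider "x < min p q / 2" | "x > 1 - (1 - max p q) / 2" by force
      then show "bump_prim d (x - p) - bump_prim d (x - q) = 0"
      proof cases
        case 1 then show ?thesis using d by (simp add: bump_prim_values min_def split: if_splits)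
      next
        case 2 then show ?thesis using d by (simp add: bump_prim_values max_def field_simps split: if_splits)
      qed
    qed
    from orth[OF this] have "ip r ?P = ip r ?Q" using L by (simp add: ip_diff_right)
    moreover have "(r p - e) * d\<^sup>2 \<le> ip r ?P"
    proof -
      have "(r p - e) * d\<^sup>2 = ip (\<lambda>x. (r p - e) * 1) ?P"
        using ip_bump[of d p] d by (simp add: ip_commute[of _ ?P] ip_cmult_right[of ?P "r p - e" "\<lambda>x. 1", simplified])
      also have "\<dots> \<le> ip r ?P"
      proof (rule ip_mono)
        fix x :: real assume x: "x \<in> {0..1}"
        show "(r p - e) * 1 * ?P x \<le> r x * ?P x"
        proof (cases "\<bar>x - p\<bar> < d")
          case True
          then show ?thesis using d1(2)[OF x] d bump_nonneg[of d "x - p"] by (intro mult_right_mono) auto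
        qed (use bump_zero[of d "x - p"] d in simp)
      qed (use L in auto)
      finally show ?thesis .
    qed
    moreover have "ip r ?Q \<le> (r q + e) * d\<^sup>2"
    proof -
      have "ip r ?Q \<le> ip (\<lambda>x. (r q + e) * 1) ?Q"
      proof (rule ip_mono)
        fix x :: real assume x: "x \<in> {0..1}"
        show "r x * ?Q x \<le> (r q + e) * 1 * ?Q x"
        proof (cases "\<bar>x - q\<bar> < d")
          case True
          then show ?thesis using d2(2)[OF x] d bump_nonneg[of d "x - q"] by (intro mult_right_mono) auto
        qed (use bump_zero[of d "x - q"] d in simp)
      qed (use L in auto)
      also have "\<dots> = (r q + e) * d\<^sup>2"
        using ip_bump[of d q] d by (simp add: ip_commute[of _ ?Q] ip_cmult_right[of ?Q "r q + e" "\<lambda>x. 1", simplified])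
      finally show ?thesis .
    qed
    ultimately have "(r p - e) * d\<^sup>2 \<le> (r q + e) * d\<^sup>2" by linarith
    then have "r p - e \<le> r q + e" using d by simp
    moreover have "r p - r q = 3 * e" by (simp add: e_def)
    ultimately show False using e by linarith
  qed
  have const: "r x = r (1/2)" if "x \<in> {0..1}" for x
  proof -
    have cl: "closure {0<..<1} = {0..1::real}" by simp
    have "r y = r (1/2)" if "y \<in> {0<..<1}" for y
      by (rule antisym; rule less) (use that in auto)
    then show ?thesis
      using continuous_constant_on_closure[of "{0<..<1}" r "r (1/2)" x] cr that unfolding cl by blast
  qed
  have c: "r x = r 0" if "x \<in> {0..1}" for x
    using const[OF that] const[of 0] by simp
  have W0: "W 0 = 0" by (simp add: W_def)
  show ?thesis
    unfolding primitive_def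
  proof (intro conjI w ballI)
    fix x :: real assume "x \<in> {0..1}"
    from c[OF this] show "u x = u 0 + integral {0..x} w"
      using W0 unfolding r_def W_def by linarith
  qed
qed

lemma primitive_weak_deriv:
  assumes P: "primitive u w" shows "is_weak_deriv u w"
  unfolding is_weak_deriv_def
proof (intro allI impI)
  fix \<phi> \<phi>' assume t: "test_fun \<phi> \<phi>'"
  have c: "continuous_on {0..1} \<phi>'"
    using t unfolding test_fun_def by (meson continuous_on_subset subset_UNIV)
  have P': "primitive \<phi> \<phi>'" using t c by (intro primitive_C1) (auto simp: test_fun_def)
  have z: "\<phi> 0 = 0" "\<phi> 1 = 0" using t by (force simp: test_fun_def)+
  show "(LINT x|leb01. u x * \<phi>' x) = - (LINT x|leb01. w x * \<phi> x)"
    using ip_by_parts[OF P P'] z by (simp add: ip_def)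
qed

lemma primitive_wderiv:
  assumes "primitive u w" shows "primitive u (wderiv u)"
proof -
  have "w \<in> L2 \<and> is_weak_deriv u w" using assms primitive_weak_deriv primitive_L2 by blast
  then have "wderiv u \<in> L2 \<and> is_weak_deriv u (wderiv u)" unfolding wderiv_def
    by (rule someI[of "\<lambda>w. w \<in> L2 \<and> is_weak_deriv u w"])
  then show ?thesis using weak_deriv_primitive primitive_continuous[OF assms] by blast
qed

lemma sobolev_1_primitive: "u \<in> sobolev 1 \<longleftrightarrow> (\<exists>w. primitive u w)"
proof
  assume "u \<in> sobolev 1"
  then show "\<exists>w. primitive u w" using weak_deriv_primitive by auto
next
  assume "\<exists>w. primitive u w"
  then obtain w where w: "primitive u w" ..
  then have "w \<in> L2" "is_weak_deriv u w" by (rule primitive_L2, rule primitive_weak_deriv)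
  then show "u \<in> sobolev 1"
    using primitive_in_L2[OF w] primitive_continuous[OF w] by auto
qed

lemma wderiv_AE_eq: "primitive u w \<Longrightarrow> AE x in leb01. wderiv u x = w x"
  using primitive_unique primitive_wderiv by blast

lemma wderiv_cong:
  assumes "\<And>x. x \<in> {0..1} \<Longrightarrow> u x = u' x" shows "wderiv u = wderiv u'"
proof -
  have "is_weak_deriv u w = is_weak_deriv u' w" for w
  proof -
    have "(LINT x|leb01. u x * \<phi>' x) = (LINT x|leb01. u' x * \<phi>' x)" for \<phi>'
      using assms by (intro Bochner_Integration.integral_cong) auto
    then show ?thesis unfolding is_weak_deriv_def by simp
  qed
  then show ?thesis unfolding wderiv_def by simp
qed

section \<open>Shifted Legendre polynomials\<close>

text \<open>Legendre polynomials in the variable \<open>2 x - 1\<close>, by Bonnet's recursion. With this definition the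
  boundary values are immediate, and orthogonality follows from the derivative identities.\<close>

fun legendre :: "nat \<Rightarrow> real \<Rightarrow> real" where
  "legendre 0 x = 1"
| "legendre (Suc 0) x = 2 * x - 1"
| "legendre (Suc (Suc n)) x =
     ((2 * real n + 3) * ((2 * x - 1) * legendre (Suc n) x) - (real n + 1) * legendre n x) / (real n + 2)"

fun dlegendre :: "nat \<Rightarrow> real \<Rightarrow> real" where
  "dlegendre 0 x = 0"
| "dlegendre (Suc 0) x = 2"
| "dlegendre (Suc (Suc n)) x =
     ((2 * real n + 3) * (2 * legendre (Suc n) x + (2 * x - 1) * dlegendre (Suc n) x)
       - (real n + 1) * dlegendre n x) / (real n + 2)"

lemma legendre_deriv: "(legendre n has_real_derivative dlegendre n x) (at x)"
proof (induction n rule: less_induct)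
  case (less n)
  consider "n = 0" | "n = 1" | m where "n = Suc (Suc m)" by (metis One_nat_def not0_implies_Suc)
  then show ?case
  proof cases
    case 1 then have "legendre n = (\<lambda>x. 1)" by auto
    then show ?thesis using 1 by simp
  next
    case 2
    then have "legendre n = (\<lambda>x. 2 * x - 1)" by auto
    then show ?thesis using 2 by (auto intro!: derivative_eq_intros)
  next
    case 3
    note IH = less[of m] less[of "Suc m"]
    have "((\<lambda>x. (2 * real m + 3) * ((2 * x - 1) * legendre (Suc m) x) - (real m + 1) * legendre m x)
       has_real_derivative ((2 * real m + 3) * (2 * legendre (Suc m) x + (2 * x - 1) * dlegendre (Suc m) x)
         - (real m + 1) * dlegendre m x)) (at x)"
      using 3 IH by (auto intro!: derivative_eq_intros simp: algebra_simps)
    from DERIV_cdivide[OF this, of "real m + 2"]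
    have "((\<lambda>x. ((2 * real m + 3) * ((2 * x - 1) * legendre (Suc m) x) - (real m + 1) * legendre m x) / (real m + 2))
       has_real_derivative dlegendre n x) (at x)"
      using 3 by simp
    moreover have "legendre n = (\<lambda>x. ((2 * real m + 3) * ((2 * x - 1) * legendre (Suc m) x) - (real m + 1) * legendre m x) / (real m + 2))"
      using 3 by auto
    ultimately show ?thesis by simp
  qed
qed

lemma legendre_continuous: "continuous_on S (legendre n)"
  by (meson DERIV_isCont continuous_at_imp_continuous_on legendre_deriv)

lemma legendre_L2: "legendre n \<in> L2"
  by (rule L2_continuous[OF legendre_continuous])

lemma legendre_at_1: "legendre n 1 = 1"
proof (induction n rule: less_induct)
  case (less n)
  consider "n = 0" | "n = 1" | m where "n = Suc (Suc m)" by (metis One_nat_def not0_implies_Suc)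
  then show ?case by cases (use less in \<open>auto simp: field_simps\<close>)
qed

lemma legendre_at_0: "legendre n 0 = (- 1) ^ n"
proof (induction n rule: less_induct)
  case (less n)
  consider "n = 0" | "n = 1" | m where "n = Suc (Suc m)" by (metis One_nat_def not0_implies_Suc)
  then show ?case by cases (use less in \<open>auto simp: field_simps\<close>)
qed

text \<open>In the variable \<open>s = 2 x - 1\<close> these are \<open>s P'\<^sub>n\<^sub>+\<^sub>1 - P'\<^sub>n = (n + 1) P\<^sub>n\<^sub>+\<^sub>1\<close> and
  \<open>P'\<^sub>n\<^sub>+\<^sub>1 - s P'\<^sub>n = (n + 1) P\<^sub>n\<close>. They are proved together because the induction step of each uses
  the other. The factor \<open>2\<close> is the derivative of \<open>s\<close>.\<close>

lemma dlegendre_lower_raise: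
  "(2 * x - 1) * dlegendre (Suc n) x - dlegendre n x = 2 * (real n + 1) * legendre (Suc n) x \<and>
   dlegendre (Suc n) x - (2 * x - 1) * dlegendre n x = 2 * (real n + 1) * legendre n x"
proof (induction n)
  case 0 show ?case by simp
next
  case (Suc n)
  define s where "s = 2 * x - 1"
  define a where "a = real n + 1"
  have a: "a > 0" "a + 1 \<noteq> 0" by (auto simp: a_def)
  define p q p' q' where "p = legendre n x" "q = legendre (Suc n) x" "p' = dlegendre n x" "q' = dlegendre (Suc n) x"
  note d = this
  define r r' where "r = legendre (Suc (Suc n)) x" "r' = dlegendre (Suc (Suc n)) x"
  note d' = this
  have IH: "s * q' - p' = 2 * a * q" "q' - s * p' = 2 * a * p"
    using Suc.IH unfolding d s_def a_def by simp_all
  have "r = ((2 * a + 1) * (s * q) - a * p) / (a + 1)"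
    unfolding d d' s_def a_def legendre.simps by (simp add: algebra_simps)
  then have r: "(a + 1) * r = (2 * a + 1) * (s * q) - a * p"
    using a by simp
  have "r' = ((2 * a + 1) * (2 * q + s * q') - a * p') / (a + 1)"
    unfolding d d' s_def a_def dlegendre.simps by (simp add: algebra_simps)
  then have r': "(a + 1) * r' = (2 * a + 1) * (2 * q + s * q') - a * p'"
    using a by simp
  have "(a + 1) * (r' - s * q') = (a + 1) * (2 * (a + 1) * q)"
  proof -
    have "(a + 1) * (r' - s * q') = (2 * a + 1) * (2 * q) + a * (s * q' - p')"
      using r' by (simp add: algebra_simps)
    also have "\<dots> = (a + 1) * (2 * (a + 1) * q)" unfolding IH(1) by (simp add: algebra_simps)
    finally show ?thesis .
  qed
  then have b: "r' - s * q' = 2 * (a + 1) * q" using a by simp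
  have "s * r' - q' = s * (s * q') + 2 * (a + 1) * (s * q) - q'"
    using arg_cong[OF b, of "\<lambda>z. s * z"] by (simp add: algebra_simps)
  also have "s * q' = p' + 2 * a * q" using IH(1) by simp
  also have "s * (p' + 2 * a * q) + 2 * (a + 1) * (s * q) - q' = 2 * ((a + 1) * r)"
    using IH(2) unfolding r by (simp add: algebra_simps)
  finally have "s * r' - q' = 2 * (a + 1) * r" by simp
  with b show ?case unfolding d d' s_def a_def by (simp add: add.commute add.left_commute)
qed

lemma dlegendre_step: "dlegendre (Suc (Suc n)) x - dlegendre n x = 2 * (2 * real n + 3) * legendre (Suc n) x"
  using dlegendre_lower_raise[where n=n and x=x] dlegendre_lower_raise[where n="Suc n" and x=x] by (simp add: algebra_simps)

text \<open>The origin of the coefficients of \<open>L_mat\<close>: differentiation on the span of the Legendre polynomials.\<close>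

lemma dlegendre_eq_sum_ell: "dlegendre k x = (\<Sum>j<k. ell k j * legendre j x)"
proof (induction k rule: less_induct)
  case (less n)
  consider "n = 0" | "n = 1" | m where "n = Suc (Suc m)" by (metis One_nat_def not0_implies_Suc)
  then show ?case
  proof cases
    case 3
    have "ell (Suc (Suc m)) j = ell m j" if "j < m" for j
      using that by (simp add: ell_def)
    moreover have "ell (Suc (Suc m)) m = 0" "ell (Suc (Suc m)) (Suc m) = 2 * (2 * real m + 3)"
      by (simp_all add: ell_def)
    ultimately have "(\<Sum>j<n. ell n j * legendre j x) = (\<Sum>j<m. ell m j * legendre j x) + 2 * (2 * real m + 3) * legendre (Suc m) x"
      using 3 by simp
    then show ?thesis using less[of m] dlegendre_step[of m x] 3 by simp
  qed (auto simp: ell_def)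
qed

lemma legendre_primitive: "primitive (legendre n) (dlegendre n)"
proof (rule primitive_C1[OF legendre_deriv])
  have "dlegendre n = (\<lambda>x. \<Sum>j<n. ell n j * legendre j x)" using dlegendre_eq_sum_ell by auto
  then show "continuous_on {0..1} (dlegendre n)" by (auto intro!: continuous_intros legendre_continuous)
qed

lemma ip_dlegendre: "f \<in> L2 \<Longrightarrow> ip f (dlegendre n) = (\<Sum>j<n. ell n j * ip f (legendre j))"
proof -
  assume f: "f \<in> L2"
  have "dlegendre n = (\<lambda>x. \<Sum>j<n. ell n j * legendre j x)" using dlegendre_eq_sum_ell by auto
  then have "ip f (dlegendre n) = ip (\<lambda>x. \<Sum>j<n. ell n j * legendre j x) f" by (simp add: ip_commute)
  also have "\<dots> = (\<Sum>j<n. ip (\<lambda>x. ell n j * legendre j x) f)"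
    by (intro ip_sum_left L2_cmult legendre_L2 f)
  finally show ?thesis by (simp add: ip_cmult_left ip_commute)
qed

text \<open>The difference of the derivatives of the polynomials of degrees \<open>m + 2\<close> and \<open>m\<close> is a multiple of the
  one of degree \<open>m + 1\<close>. Integration by parts moves the derivative to the other factor, of degree \<open>j\<close>; the boundary
  terms vanish since the two polynomials agree at both ends. Hence the inner products with degree
  \<open>j\<close> follow from those with degrees below \<open>j\<close>, and induction on \<open>j\<close>, for all \<open>k\<close> at once,
  yields orthogonality and the norms together.\<close>

lemma legendre_orthogonal: "ip (legendre k) (legendre j) = (if k = j then 1 / (2 * real k + 1) else 0)"
proof (induction j arbitrary: k rule: less_induct)
  case (less j)
  show ?case
  proof (cases k)
    case 0
    show ?thesis
    proof (cases "j = 0")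
      case True
      have "ip (legendre 0) (legendre 0) = 1" by (simp add: ip_eq_integral legendre_L2)
      then show ?thesis using True 0 by (simp del: legendre.simps)
    next
      case False
      then show ?thesis using less[of 0 j] 0 by (simp add: ip_commute)
    qed
  next
    case (Suc m)
    let ?d = "\<lambda>x. legendre (Suc (Suc m)) x - legendre m x"
    have "2 * (2 * real m + 3) * ip (legendre k) (legendre j) = ip (\<lambda>x. dlegendre (Suc (Suc m)) x - dlegendre m x) (legendre j)"
      unfolding dlegendre_step ip_cmult_left Suc ..
    also have "\<dots> = - ip ?d (dlegendre j)"
    proof -
      have "primitive ?d (\<lambda>x. dlegendre (Suc (Suc m)) x - dlegendre m x)"
        by (intro primitive_diff legendre_primitive)
      from ip_by_parts[OF this legendre_primitive[of j]] show ?thesis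
        by (simp add: legendre_at_0 legendre_at_1 del: legendre.simps dlegendre.simps)
    qed
    also have "ip ?d (dlegendre j) = (\<Sum>i<j. ell j i * ip ?d (legendre i))"
      by (intro ip_dlegendre L2_diff legendre_L2)
    also have "\<dots> = (\<Sum>i<j. ell j i * ((if Suc (Suc m) = i then 1 / (2 * real i + 1) else 0)
         - (if m = i then 1 / (2 * real i + 1) else 0)))"
    proof (intro sum.cong refl)
      fix i assume i: "i \<in> {..<j}"
      have "ip ?d (legendre i) = ip (legendre (Suc (Suc m))) (legendre i) - ip (legendre m) (legendre i)"
        by (intro ip_diff_left legendre_L2)
      then show "ell j i * ip ?d (legendre i) = ell j i * ((if Suc (Suc m) = i then 1 / (2 * real i + 1) else 0)
         - (if m = i then 1 / (2 * real i + 1) else 0))"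
        using i less[of i m] less[of i "Suc (Suc m)"] by (auto simp del: legendre.simps)
    qed
    also have "\<dots> = (\<Sum>i<j. if Suc (Suc m) = i then ell j i / (2 * real i + 1) else 0)
         - (\<Sum>i<j. if m = i then ell j i / (2 * real i + 1) else 0)"
      unfolding sum_subtractf[symmetric] by (intro sum.cong) auto
    also have "\<dots> = (if Suc (Suc m) < j then ell j (Suc (Suc m)) / (2 * real (Suc (Suc m)) + 1) else 0)
         - (if m < j then ell j m / (2 * real m + 1) else 0)"
      by (simp add: sum.delta)
    also have "\<dots> = (if Suc (Suc m) < j then 1 - (- 1) ^ (j + m) else 0) - (if m < j then 1 - (- 1) ^ (j + m) else 0)"
    proof -
      have "ell j i / (2 * real i + 1) = 1 - (- 1) ^ (j + i)" if "i < j" for i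
        using that by (simp add: ell_def field_simps)
      from this[of m] this[of "Suc (Suc m)"] show ?thesis by auto
    qed
    also have "\<dots> = (if j = Suc m then - 2 else 0)"
    proof (cases "j = Suc m \<or> j = Suc (Suc m)")
      case False then show ?thesis by auto
    qed auto
    finally have "2 * (2 * real m + 3) * ip (legendre k) (legendre j) = (if j = Suc m then 2 else 0)" by simp
    moreover have nz: "2 * (2 * real m + 3) > 0" by simp
    ultimately have "ip (legendre k) (legendre j) = (if j = Suc m then 2 else 0) / (2 * (2 * real m + 3))"
      by (simp add: eq_divide_eq mult.commute del: legendre.simps)
    moreover have "2 / (2 * (2 * real m + 3)) = 1 / (2 * real (Suc m) + 1)"
      by (simp add: divide_simps)
    ultimately have "ip (legendre k) (legendre j) = (if j = Suc m then 1 / (2 * real (Suc m) + 1) else 0)"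
      by (metis div_0)
    then show ?thesis using Suc by auto
  qed
qed

section \<open>Bessel's inequality for quadratic forms\<close>

text \<open>The second argument is a matrix of numbers, so that the same notation covers products of two
  values, products of moments and inner products of functions.\<close>

definition form2 :: "real mat \<Rightarrow> (nat \<Rightarrow> nat \<Rightarrow> real) \<Rightarrow> real" where
  "form2 M f = (\<Sum>i<2. \<Sum>j<2. M $$ (i, j) * f i j)"

lemma sum_lessThan_2: "(\<Sum>i<2. f i) = f 0 + (f (Suc 0) :: 'a :: comm_monoid_add)"
  by (simp add: numeral_2_eq_2 lessThan_Suc add.commute)

text \<open>The form, evaluated on the difference of \<open>\<chi>\<close> and its Legendre projection, has a nonnegative integral;
  orthogonality turns that integral into the difference of the two sides.\<close>

lemma bessel_quadratic:
  assumes \<chi>: "\<And>i. \<chi> i \<in> L2"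
    and psd: "\<And>a :: nat \<Rightarrow> real. 0 \<le> form2 M (\<lambda>i j. a i * a j)"
  shows "(\<Sum>k\<le>N. (2 * real k + 1) * form2 M (\<lambda>i j. ip (\<chi> i) (legendre k) * ip (\<chi> j) (legendre k)))
    \<le> form2 M (\<lambda>i j. ip (\<chi> i) (\<chi> j))"
proof -
  define b where "b i k = (2 * real k + 1) * ip (\<chi> i) (legendre k)" for i k
  define p where "p i x = (\<Sum>k\<le>N. b i k * legendre k x)" for i x
  have p: "p i \<in> L2" for i unfolding p_def by (intro L2_sum L2_cmult legendre_L2)
  have ipp: "ip (p i) f = (\<Sum>k\<le>N. b i k * ip (legendre k) f)" if "f \<in> L2" for i f
    unfolding p_def using that by (subst ip_sum_left) (auto intro: L2_cmult legendre_L2 simp: ip_cmult_left)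
  have "ip (p i) (legendre k) = ip (\<chi> i) (legendre k)" if "k \<le> N" for i k
  proof -
    have "ip (p i) (legendre k) = (\<Sum>l\<le>N. if l = k then b i l * (1 / (2 * real l + 1)) else 0)"
      unfolding ipp[OF legendre_L2] legendre_orthogonal by (intro sum.cong) auto
    then show ?thesis using that by (simp add: sum.delta b_def)
  qed
  then have pp: "ip (p i) (p j) = (\<Sum>k\<le>N. b i k * ip (\<chi> j) (legendre k))" for i j
    unfolding ipp[OF p] by (intro sum.cong) (auto simp: ip_commute[of "legendre _"])
  have e: "ip (\<lambda>x. \<chi> i x - p i x) (\<lambda>x. \<chi> j x - p j x)
      = ip (\<chi> i) (\<chi> j) - (\<Sum>k\<le>N. (2 * real k + 1) * (ip (\<chi> i) (legendre k) * ip (\<chi> j) (legendre k)))" for i j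
  proof -
    have "ip (\<lambda>x. \<chi> i x - p i x) (\<lambda>x. \<chi> j x - p j x)
       = ip (\<chi> i) (\<chi> j) - ip (p j) (\<chi> i) - ip (p i) (\<chi> j) + ip (p i) (p j)"
      using \<chi> p by (simp add: ip_diff_left ip_diff_right L2_diff ip_commute[of "\<chi> i" "p j"])
    moreover have "ip (p j) (\<chi> i) = (\<Sum>k\<le>N. (2 * real k + 1) * (ip (\<chi> i) (legendre k) * ip (\<chi> j) (legendre k)))"
       "ip (p i) (\<chi> j) = ip (p i) (p j)"
      unfolding ipp[OF \<chi>] pp by (auto intro!: sum.cong simp: b_def ip_commute)
    moreover have "ip (p i) (p j) = (\<Sum>k\<le>N. (2 * real k + 1) * (ip (\<chi> i) (legendre k) * ip (\<chi> j) (legendre k)))"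
      unfolding pp by (auto intro!: sum.cong simp: b_def)
    ultimately show ?thesis by simp
  qed
  have int: "integrable leb01 (\<lambda>x. (\<chi> i x - p i x) * (\<chi> j x - p j x))" for i j
    using \<chi> p by (intro L2_mult_integrable L2_diff) auto
  have "0 \<le> (LINT x|leb01. form2 M (\<lambda>i j. (\<chi> i x - p i x) * (\<chi> j x - p j x)))"
    by (intro integral_nonneg_AE AE_I2 psd)
  also have "\<dots> = form2 M (\<lambda>i j. ip (\<lambda>x. \<chi> i x - p i x) (\<lambda>x. \<chi> j x - p j x))"
    unfolding form2_def using int by (simp add: ip_def Bochner_Integration.integral_sum)
  also have "\<dots> = form2 M (\<lambda>i j. ip (\<chi> i) (\<chi> j))
     - (\<Sum>k\<le>N. (2 * real k + 1) * form2 M (\<lambda>i j. ip (\<chi> i) (legendre k) * ip (\<chi> j) (legendre k)))"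
    unfolding e form2_def by (simp add: sum_lessThan_2 sum.distrib sum_distrib_left algebra_simps)
  finally show ?thesis by simp
qed

section \<open>Quadratic forms and block matrices\<close>

lemma scalar_prod_mult_mat_vec:
  assumes "M \<in> carrier_mat d e" "x \<in> carrier_vec d" "y \<in> carrier_vec e"
  shows "x \<bullet> (M *\<^sub>v y) = (\<Sum>i<d. \<Sum>j<e. M $$ (i, j) * (x $ i * (y $ j :: real)))"
  using assms by (auto simp: scalar_prod_def sum_distrib_left lessThan_atLeast0 algebra_simps intro!: sum.cong)

lemma scalar_prod_self: "x \<in> carrier_vec d \<Longrightarrow> x \<bullet> x = (\<Sum>i<d. (x $ i :: real)\<^sup>2)"
  by (auto simp: scalar_prod_def power2_eq_square lessThan_atLeast0)

lemma quadratic_form_zero: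
  "x \<in> carrier_vec d \<Longrightarrow> x \<bullet> (0\<^sub>m d d *\<^sub>v x) = (0::real)"
  by (subst scalar_prod_mult_mat_vec[of _ d d]) auto

lemma quadratic_form_bounded:
  assumes M: "M \<in> carrier_mat d d"
  obtains C :: real where "C \<ge> 0" "\<And>x. x \<in> carrier_vec d \<Longrightarrow> x \<bullet> (M *\<^sub>v x) \<le> C * (x \<bullet> x)"
proof
  let ?C = "\<Sum>i<d. \<Sum>j<d. \<bar>M $$ (i, j)\<bar>"
  show "0 \<le> ?C" by (intro sum_nonneg) auto
  fix x :: "real vec" assume x: "x \<in> carrier_vec d"
  have le: "(x $ i)\<^sup>2 \<le> x \<bullet> x" if "i < d" for i
    unfolding scalar_prod_self[OF x] by (rule member_le_sum) (use that in auto)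
  have "x \<bullet> (M *\<^sub>v x) = (\<Sum>i<d. \<Sum>j<d. M $$ (i, j) * (x $ i * x $ j))"
    by (rule scalar_prod_mult_mat_vec[OF M x x])
  also have "\<dots> \<le> (\<Sum>i<d. \<Sum>j<d. \<bar>M $$ (i, j)\<bar> * (x \<bullet> x))"
  proof (intro sum_mono)
    fix i j assume ij: "i \<in> {..<d}" "j \<in> {..<d}"
    have "0 \<le> (\<bar>x $ i\<bar> - \<bar>x $ j\<bar>)\<^sup>2" by simp
    then have "2 * \<bar>x $ i * x $ j\<bar> \<le> (x $ i)\<^sup>2 + (x $ j)\<^sup>2"
      by (simp add: power2_diff abs_mult)
    then have "\<bar>x $ i * x $ j\<bar> \<le> x \<bullet> x" using le[of i] le[of j] ij by auto
    then have "\<bar>M $$ (i, j)\<bar> * \<bar>x $ i * x $ j\<bar> \<le> \<bar>M $$ (i, j)\<bar> * (x \<bullet> x)"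
      by (rule mult_left_mono) simp
    then show "M $$ (i, j) * (x $ i * x $ j) \<le> \<bar>M $$ (i, j)\<bar> * (x \<bullet> x)"
      unfolding abs_mult[symmetric] by (rule order_trans[OF abs_ge_self])
  qed
  also have "\<dots> = ?C * (x \<bullet> x)" by (simp add: sum_distrib_right)
  finally show "x \<bullet> (M *\<^sub>v x) \<le> ?C * (x \<bullet> x)" .
qed

text \<open>A closed part of a product of compact intervals.\<close>

lemma compact_sphere_functions:
  "compact {f :: nat \<Rightarrow> real. (\<forall>i\<ge>d. f i = 0) \<and> (\<Sum>i<d. (f i)\<^sup>2) = 1}" (is "compact ?S")
proof -
  let ?B = "PiE UNIV (\<lambda>i. if i < d then {-1..1} else {0::real})"
  have "compactin (product_topology (\<lambda>i::nat. euclidean) UNIV) ?B"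
    unfolding compactin_PiE by simp
  then have B: "compact ?B" by (simp add: euclidean_product_topology)
  have c: "continuous_on UNIV (\<lambda>f :: nat \<Rightarrow> real. f i)" for i
    by (rule continuous_on_product_coordinates)
  have "closed {f :: nat \<Rightarrow> real. (\<Sum>i<d. (f i)\<^sup>2) = 1}"
    by (intro closed_Collect_eq continuous_intros c)
  then have "compact (?B \<inter> {f. (\<Sum>i<d. (f i)\<^sup>2) = 1})" by (rule compact_Int_closed[OF B])
  moreover have "?B \<inter> {f. (\<Sum>i<d. (f i)\<^sup>2) = 1} = ?S"
  proof (rule equalityI; rule subsetI)
    fix f assume f: "f \<in> ?B \<inter> {f. (\<Sum>i<d. (f i)\<^sup>2) = 1}"
    have "f i = 0" if "i \<ge> d" for i
    proof -
      have "f i \<in> (if i < d then {-1..1} else {0})" using f by blast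
      then show ?thesis using that by simp
    qed
    then show "f \<in> ?S" using f by auto
  next
    fix f assume f: "f \<in> ?S"
    have "f i \<in> (if i < d then {-1..1} else {0})" for i
    proof (cases "i < d")
      case True
      have "(f i)\<^sup>2 \<le> (\<Sum>i<d. (f i)\<^sup>2)" by (rule member_le_sum) (use True in auto)
      then have "(f i)\<^sup>2 \<le> 1" using f by simp
      then have "\<bar>f i\<bar> \<le> 1" by (simp add: abs_square_le_1)
      then show ?thesis using True by auto
    qed (use f in auto)
    then show "f \<in> ?B \<inter> {f. (\<Sum>i<d. (f i)\<^sup>2) = 1}" using f by (auto simp: PiE_iff)
  qed
  ultimately show ?thesis by simp
qed

text \<open>The form has a positive minimum on the unit sphere, and homogeneity extends the bound to all vectors.\<close>

lemma positive_form_coercive: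
  assumes M: "M \<in> carrier_mat d d"
    and pos: "\<And>x. x \<in> carrier_vec d \<Longrightarrow> x \<noteq> 0\<^sub>v d \<Longrightarrow> 0 < x \<bullet> (M *\<^sub>v x)"
  obtains \<epsilon> :: real where "\<epsilon> > 0" "\<And>x. x \<in> carrier_vec d \<Longrightarrow> \<epsilon> * (x \<bullet> x) \<le> x \<bullet> (M *\<^sub>v x)"
proof -
  let ?S = "{f :: nat \<Rightarrow> real. (\<forall>i\<ge>d. f i = 0) \<and> (\<Sum>i<d. (f i)\<^sup>2) = 1}"
  define q where "q f = (\<Sum>i<d. \<Sum>j<d. M $$ (i, j) * (f i * f j))" for f :: "nat \<Rightarrow> real"
  have c: "continuous_on ?S (\<lambda>f :: nat \<Rightarrow> real. f i)" for i
    by (rule continuous_on_subset[OF continuous_on_product_coordinates]) simp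
  have cq: "continuous_on ?S q" unfolding q_def by (intro continuous_intros c)
  have qv: "q f = vec d f \<bullet> (M *\<^sub>v vec d f)" for f
    unfolding q_def using M by (subst scalar_prod_mult_mat_vec[OF M]) auto
  have "\<exists>\<epsilon>>0. \<forall>f\<in>?S. \<epsilon> \<le> q f"
  proof (cases "?S = {}")
    case True show ?thesis unfolding True by (intro exI[of _ 1]) simp
  next
    case False
    then obtain f where f: "f \<in> ?S" "\<And>g. g \<in> ?S \<Longrightarrow> q f \<le> q g"
      using continuous_attains_inf[OF compact_sphere_functions False cq] by auto
    have "vec d f \<noteq> 0\<^sub>v d"
    proof
      assume z: "vec d f = 0\<^sub>v d"
      have "f i = 0" if "i < d" for i using arg_cong[OF z, of "\<lambda>v. v $ i"] that by simp
      then have "(\<Sum>i<d. (f i)\<^sup>2) = 0" by simp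
      then show False using f(1) by simp
    qed
    then have "0 < q f" unfolding qv by (intro pos) auto
    then show ?thesis using f(2) by blast
  qed
  then obtain \<epsilon> where e: "\<epsilon> > 0" "\<And>f. f \<in> ?S \<Longrightarrow> \<epsilon> \<le> q f" by blast
  show ?thesis
  proof (rule that[OF e(1)])
    fix x :: "real vec" assume x: "x \<in> carrier_vec d"
    have qx: "x \<bullet> (M *\<^sub>v x) = (\<Sum>i<d. \<Sum>j<d. M $$ (i, j) * (x $ i * x $ j))"
      by (rule scalar_prod_mult_mat_vec[OF M x x])
    show "\<epsilon> * (x \<bullet> x) \<le> x \<bullet> (M *\<^sub>v x)"
    proof (cases "x \<bullet> x = 0")
      case True
      then have "\<forall>i\<in>{..<d}. (x $ i)\<^sup>2 = 0"
        unfolding scalar_prod_self[OF x] by (subst (asm) sum_nonneg_eq_0_iff) auto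
      then show ?thesis unfolding qx True by simp
    next
      case False
      then have r: "x \<bullet> x > 0"
        unfolding scalar_prod_self[OF x] by (simp add: less_le sum_nonneg)
      define f where "f i = (if i < d then x $ i / sqrt (x \<bullet> x) else 0)" for i
      have "(\<Sum>i<d. (f i)\<^sup>2) = (\<Sum>i<d. (x $ i)\<^sup>2 / (x \<bullet> x))"
        using r by (intro sum.cong) (auto simp: f_def power_divide)
      also have "\<dots> = 1"
        using r scalar_prod_self[OF x] by (simp add: sum_divide_distrib[symmetric])
      finally have "f \<in> ?S" by (simp add: f_def)
      then have "\<epsilon> \<le> q f" by (rule e(2))
      also have "q f = (\<Sum>i<d. \<Sum>j<d. M $$ (i, j) * (x $ i * x $ j) / (x \<bullet> x))"
        unfolding q_def
      proof (intro sum.cong refl)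
        fix i j assume "i \<in> {..<d}" "j \<in> {..<d}"
        moreover have "sqrt (x \<bullet> x) * sqrt (x \<bullet> x) = x \<bullet> x" using r by simp
        ultimately show "M $$ (i, j) * (f i * f j) = M $$ (i, j) * (x $ i * x $ j) / (x \<bullet> x)"
          by (simp add: f_def)
      qed
      also have "\<dots> = x \<bullet> (M *\<^sub>v x) / (x \<bullet> x)"
        unfolding qx by (simp add: sum_divide_distrib)
      finally show ?thesis using r by (simp add: field_simps)
    qed
  qed
qed

lemma append_cols_carrier [simp, intro]:
  "M \<in> carrier_mat nr nc1 \<Longrightarrow> M' \<in> carrier_mat nr nc2 \<Longrightarrow> M @\<^sub>c M' \<in> carrier_mat nr (nc1 + nc2)"
  unfolding append_cols_def carrier_mat_def by auto

lemma append_vec_empty: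
  fixes v w :: "real vec" assumes "w \<in> carrier_vec 0" shows "v @\<^sub>v w = v"
proof (rule eq_vecI)
  have d: "dim_vec w = 0" using assms by (rule carrier_vecD)
  show "dim_vec (v @\<^sub>v w) = dim_vec v" by (simp only: index_append_vec d add_0_right)
  show "(v @\<^sub>v w) $ i = v $ i" if "i < dim_vec v" for i
    using that by (simp only: index_append_vec d add_0_right if_True)
qed

lemma append_vec_assoc:
  fixes u v w :: "real vec" shows "(u @\<^sub>v v) @\<^sub>v w = u @\<^sub>v v @\<^sub>v w"
  by (rule eq_vecI) (auto simp: diff_diff_left)

lemma append_cols_mult_vec:
  fixes M M' :: "real mat"
  assumes "M \<in> carrier_mat nr nc1" "M' \<in> carrier_mat nr nc2" "a \<in> carrier_vec nc1" "b \<in> carrier_vec nc2"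
  shows "(M @\<^sub>c M') *\<^sub>v (a @\<^sub>v b) = M *\<^sub>v a + M' *\<^sub>v b"
proof -
  have dc: "dim_col M = nc1" "dim_col M' = nc2" using assms by auto
  have "(M @\<^sub>c M') *\<^sub>v (a @\<^sub>v b) = (M *\<^sub>v a + M' *\<^sub>v b) @\<^sub>v (0\<^sub>m 0 nc1 *\<^sub>v a + 0\<^sub>m 0 nc2 *\<^sub>v b)"
    unfolding append_cols_def dc 
    by (rule four_block_mat_mult_vec[OF assms(1,2) zero_carrier_mat zero_carrier_mat assms(3,4)])
  also have "\<dots> = M *\<^sub>v a + M' *\<^sub>v b"
    by (intro append_vec_empty carrier_vecI) simp
  finally show ?thesis .
qed

lemma zero_mult_mat_vec: "v \<in> carrier_vec k \<Longrightarrow> 0\<^sub>m m k *\<^sub>v v = (0\<^sub>v m :: real vec)"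
  by (rule eq_vecI) simp_all

lemma append_zero_cols_mult_vec:
  fixes M :: "real mat"
  assumes "M \<in> carrier_mat m k" "a \<in> carrier_vec k" "b \<in> carrier_vec l"
  shows "(M @\<^sub>c 0\<^sub>m m l) *\<^sub>v (a @\<^sub>v b) = M *\<^sub>v a"
  unfolding append_cols_mult_vec[OF assms(1) zero_carrier_mat assms(2,3)] zero_mult_mat_vec[OF assms(3)]
  by (rule right_zero_vec) (rule mult_mat_vec_carrier[OF assms(1,2)])

lemma zero_append_cols_mult_vec:
  fixes M :: "real mat"
  assumes "M \<in> carrier_mat m l" "a \<in> carrier_vec k" "b \<in> carrier_vec l"
  shows "(0\<^sub>m m k @\<^sub>c M) *\<^sub>v (a @\<^sub>v b) = M *\<^sub>v b"
  unfolding append_cols_mult_vec[OF zero_carrier_mat assms] zero_mult_mat_vec[OF assms(2)]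
  by (rule left_zero_vec) (rule mult_mat_vec_carrier[OF assms(1,3)])

lemma quadratic_form_He:
  fixes M :: "real mat"
  assumes M: "M \<in> carrier_mat d d" and x: "x \<in> carrier_vec d"
  shows "x \<bullet> (He M *\<^sub>v x) = 2 * (x \<bullet> (M *\<^sub>v x))"
proof -
  have "x \<bullet> (He M *\<^sub>v x) = x \<bullet> (M *\<^sub>v x) + x \<bullet> (transpose_mat M *\<^sub>v x)"
    unfolding He_def using assms
    by (simp add: add_mult_distrib_mat_vec[where nr=d and nc=d] scalar_prod_add_distrib[where n=d])
  also have "x \<bullet> (transpose_mat M *\<^sub>v x) = (transpose_mat M *\<^sub>v x) \<bullet> x"
    using assms by (intro comm_scalar_prod[of _ d]) auto
  also have "\<dots> = x \<bullet> (M *\<^sub>v x)" by (rule transpose_vec_mult_scalar[OF M x x])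
  finally show ?thesis by simp
qed

lemma quadratic_form_product:
  fixes M :: "real mat"
  assumes "T \<in> carrier_mat m d" "M \<in> carrier_mat m m" "U \<in> carrier_mat m d" "x \<in> carrier_vec d"
  shows "x \<bullet> ((transpose_mat T * M * U) *\<^sub>v x) = (T *\<^sub>v x) \<bullet> (M *\<^sub>v (U *\<^sub>v x))"
proof -
  have "(transpose_mat T * M * U) *\<^sub>v x = transpose_mat T *\<^sub>v (M *\<^sub>v (U *\<^sub>v x))"
    using assms by (simp add: assoc_mult_mat_vec[where n\<^sub>1=d and n\<^sub>2=m and n\<^sub>3=d]
       assoc_mult_mat_vec[where n\<^sub>1=d and n\<^sub>2=m and n\<^sub>3=m])
  then have "x \<bullet> ((transpose_mat T * M * U) *\<^sub>v x) = x \<bullet> (transpose_mat T *\<^sub>v (M *\<^sub>v (U *\<^sub>v x)))"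
    by (rule arg_cong)
  also have "\<dots> = (transpose_mat T *\<^sub>v (M *\<^sub>v (U *\<^sub>v x))) \<bullet> x"
    using assms by (intro comm_scalar_prod[of _ d]) auto
  also have "\<dots> = (M *\<^sub>v (U *\<^sub>v x)) \<bullet> (T *\<^sub>v x)"
    using assms by (intro transpose_vec_mult_scalar) auto
  also have "\<dots> = (T *\<^sub>v x) \<bullet> (M *\<^sub>v (U *\<^sub>v x))"
    using assms by (intro comm_scalar_prod[of _ m]) auto
  finally show ?thesis .
qed

text \<open>Two consecutive entries belong to one block, as in the block matrices \<open>L_mat\<close> and \<open>one_mat_N\<close>.\<close>

definition blocks :: "nat \<Rightarrow> (nat \<Rightarrow> nat \<Rightarrow> real) \<Rightarrow> real vec" where
  "blocks m Y = vec (2 * m) (\<lambda>j. Y (j div 2) (j mod 2))"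

lemma blocks_carrier [simp, intro]: "blocks m Y \<in> carrier_vec (2 * m)"
  and dim_blocks [simp]: "dim_vec (blocks m Y) = 2 * m"
  by (simp_all add: blocks_def)

lemma blocks_Suc: "blocks (Suc m) Y = vec 2 (Y 0) @\<^sub>v blocks m (\<lambda>k. Y (Suc k))"
proof (rule eq_vecI)
  fix j assume "j < dim_vec (vec 2 (Y 0) @\<^sub>v blocks m (\<lambda>k. Y (Suc k)))"
  then have j: "j < 2 * m + 2" by simp
  show "blocks (Suc m) Y $ j = (vec 2 (Y 0) @\<^sub>v blocks m (\<lambda>k. Y (Suc k))) $ j"
  proof (cases "j < 2")
    case True
    then show ?thesis using j by (simp add: blocks_def)
  next
    case False
    then obtain l where l: "j = l + 2" by (intro that[of "j - 2"]) simp
    then show ?thesis using j by (simp add: blocks_def)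
  qed
qed simp

lemma quadratic_form_diag_block_Cons:
  fixes M :: "real mat"
  assumes M: "M \<in> carrier_mat d d" and D: "diag_block_mat Ms \<in> carrier_mat e e"
    and a: "a \<in> carrier_vec d" and b: "b \<in> carrier_vec e"
  shows "(a @\<^sub>v b) \<bullet> (diag_block_mat (M # Ms) *\<^sub>v (a @\<^sub>v b)) = a \<bullet> (M *\<^sub>v a) + b \<bullet> (diag_block_mat Ms *\<^sub>v b)"
proof -
  have dims: "dim_row M = d" "dim_col M = d" "dim_row (diag_block_mat Ms) = e" "dim_col (diag_block_mat Ms) = e"
    using M D by (simp_all only: carrier_matD)
  have "diag_block_mat (M # Ms) *\<^sub>v (a @\<^sub>v b) = (M *\<^sub>v a) @\<^sub>v (diag_block_mat Ms *\<^sub>v b)"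
    unfolding diag_block_mat.simps Let_def dims by (rule mult_mat_vec_split[OF M D a b])
  then show ?thesis
    using scalar_prod_append[OF a b mult_mat_vec_carrier[OF M a] mult_mat_vec_carrier[OF D b]] by simp
qed

lemma diag_block_carrier:
  assumes R: "R \<in> carrier_mat 2 2"
  shows "diag_block_mat (map (\<lambda>k. r k \<cdot>\<^sub>m R) ks @ [0\<^sub>m 2 2]) \<in> carrier_mat (2 * length ks + 2) (2 * length ks + 2)"
proof -
  have "dim_row R = 2" "dim_col R = 2" using R by auto
  then show ?thesis
    by (intro carrier_matI) (simp_all add: dim_diag_block_mat comp_def sum_list_triv)
qed

text \<open>The zero block at the end acts on the two boundary values. It is kept in the statement because the
  induction on \<open>ks\<close> removes blocks from the front.\<close>

lemma quadratic_form_blocks: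
  fixes R :: "real mat"
  assumes R: "R \<in> carrier_mat 2 2" and z: "\<zeta> \<in> carrier_vec 2"
  shows "(blocks (length ks) Y @\<^sub>v \<zeta>) \<bullet> (diag_block_mat (map (\<lambda>k. r k \<cdot>\<^sub>m R) ks @ [0\<^sub>m 2 2]) *\<^sub>v (blocks (length ks) Y @\<^sub>v \<zeta>))
    = (\<Sum>p<length ks. r (ks ! p) * form2 R (\<lambda>i j. Y p i * Y p j))"
proof (induction ks arbitrary: Y)
  case Nil
  have "blocks 0 Y @\<^sub>v \<zeta> = \<zeta>" by (intro eq_vecI) auto
  then show ?case using quadratic_form_zero[OF z] by (simp del: diag_block_mat.simps)
next
  case (Cons k ks)
  let ?D = "diag_block_mat (map (\<lambda>k. r k \<cdot>\<^sub>m R) ks @ [0\<^sub>m 2 2])"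
  let ?b = "blocks (length ks) (\<lambda>k. Y (Suc k)) @\<^sub>v \<zeta>"
  have b: "?b \<in> carrier_vec (2 * length ks + 2)" by (rule append_carrier_vec[OF blocks_carrier z])
  have "blocks (Suc (length ks)) Y @\<^sub>v \<zeta> = vec 2 (Y 0) @\<^sub>v ?b"
    unfolding blocks_Suc by (rule append_vec_assoc)
  moreover have "length (k # ks) = Suc (length ks)" by simp
  moreover have "map (\<lambda>k. r k \<cdot>\<^sub>m R) (k # ks) @ [0\<^sub>m 2 2] = (r k \<cdot>\<^sub>m R) # map (\<lambda>k. r k \<cdot>\<^sub>m R) ks @ [0\<^sub>m 2 2]" by simp
  moreover have "(vec 2 (Y 0) @\<^sub>v ?b) \<bullet> (diag_block_mat ((r k \<cdot>\<^sub>m R) # map (\<lambda>k. r k \<cdot>\<^sub>m R) ks @ [0\<^sub>m 2 2]) *\<^sub>v (vec 2 (Y 0) @\<^sub>v ?b))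
     = vec 2 (Y 0) \<bullet> ((r k \<cdot>\<^sub>m R) *\<^sub>v vec 2 (Y 0)) + ?b \<bullet> (?D *\<^sub>v ?b)"
    by (rule quadratic_form_diag_block_Cons[OF _ diag_block_carrier[OF R] _ b]) (use R in simp_all)
  ultimately have "(blocks (length (k # ks)) Y @\<^sub>v \<zeta>) \<bullet> (diag_block_mat (map (\<lambda>k. r k \<cdot>\<^sub>m R) (k # ks) @ [0\<^sub>m 2 2]) *\<^sub>v (blocks (length (k # ks)) Y @\<^sub>v \<zeta>))
     = vec 2 (Y 0) \<bullet> ((r k \<cdot>\<^sub>m R) *\<^sub>v vec 2 (Y 0)) + ?b \<bullet> (?D *\<^sub>v ?b)"
    by (simp only:)
  also have "vec 2 (Y 0) \<bullet> ((r k \<cdot>\<^sub>m R) *\<^sub>v vec 2 (Y 0)) = r k * form2 R (\<lambda>i j. Y 0 i * Y 0 j)"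
    using R by (subst scalar_prod_mult_mat_vec[of _ 2 2]) (auto simp: form2_def sum_lessThan_2 algebra_simps)
  also have "?b \<bullet> (?D *\<^sub>v ?b) = (\<Sum>p<length ks. r (ks ! p) * form2 R (\<lambda>i j. Y (Suc p) i * Y (Suc p) j))"
    by (rule Cons.IH)
  finally show ?case by (simp add: sum.lessThan_Suc_shift del: sum.lessThan_Suc diag_block_mat.simps)
qed

lemma quadratic_form_R_tilde:
  assumes R: "R \<in> carrier_mat 2 2" and z: "\<zeta> \<in> carrier_vec 2" and X: "X \<in> carrier_vec n"
  shows "(X @\<^sub>v blocks (N + 1) Y @\<^sub>v \<zeta>) \<bullet> (R_tilde n N R *\<^sub>v (X @\<^sub>v blocks (N + 1) Y @\<^sub>v \<zeta>))
    = (\<Sum>k\<le>N. (2 * real k + 1) * form2 R (\<lambda>i j. Y k i * Y k j))"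
proof -
  let ?Ms = "map (\<lambda>k. real (2 * k + 1) \<cdot>\<^sub>m R) [0..<N + 1] @ [0\<^sub>m 2 2]"
  have D: "diag_block_mat ?Ms \<in> carrier_mat (2 * (N + 1) + 2) (2 * (N + 1) + 2)"
    using diag_block_carrier[OF R, of "\<lambda>k. real (2 * k + 1)" "[0..<N + 1]"] by (simp del: diag_block_mat.simps upt_Suc)
  have b: "blocks (N + 1) Y @\<^sub>v \<zeta> \<in> carrier_vec (2 * (N + 1) + 2)" by (rule append_carrier_vec[OF blocks_carrier z])
  have "(X @\<^sub>v blocks (N + 1) Y @\<^sub>v \<zeta>) \<bullet> (R_tilde n N R *\<^sub>v (X @\<^sub>v blocks (N + 1) Y @\<^sub>v \<zeta>))
     = X \<bullet> (0\<^sub>m n n *\<^sub>v X) + (blocks (N + 1) Y @\<^sub>v \<zeta>) \<bullet> (diag_block_mat ?Ms *\<^sub>v (blocks (N + 1) Y @\<^sub>v \<zeta>))"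
    unfolding R_tilde_def append_Cons append_Nil
    by (rule quadratic_form_diag_block_Cons[OF zero_carrier_mat D X b])
  also have "X \<bullet> (0\<^sub>m n n *\<^sub>v X) = 0" by (rule quadratic_form_zero[OF X])
  finally show ?thesis
    using quadratic_form_blocks[OF R z, of "[0..<N + 1]" Y "\<lambda>k. real (2 * k + 1)"]
    by (simp add: lessThan_Suc_atMost add.commute[of 1 "2 * real _"] del: diag_block_mat.simps upt_Suc)
qed

section \<open>The matrix inequality as a quadratic form in the boundary and moment data\<close>

lemma sum_pairs: "(\<Sum>i<2 * m. f i) = (\<Sum>k<m. \<Sum>r<2. f (2 * k + r))" for f :: "nat \<Rightarrow> real"
  by (induction m) (auto simp: sum_lessThan_2)

lemma blocks_scalar_prod: "blocks m Y \<bullet> blocks m Y = (\<Sum>k<m. \<Sum>r<2. (Y k r)\<^sup>2)"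
proof -
  have "blocks m Y \<bullet> blocks m Y = (\<Sum>i<2 * m. (Y (i div 2) (i mod 2))\<^sup>2)"
    unfolding scalar_prod_self[OF blocks_carrier] by (intro sum.cong) (auto simp: blocks_def)
  also have "\<dots> = (\<Sum>k<m. \<Sum>r<2. (Y k r)\<^sup>2)"
    unfolding sum_pairs by (intro sum.cong) auto
  finally show ?thesis .
qed

definition quad_form :: "real mat \<Rightarrow> real vec \<Rightarrow> real" where "quad_form M x = x \<bullet> (M *\<^sub>v x)"

lemma quad_form_sum: "M \<in> carrier_mat d d \<Longrightarrow> x \<in> carrier_vec d \<Longrightarrow>
    quad_form M x = (\<Sum>i<d. \<Sum>j<d. M $$ (i, j) * (x $ i * x $ j))"
  unfolding quad_form_def by (rule scalar_prod_mult_mat_vec)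

lemma quad_form_add:
  assumes "M \<in> carrier_mat d d" "M' \<in> carrier_mat d d" "x \<in> carrier_vec d"
  shows "quad_form (M + M') x = quad_form M x + quad_form M' x"
proof -
  have "M + M' \<in> carrier_mat d d" using assms by auto
  then show ?thesis
    using assms by (simp add: quad_form_sum[where d=d] sum.distrib[symmetric] distrib_right)
qed

lemma quad_form_diff:
  assumes "M \<in> carrier_mat d d" "M' \<in> carrier_mat d d" "x \<in> carrier_vec d"
  shows "quad_form (M - M') x = quad_form M x - quad_form M' x"
proof -
  have "M - M' \<in> carrier_mat d d" using assms by auto
  then show ?thesis
    using assms by (simp add: quad_form_sum[where d=d] sum_subtractf[symmetric] left_diff_distrib)
qed

lemma quad_form_smult:
  assumes "M \<in> carrier_mat d d" "x \<in> carrier_vec d"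
  shows "quad_form (a \<cdot>\<^sub>m M) x = a * quad_form M x"
proof -
  have "a \<cdot>\<^sub>m M \<in> carrier_mat d d" using assms by auto
  then show ?thesis
    using assms by (simp add: quad_form_sum[where d=d] sum_distrib_left mult.assoc)
qed

locale lyapunov_data =
  fixes n N :: nat and A B K :: "real mat" and c c0 :: real and P S R :: "real mat"
  assumes A: "A \<in> carrier_mat n n" and B: "B \<in> carrier_mat n 1" and K: "K \<in> carrier_mat 1 n"
    and c_pos: "c > 0"
    and P: "sym_pos_def (n + 2 * (N + 1)) P" and S: "sym_pos_def 2 S" and R: "sym_pos_def 2 R"
    and Psi: "sym_neg_def (n + 2 * (N + 1) + 2) (Psi_mat n N A B K c c0 P S R)"
begin

text \<open>\<open>dz\<close> is the dimension of the vector \<open>z\<close> that \<open>P\<close> acts on; the other abbreviations are the matrices of the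
  inequality for the fixed data.\<close>

abbreviation "dz \<equiv> n + 2 * (N + 1)"
abbreviation "NNm \<equiv> NN_mat n N A B K c"
abbreviation "Gm \<equiv> G_mat n N A B K c c0"
abbreviation "Hm \<equiv> H_mat n N A B K c c0"
abbreviation "ZZm \<equiv> ZZ_mat n N A B K c c0"
abbreviation "Zm \<equiv> Z_mat n N A B K c c0"
abbreviation "Fm \<equiv> F_mat n N"
abbreviation "Psim \<equiv> Psi_mat n N A B K c c0 P S R"

text \<open>The right-hand side of the differential equation for \<open>X\<close>, with \<open>u(1)\<close> eliminated: \<open>u(1) - u(0)\<close> is the
  integral of \<open>u\<^sub>x\<close>, which is \<open>(y 0 - y 1) / (2 c)\<close> if \<open>y\<close> holds the mean values of the two Riemann
  coordinates, and \<open>u(0) = K X\<close>.\<close>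

definition drift :: "real vec \<Rightarrow> (nat \<Rightarrow> real) \<Rightarrow> real vec" where
  "drift X y = (A + B * K) *\<^sub>v X + B_tilde B c *\<^sub>v vec 2 y"

text \<open>Everything that enters the time derivative of the functional: \<open>X\<close>, the moments \<open>Y\<close> of the Riemann
  coordinates, and the numbers \<open>\<zeta> = (u\<^sub>t(1), c u\<^sub>x(0))\<close>.\<close>

definition xi :: "real vec \<Rightarrow> (nat \<Rightarrow> nat \<Rightarrow> real) \<Rightarrow> (nat \<Rightarrow> real) \<Rightarrow> real vec" where
  "xi X Y \<zeta> = X @\<^sub>v blocks (N + 1) Y @\<^sub>v vec 2 \<zeta>"

lemma P_carrier: "P \<in> carrier_mat dz dz"
  and S_carrier: "S \<in> carrier_mat 2 2" and R_carrier: "R \<in> carrier_mat 2 2"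
  using P S R unfolding sym_pos_def_def by blast+

lemma xi_carrier: "X \<in> carrier_vec n \<Longrightarrow> xi X Y \<zeta> \<in> carrier_vec (dz + 2)"
  unfolding xi_def append_vec_assoc[symmetric]
  by (intro append_carrier_vec blocks_carrier vec_carrier)

lemma B_tilde_carrier: "B_tilde B c \<in> carrier_mat n 2"
  using B unfolding B_tilde_def by (auto simp: mat_of_rows_list_def)

lemma ABK_carrier: "A + B * K \<in> carrier_mat n n"
  using A B K by auto

lemma drift_carrier: "drift X y \<in> carrier_vec n"
  unfolding drift_def using B_tilde_carrier by (intro carrier_vecI) simp

lemma NN_carrier: "NNm \<in> carrier_mat n (dz + 2)"
proof -
  have "NNm \<in> carrier_mat n (n + (2 + 2 * (N + 1)))"
    unfolding NN_mat_def by (intro append_cols_carrier ABK_carrier B_tilde_carrier zero_carrier_mat)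
  then show ?thesis by (simp add: ac_simps)
qed

lemma NN_xi:
  assumes X: "X \<in> carrier_vec n"
  shows "NNm *\<^sub>v xi X Y \<zeta> = drift X (Y 0)"
proof -
  let ?r = "blocks N (\<lambda>k. Y (Suc k)) @\<^sub>v vec 2 \<zeta>"
  have r: "?r \<in> carrier_vec (2 * (N + 1))"
    using append_carrier_vec[OF blocks_carrier[of N "\<lambda>k. Y (Suc k)"] vec_carrier[of 2 \<zeta>]] by simp
  have xi: "xi X Y \<zeta> = X @\<^sub>v vec 2 (Y 0) @\<^sub>v ?r"
    unfolding xi_def by (simp add: blocks_Suc append_vec_assoc)
  show ?thesis
    unfolding NN_mat_def xi drift_def
      append_cols_mult_vec[OF ABK_carrier append_cols_carrier[OF B_tilde_carrier zero_carrier_mat] X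
        append_carrier_vec[OF vec_carrier r]]
      append_zero_cols_mult_vec[OF B_tilde_carrier vec_carrier r] ..
qed

lemma zero_cols_xi:
  assumes X: "X \<in> carrier_vec n" and g: "g \<in> carrier_mat m 2"
  shows "(0\<^sub>m m dz @\<^sub>c g) *\<^sub>v xi X Y \<zeta> = g *\<^sub>v vec 2 \<zeta>"
proof -
  have z: "X @\<^sub>v blocks (N + 1) Y \<in> carrier_vec dz"
    by (intro append_carrier_vec X blocks_carrier)
  show ?thesis
    unfolding xi_def append_vec_assoc[symmetric] by (rule zero_append_cols_mult_vec[OF g z vec_carrier])
qed

lemma g_carrier: "g_mat c c0 \<in> carrier_mat 2 2" and h_carrier: "h_mat c c0 \<in> carrier_mat 2 2"
  by (auto simp: g_mat_def h_mat_def mat_of_rows_list_def)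

lemma g_vec: "g_mat c c0 *\<^sub>v vec 2 \<zeta> = vec 2 (\<lambda>i. if i = 0 then \<zeta> (Suc 0) else (1 + c * c0) * \<zeta> 0)"
  by (rule eq_vecI)
    (auto simp: g_mat_def mat_of_rows_list_def scalar_prod_def numeral_2_eq_2 less_Suc_eq)

lemma h_vec: "h_mat c c0 *\<^sub>v vec 2 \<zeta> = vec 2 (\<lambda>i. if i = 0 then (1 - c * c0) * \<zeta> 0 else - \<zeta> (Suc 0))"
  by (rule eq_vecI)
    (auto simp: h_mat_def mat_of_rows_list_def scalar_prod_def numeral_2_eq_2 less_Suc_eq)

definition Kdrift :: "real vec \<Rightarrow> (nat \<Rightarrow> real) \<Rightarrow> real" where
  "Kdrift X y = (K *\<^sub>v drift X y) $ 0"

text \<open>The Riemann coordinates at \<open>x = 0\<close> and, in the next definition, at \<open>x = 1\<close>, after insertion of the boundary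
  conditions; \<open>k\<close> stands for \<open>u\<^sub>t(0)\<close>, which is \<open>K\<close> applied to the derivative of \<open>X\<close>.\<close>

definition left_trace :: "real \<Rightarrow> (nat \<Rightarrow> real) \<Rightarrow> nat \<Rightarrow> real" where
  "left_trace k \<zeta> i = (if i = 0 then \<zeta> (Suc 0) + k else (1 + c * c0) * \<zeta> 0)"

definition right_trace :: "real \<Rightarrow> (nat \<Rightarrow> real) \<Rightarrow> nat \<Rightarrow> real" where
  "right_trace k \<zeta> i = (if i = 0 then (1 - c * c0) * \<zeta> 0 else k - \<zeta> (Suc 0))"

lemma K0_carrier: "K @\<^sub>r 0\<^sub>m 1 n \<in> carrier_mat 2 n" "0\<^sub>m 1 n @\<^sub>r K \<in> carrier_mat 2 n"
  using carrier_append_rows[OF K zero_carrier_mat[of 1 n]] carrier_append_rows[OF zero_carrier_mat[of 1 n] K]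
  unfolding one_add_one .

lemma G_carrier: "Gm \<in> carrier_mat 2 (dz + 2)"
  unfolding G_mat_def
  by (intro add_carrier_mat mult_carrier_mat[OF K0_carrier(1) NN_carrier])

lemma H_carrier: "Hm \<in> carrier_mat 2 (dz + 2)"
  unfolding H_mat_def
  by (intro add_carrier_mat mult_carrier_mat[OF K0_carrier(2) NN_carrier])

lemma trace_rows_xi:
  assumes X: "X \<in> carrier_vec n" and g: "g \<in> carrier_mat 2 2" and Q: "Q \<in> carrier_mat 2 n"
  shows "((0\<^sub>m 2 dz @\<^sub>c g) + Q * NNm) *\<^sub>v xi X Y \<zeta> = g *\<^sub>v vec 2 \<zeta> + Q *\<^sub>v drift X (Y 0)"
  unfolding add_mult_distrib_mat_vec[OF append_cols_carrier[OF zero_carrier_mat g]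
      mult_carrier_mat[OF Q NN_carrier] xi_carrier[OF X]]
    zero_cols_xi[OF X g] assoc_mult_mat_vec[OF Q NN_carrier xi_carrier[OF X]] NN_xi[OF X] ..

lemma K0_drift:
  "(K @\<^sub>r 0\<^sub>m 1 n) *\<^sub>v drift X y = vec 2 (\<lambda>i. if i = 0 then Kdrift X y else 0)"
  "(0\<^sub>m 1 n @\<^sub>r K) *\<^sub>v drift X y = vec 2 (\<lambda>i. if i = 0 then 0 else Kdrift X y)"
proof -
  have v: "K *\<^sub>v drift X y = vec 1 (\<lambda>_. Kdrift X y)"
    using K unfolding Kdrift_def by (intro eq_vecI) auto
  have z: "0\<^sub>m 1 n *\<^sub>v drift X y = vec 1 (\<lambda>_. 0)"
    unfolding zero_mult_mat_vec[OF drift_carrier] by (intro eq_vecI) auto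
  show "(K @\<^sub>r 0\<^sub>m 1 n) *\<^sub>v drift X y = vec 2 (\<lambda>i. if i = 0 then Kdrift X y else 0)"
    unfolding mat_mult_append[OF K zero_carrier_mat drift_carrier] v z by (intro eq_vecI) auto
  show "(0\<^sub>m 1 n @\<^sub>r K) *\<^sub>v drift X y = vec 2 (\<lambda>i. if i = 0 then 0 else Kdrift X y)"
    unfolding mat_mult_append[OF zero_carrier_mat K drift_carrier] v z by (intro eq_vecI) auto
qed

lemma G_xi:
  assumes X: "X \<in> carrier_vec n"
  shows "Gm *\<^sub>v xi X Y \<zeta> = vec 2 (left_trace (Kdrift X (Y 0)) \<zeta>)"
  unfolding G_mat_def trace_rows_xi[OF X g_carrier K0_carrier(1)] g_vec K0_drift
  by (intro eq_vecI) (auto simp: left_trace_def)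

lemma H_xi:
  assumes X: "X \<in> carrier_vec n"
  shows "Hm *\<^sub>v xi X Y \<zeta> = vec 2 (right_trace (Kdrift X (Y 0)) \<zeta>)"
  unfolding H_mat_def trace_rows_xi[OF X h_carrier K0_carrier(2)] h_vec K0_drift
  by (intro eq_vecI) (auto simp: right_trace_def)

lemma L_blocks: "L_mat N *\<^sub>v blocks (N + 1) Y = blocks (N + 1) (\<lambda>k r. \<Sum>l\<le>N. ell k l * Y l r)"
proof (rule eq_vecI)
  show "dim_vec (L_mat N *\<^sub>v blocks (N + 1) Y) = dim_vec (blocks (N + 1) (\<lambda>k r. \<Sum>l\<le>N. ell k l * Y l r))"
    by (simp add: L_mat_def)
  fix i assume "i < dim_vec (blocks (N + 1) (\<lambda>k r. \<Sum>l\<le>N. ell k l * Y l r))"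
  then have i: "i < 2 * (N + 1)" by simp
  have "(L_mat N *\<^sub>v blocks (N + 1) Y) $ i
     = (\<Sum>j<2 * (N + 1). (if i mod 2 = j mod 2 then ell (i div 2) (j div 2) else 0) * Y (j div 2) (j mod 2))"
    using i by (auto simp: L_mat_def scalar_prod_def blocks_def lessThan_atLeast0 intro!: sum.cong)
  also have "\<dots> = (\<Sum>l<N + 1. \<Sum>r<2. (if i mod 2 = r then ell (i div 2) l * Y l r else 0))"
    unfolding sum_pairs by (intro sum.cong) auto
  also have "\<dots> = (\<Sum>l<N + 1. ell (i div 2) l * Y l (i mod 2))"
    by (intro sum.cong) (auto simp: sum_lessThan_2)
  finally show "(L_mat N *\<^sub>v blocks (N + 1) Y) $ i = blocks (N + 1) (\<lambda>k r. \<Sum>l\<le>N. ell k l * Y l r) $ i"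
    using i by (simp add: blocks_def lessThan_Suc_atMost)
qed

lemma one_blocks: "one_mat_N N *\<^sub>v vec 2 y = blocks (N + 1) (\<lambda>k. y)"
  by (rule eq_vecI)
    (auto simp: one_mat_N_def blocks_def scalar_prod_def atLeast0LessThan sum_lessThan_2 mod2_eq_if)

lemma one_bar_blocks: "one_bar_mat_N N *\<^sub>v vec 2 y = blocks (N + 1) (\<lambda>k r. (- 1) ^ k * y r)"
  by (rule eq_vecI)
    (auto simp: one_bar_mat_N_def blocks_def scalar_prod_def atLeast0LessThan sum_lessThan_2 mod2_eq_if)

lemma L_part_xi:
  assumes X: "X \<in> carrier_vec n"
  shows "(0\<^sub>m (2 * N + 2) n @\<^sub>c L_mat N @\<^sub>c 0\<^sub>m (2 * N + 2) 2) *\<^sub>v xi X Y \<zeta>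
    = blocks (N + 1) (\<lambda>k r. \<Sum>l\<le>N. ell k l * Y l r)"
proof -
  have L: "L_mat N \<in> carrier_mat (2 * N + 2) (2 * (N + 1))" by (simp add: L_mat_def)
  have b: "blocks (N + 1) Y \<in> carrier_vec (2 * (N + 1))" by (rule blocks_carrier)
  show ?thesis
    unfolding xi_def zero_append_cols_mult_vec[OF append_cols_carrier[OF L zero_carrier_mat] X
        append_carrier_vec[OF b vec_carrier]] append_zero_cols_mult_vec[OF L b vec_carrier] L_blocks ..
qed

lemma one_carrier: "one_mat_N N \<in> carrier_mat (2 * N + 2) 2" "one_bar_mat_N N \<in> carrier_mat (2 * N + 2) 2"
  by (simp_all add: one_mat_N_def one_bar_mat_N_def)

lemma L_part_carrier: "0\<^sub>m (2 * N + 2) n @\<^sub>c L_mat N @\<^sub>c 0\<^sub>m (2 * N + 2) 2 \<in> carrier_mat (2 * N + 2) (dz + 2)"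
proof -
  have L: "L_mat N \<in> carrier_mat (2 * N + 2) (2 * (N + 1))" by (simp add: L_mat_def)
  show ?thesis
    using append_cols_carrier[OF zero_carrier_mat append_cols_carrier[OF L zero_carrier_mat], of n 2]
    by (simp only: add.assoc)
qed

lemma ZZ_carrier: "ZZm \<in> carrier_mat (2 * N + 2) (dz + 2)"
  unfolding ZZ_mat_def
  by (intro minus_carrier_mat L_part_carrier)

lemma ZZ_xi:
  assumes X: "X \<in> carrier_vec n"
  shows "ZZm *\<^sub>v xi X Y \<zeta> = blocks (N + 1)
    (\<lambda>k r. right_trace (Kdrift X (Y 0)) \<zeta> r - (- 1) ^ k * left_trace (Kdrift X (Y 0)) \<zeta> r
        - (\<Sum>l\<le>N. ell k l * Y l r))"
proof -
  note x = xi_carrier[OF X, of Y \<zeta>]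
  note oH = mult_carrier_mat[OF one_carrier(1) H_carrier]
  note oG = mult_carrier_mat[OF one_carrier(2) G_carrier]
  let ?x = "xi X Y \<zeta>"
  have "ZZm *\<^sub>v ?x
     = (one_mat_N N * Hm - one_bar_mat_N N * Gm) *\<^sub>v ?x
      - (0\<^sub>m (2 * N + 2) n @\<^sub>c L_mat N @\<^sub>c 0\<^sub>m (2 * N + 2) 2) *\<^sub>v ?x"
    unfolding ZZ_mat_def
    by (rule minus_mult_distrib_mat_vec[OF minus_carrier_mat[OF oG] L_part_carrier x])
  also have "(one_mat_N N * Hm - one_bar_mat_N N * Gm) *\<^sub>v ?x
     = (one_mat_N N * Hm) *\<^sub>v ?x - (one_bar_mat_N N * Gm) *\<^sub>v ?x"
    by (rule minus_mult_distrib_mat_vec[OF oH oG x])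
  also have "(one_mat_N N * Hm) *\<^sub>v ?x = one_mat_N N *\<^sub>v (Hm *\<^sub>v ?x)"
    by (rule assoc_mult_mat_vec[OF one_carrier(1) H_carrier x])
  also have "(one_bar_mat_N N * Gm) *\<^sub>v ?x = one_bar_mat_N N *\<^sub>v (Gm *\<^sub>v ?x)"
    by (rule assoc_mult_mat_vec[OF one_carrier(2) G_carrier x])
  finally show ?thesis
    unfolding H_xi[OF X] G_xi[OF X] L_part_xi[OF X] one_blocks one_bar_blocks
    by (auto simp: blocks_def)
qed

lemma Z_xi:
  assumes X: "X \<in> carrier_vec n"
  shows "Zm *\<^sub>v xi X Y \<zeta> = drift X (Y 0) @\<^sub>v blocks (N + 1)
    (\<lambda>k r. c * (right_trace (Kdrift X (Y 0)) \<zeta> r - (- 1) ^ k * left_trace (Kdrift X (Y 0)) \<zeta> r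
        - (\<Sum>l\<le>N. ell k l * Y l r)))"
proof -
  note x = xi_carrier[OF X, of Y \<zeta>]
  have "Zm *\<^sub>v xi X Y \<zeta> = NNm *\<^sub>v xi X Y \<zeta>
      @\<^sub>v (c \<cdot>\<^sub>m ZZm) *\<^sub>v xi X Y \<zeta>"
    unfolding Z_mat_def by (rule mat_mult_append[OF NN_carrier smult_carrier_mat[OF ZZ_carrier] x])
  also have "(c \<cdot>\<^sub>m ZZm) *\<^sub>v xi X Y \<zeta> = c \<cdot>\<^sub>v (ZZm *\<^sub>v xi X Y \<zeta>)"
    using x ZZ_carrier by (intro eq_vecI) auto
  finally show ?thesis
    unfolding NN_xi[OF X] ZZ_xi[OF X]
    by (auto simp: blocks_def intro!: arg_cong[where f="\<lambda>v. drift X (Y 0) @\<^sub>v v"] eq_vecI)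
qed

lemma Z_carrier: "Zm \<in> carrier_mat dz (dz + 2)"
  using carrier_append_rows[OF NN_carrier smult_carrier_mat[OF ZZ_carrier]]
  unfolding Z_mat_def by simp

lemma F_carrier: "Fm \<in> carrier_mat dz (dz + 2)"
  unfolding F_mat_def by (intro append_cols_carrier one_carrier_mat zero_carrier_mat)

lemma F_xi:
  assumes X: "X \<in> carrier_vec n"
  shows "Fm *\<^sub>v xi X Y \<zeta> = X @\<^sub>v blocks (N + 1) Y"
proof -
  have z: "X @\<^sub>v blocks (N + 1) Y \<in> carrier_vec dz"
    by (intro append_carrier_vec X blocks_carrier)
  show ?thesis
    unfolding F_mat_def xi_def append_vec_assoc[symmetric]
      append_zero_cols_mult_vec[OF one_carrier_mat z vec_carrier]
    by (rule one_mult_mat_vec[OF z])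
qed

lemma R_tilde_carrier: "R_tilde n N R \<in> carrier_mat (dz + 2) (dz + 2)"
proof -
  have "dim_row R = 2" "dim_col R = 2" using R_carrier by auto
  then show ?thesis unfolding R_tilde_def
    by (intro carrier_matI) (simp_all add: dim_diag_block_mat comp_def sum_list_triv del: upt_Suc)
qed

text \<open>Differentiating the functional and integrating by parts produce the right-hand side, except that
  the integral of \<open>\<chi>\<^sup>T R \<chi>\<close> takes the place of the sum over the moments in the middle. \<open>Gm\<close> and \<open>Hm\<close> supply the traces \<open>\<alpha>\<close> and \<open>\<beta>\<close>, and \<open>Zm\<close> the velocity of the pair of \<open>X\<close> and the moments.\<close>

lemma Psi_xi:
  fixes Y :: "nat \<Rightarrow> nat \<Rightarrow> real" and \<zeta> :: "nat \<Rightarrow> real"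
  assumes X: "X \<in> carrier_vec n"
  defines "\<alpha> \<equiv> left_trace (Kdrift X (Y 0)) \<zeta>" and "\<beta> \<equiv> right_trace (Kdrift X (Y 0)) \<zeta>"
  shows "quad_form Psim (xi X Y \<zeta>) =
     2 * ((drift X (Y 0) @\<^sub>v blocks (N + 1)
        (\<lambda>k r. c * (\<beta> r - (- 1) ^ k * \<alpha> r - (\<Sum>l\<le>N. ell k l * Y l r)))) \<bullet> (P *\<^sub>v (X @\<^sub>v blocks (N + 1) Y)))
     - c * (\<Sum>k\<le>N. (2 * real k + 1) * form2 R (\<lambda>i j. Y k i * Y k j))
     + c * (form2 (S + R) (\<lambda>i j. \<beta> i * \<beta> j)
          - form2 S (\<lambda>i j. \<alpha> i * \<alpha> j))"
proof -
  let ?D = "dz + 2"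
  let ?x = "xi X Y \<zeta>"
  note x = xi_carrier[OF X, of Y \<zeta>]
  let ?Z = "Zm" and ?F = "Fm" and ?H = "Hm" and ?G = "Gm"
  let ?M1 = "transpose_mat ?Z * P * ?F"
  let ?M2 = "transpose_mat ?H * (S + R) * ?H" and ?M3 = "transpose_mat ?G * S * ?G"
  note SR = add_carrier_mat[OF R_carrier, of S]
  have tZ: "transpose_mat ?Z \<in> carrier_mat ?D dz"
   and tH: "transpose_mat ?H \<in> carrier_mat ?D 2" and tG: "transpose_mat ?G \<in> carrier_mat ?D 2"
    using Z_carrier H_carrier G_carrier by (simp_all only: transpose_carrier_mat)
  have M1: "?M1 \<in> carrier_mat ?D ?D" by (rule mult_carrier_mat[OF mult_carrier_mat[OF tZ P_carrier] F_carrier])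
  have M2: "?M2 \<in> carrier_mat ?D ?D" by (rule mult_carrier_mat[OF mult_carrier_mat[OF tH SR] H_carrier])
  have M3: "?M3 \<in> carrier_mat ?D ?D" by (rule mult_carrier_mat[OF mult_carrier_mat[OF tG S_carrier] G_carrier])
  have He: "He ?M1 \<in> carrier_mat ?D ?D"
    unfolding He_def by (rule add_carrier_mat) (simp only: transpose_carrier_mat M1)
  have cR: "c \<cdot>\<^sub>m R_tilde n N R \<in> carrier_mat ?D ?D" by (rule smult_carrier_mat[OF R_tilde_carrier])
  have M23: "?M2 - ?M3 \<in> carrier_mat ?D ?D" by (rule minus_carrier_mat[OF M3])
  have cM: "c \<cdot>\<^sub>m (?M2 - ?M3) \<in> carrier_mat ?D ?D" by (rule smult_carrier_mat[OF M23])
  have "quad_form Psim ?x = quad_form (He ?M1) ?x - c * quad_form (R_tilde n N R) ?x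
      + c * (quad_form ?M2 ?x - quad_form ?M3 ?x)"
    unfolding Psi_mat_def
    by (simp only: quad_form_add[OF minus_carrier_mat[OF cR] cM x] quad_form_diff[OF He cR x] quad_form_diff[OF M2 M3 x]
        quad_form_smult[OF R_tilde_carrier x] quad_form_smult[OF M23 x])
  also have "quad_form (He ?M1) ?x = 2 * ((?Z *\<^sub>v ?x) \<bullet> (P *\<^sub>v (?F *\<^sub>v ?x)))"
    unfolding quad_form_def quadratic_form_He[OF M1 x]
    by (subst quadratic_form_product[OF Z_carrier P_carrier F_carrier x]) (rule refl)
  also have "quad_form (R_tilde n N R) ?x = (\<Sum>k\<le>N. (2 * real k + 1) * form2 R (\<lambda>i j. Y k i * Y k j))"
    unfolding quad_form_def xi_def by (rule quadratic_form_R_tilde[OF R_carrier vec_carrier X])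
  also have "quad_form ?M2 ?x = quad_form (S + R) (vec 2 \<beta>)"
    unfolding quad_form_def \<beta>_def H_xi[OF X, symmetric] by (rule quadratic_form_product[OF H_carrier SR H_carrier x])
  also have "\<dots> = form2 (S + R) (\<lambda>i j. \<beta> i * \<beta> j)"
    unfolding quad_form_sum[OF SR vec_carrier] form2_def by (intro sum.cong) auto
  also have "quad_form ?M3 ?x = quad_form S (vec 2 \<alpha>)"
    unfolding quad_form_def \<alpha>_def G_xi[OF X, symmetric] by (rule quadratic_form_product[OF G_carrier S_carrier G_carrier x])
  also have "\<dots> = form2 S (\<lambda>i j. \<alpha> i * \<alpha> j)"
    unfolding quad_form_sum[OF S_carrier vec_carrier] form2_def by (intro sum.cong) auto
  finally show ?thesis
    unfolding Z_xi[OF X] F_xi[OF X] \<alpha>_def \<beta>_def .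
qed

end

section \<open>The Lyapunov functional and its dissipation\<close>

text \<open>The equation of motion of the moments, before multiplication by \<open>c\<close>: since the Riemann coordinates are
  transported, the velocity of a moment is the moment of a derivative.\<close>

lemma ip_deriv_legendre:
  assumes "primitive f f'"
  shows "ip f' (legendre k) = f 1 - (- 1) ^ k * f 0 - ip f (dlegendre k)"
  using ip_by_parts[OF assms legendre_primitive[of k]] by (simp add: legendre_at_0 legendre_at_1 mult.commute)

lemma ell_zero: "k \<le> l \<Longrightarrow> ell k l = 0"
  by (auto simp: ell_def mult_2[symmetric])

lemma ip_dlegendre_atMost:
  assumes "f \<in> L2" "k \<le> N" shows "ip f (dlegendre k) = (\<Sum>l\<le>N. ell k l * ip f (legendre l))"
  unfolding ip_dlegendre[OF assms(1)]
  by (rule sum.mono_neutral_left) (use assms ell_zero in auto)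

context lyapunov_data begin

text \<open>The weight grows with \<open>x\<close> in the sense of \<open>R\<close>, and the transport runs towards \<open>x = 0\<close>; this is the source
  of dissipation in the interior.\<close>

definition weight :: "nat \<Rightarrow> nat \<Rightarrow> real \<Rightarrow> real" where
  "weight i j x = S $$ (i, j) + x * R $$ (i, j)"

definition moments :: "(nat \<Rightarrow> real \<Rightarrow> real) \<Rightarrow> nat \<Rightarrow> nat \<Rightarrow> real" where
  "moments \<chi> k i = ip (\<chi> i) (legendre k)"

definition zvec :: "real vec \<Rightarrow> (nat \<Rightarrow> real \<Rightarrow> real) \<Rightarrow> real vec" where
  "zvec X \<chi> = X @\<^sub>v blocks (N + 1) (moments \<chi>)"

definition lyap :: "real vec \<Rightarrow> (nat \<Rightarrow> real \<Rightarrow> real) \<Rightarrow> real" where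
  "lyap X \<chi> = zvec X \<chi> \<bullet> (P *\<^sub>v zvec X \<chi>)
     + (\<Sum>i<2. \<Sum>j<2. ip (\<chi> i) (\<lambda>x. weight i j x * \<chi> j x))"

text \<open>The derivative of \<open>lyap\<close> in the direction \<open>(Xd, \<chi>d)\<close>; symmetry of \<open>P\<close> accounts for the factor \<open>2\<close>.\<close>

definition lyap_deriv :: "real vec \<Rightarrow> (nat \<Rightarrow> real \<Rightarrow> real) \<Rightarrow> real vec \<Rightarrow> (nat \<Rightarrow> real \<Rightarrow> real) \<Rightarrow> real" where
  "lyap_deriv X \<chi> Xd \<chi>d = 2 * (zvec Xd \<chi>d \<bullet> (P *\<^sub>v zvec X \<chi>))
     + (\<Sum>i<2. \<Sum>j<2. ip (\<chi>d i) (\<lambda>x. weight i j x * \<chi> j x) + ip (\<chi> i) (\<lambda>x. weight i j x * \<chi>d j x))"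

definition energy :: "real vec \<Rightarrow> (nat \<Rightarrow> real \<Rightarrow> real) \<Rightarrow> real" where
  "energy X \<chi> = X \<bullet> X + (\<Sum>i<2. ip (\<chi> i) (\<chi> i))"

lemma zvec_carrier: "X \<in> carrier_vec n \<Longrightarrow> zvec X \<chi> \<in> carrier_vec dz"
  unfolding zvec_def by (intro append_carrier_vec blocks_carrier)

lemma weight_continuous: "continuous_on T (weight i j)"
  unfolding weight_def by (intro continuous_intros)

lemma weighted_L2: "f \<in> L2 \<Longrightarrow> (\<lambda>x. weight i j x * f x) \<in> L2"
  by (rule L2_mult_continuous[OF _ weight_continuous])

lemma form2_vec: "M \<in> carrier_mat 2 2 \<Longrightarrow> vec 2 a \<bullet> (M *\<^sub>v vec 2 a) = form2 M (\<lambda>i j. a i * a j)"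
  by (subst scalar_prod_mult_mat_vec[of _ 2 2]) (auto simp: form2_def intro!: sum.cong)

lemma vec_2_scalar_prod: "vec 2 a \<bullet> vec 2 a = (\<Sum>i<2. (a i)\<^sup>2)" for a :: "nat \<Rightarrow> real"
  unfolding scalar_prod_self[OF vec_carrier] by (intro sum.cong) auto

lemma form2_coercive:
  assumes "sym_pos_def 2 M"
  obtains r where "r > 0" "\<And>a. r * (\<Sum>i<2. (a i)\<^sup>2) \<le> form2 M (\<lambda>i j. a i * a j)"
proof -
  have M: "M \<in> carrier_mat 2 2" using assms by (simp add: sym_pos_def_def)
  obtain r where r: "r > 0" "\<And>x. x \<in> carrier_vec 2 \<Longrightarrow> r * (x \<bullet> x) \<le> x \<bullet> (M *\<^sub>v x)"
    using positive_form_coercive[OF M] assms unfolding sym_pos_def_def by blast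
  have "r * (\<Sum>i<2. (a i)\<^sup>2) \<le> form2 M (\<lambda>i j. a i * a j)" for a
    using r(2)[OF vec_carrier[of 2 a]] unfolding form2_vec[OF M] vec_2_scalar_prod .
  then show ?thesis using r(1) that by blast
qed

lemma weighted_form_by_parts:
  assumes \<chi>: "\<And>i. primitive (\<chi> i) (\<chi>' i)"
  shows "ip (\<chi>' i) (\<lambda>x. weight i j x * \<chi> j x) + ip (\<chi> i) (\<lambda>x. weight i j x * \<chi>' j x)
    = (S $$ (i, j) + R $$ (i, j)) * (\<chi> i 1 * \<chi> j 1) - S $$ (i, j) * (\<chi> i 0 * \<chi> j 0) - R $$ (i, j) * ip (\<chi> i) (\<chi> j)"
proof -
  have w: "primitive (weight i j) (\<lambda>x. R $$ (i, j))"
    by (rule primitive_C1) (auto simp: weight_def[abs_def] intro!: derivative_eq_intros)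
  have L: "\<chi> i \<in> L2" "\<chi>' i \<in> L2" for i by (rule primitive_in_L2[OF \<chi>], rule primitive_L2[OF \<chi>])
  have "ip (\<chi> i) (\<lambda>x. R $$ (i, j) * \<chi> j x + weight i j x * \<chi>' j x)
     = R $$ (i, j) * ip (\<chi> i) (\<chi> j) + ip (\<chi> i) (\<lambda>x. weight i j x * \<chi>' j x)"
    by (subst ip_add_right[OF L2_cmult[OF L(1)] weighted_L2[OF L(2)] L(1)]) (simp only: ip_cmult_right)
  with ip_by_parts[OF \<chi>[of i] primitive_mult[OF w \<chi>[of j]]]
  show ?thesis by (simp add: weight_def algebra_simps)
qed

text \<open>The traces are those of a state satisfying the boundary conditions, with \<open>\<zeta>\<close> as free parameters.\<close>

definition boundary_coupling :: "real vec \<Rightarrow> (nat \<Rightarrow> real \<Rightarrow> real) \<Rightarrow> (nat \<Rightarrow> real) \<Rightarrow> bool" where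
  "boundary_coupling X \<chi> \<zeta> \<longleftrightarrow> (\<forall>i<2. \<chi> i 0 = left_trace (Kdrift X (moments \<chi> 0)) \<zeta> i \<and>
     \<chi> i 1 = right_trace (Kdrift X (moments \<chi> 0)) \<zeta> i)"

text \<open>A purely spatial estimate: the velocity is inserted from the equations, and time does not occur.
  By \<open>Psi_xi\<close> the derivative is the form \<open>Psim\<close> at \<open>\<xi>\<close> minus \<open>c\<close> times the defect in Bessel's inequality for
  \<open>R\<close>. Negative definiteness alone would control only \<open>X\<close> and finitely many moments. The defect for
  \<open>\<theta> I\<close>, which is at most that for \<open>R\<close>, contributes the full norm of \<open>\<chi>\<close>, at the price of a multiple of the
  squared moments that \<open>\<epsilon>\<close> absorbs.\<close>

lemma dissipation:
  obtains \<eta> where "\<eta> > 0"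
    "\<And>X \<chi> \<chi>' \<zeta>. X \<in> carrier_vec n \<Longrightarrow> (\<And>i. primitive (\<chi> i) (\<chi>' i)) \<Longrightarrow> boundary_coupling X \<chi> \<zeta> \<Longrightarrow>
       lyap_deriv X \<chi> (drift X (moments \<chi> 0)) (\<lambda>i x. c * \<chi>' i x) \<le> - \<eta> * energy X \<chi>"
proof -
  let ?D = "dz + 2"
  have Psi_carrier: "Psim \<in> carrier_mat ?D ?D" using Psi by (simp add: sym_neg_def_def)
  have uPsi: "- Psim \<in> carrier_mat ?D ?D" using Psi_carrier by simp
  have um: "x \<bullet> (- Psim *\<^sub>v x) = - quad_form Psim x" if "x \<in> carrier_vec ?D" for x
    unfolding quad_form_sum[OF Psi_carrier that] scalar_prod_mult_mat_vec[OF uPsi that that] sum_negf[symmetric]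
    using Psi_carrier by (intro sum.cong) auto
  have "0 < x \<bullet> (- Psim *\<^sub>v x)" if "x \<in> carrier_vec ?D" "x \<noteq> 0\<^sub>v ?D" for x
    unfolding um[OF that(1)] using Psi that unfolding sym_neg_def_def quad_form_def by auto
  then obtain \<epsilon> where e: "\<epsilon> > 0" "\<And>x. x \<in> carrier_vec ?D \<Longrightarrow> \<epsilon> * (x \<bullet> x) \<le> - quad_form Psim x"
    using positive_form_coercive[OF uPsi] um by metis
  obtain r where r: "r > 0" "\<And>a. r * (\<Sum>i<2. (a i)\<^sup>2) \<le> form2 R (\<lambda>i j. a i * a j)"
    using form2_coercive[OF R] by blast
  \<comment> \<open>\<open>\<theta>\<close> must stay below \<open>R\<close>, and the price \<open>c \<theta> (2 k + 1)\<close> of the moments of order \<open>k \<le> N\<close> below \<open>\<epsilon>\<close>.\<close>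
  define \<theta> where "\<theta> = min r (\<epsilon> / (c * (2 * real N + 1)))"
  have th: "0 < \<theta>" "\<theta> \<le> r" "c * \<theta> * (2 * real N + 1) \<le> \<epsilon>"
  proof -
    have d: "0 < c * (2 * real N + 1)" using c_pos by simp
    show "0 < \<theta>" "\<theta> \<le> r" using r(1) e(1) d by (simp_all add: \<theta>_def)
    have "\<theta> * (c * (2 * real N + 1)) \<le> \<epsilon>"
      unfolding pos_le_divide_eq[OF d, symmetric] \<theta>_def by simp
    then show "c * \<theta> * (2 * real N + 1) \<le> \<epsilon>" by (simp add: mult.commute mult.left_commute)
  qed
  show ?thesis
  proof (rule that)
    show "0 < min \<epsilon> (c * \<theta>)" using e th c_pos by simp
    fix X :: "real vec" and \<chi> \<chi>' :: "nat \<Rightarrow> real \<Rightarrow> real" and \<zeta> :: "nat \<Rightarrow> real"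
    assume X: "X \<in> carrier_vec n" and \<chi>: "\<And>i. primitive (\<chi> i) (\<chi>' i)"
      and bc: "boundary_coupling X \<chi> \<zeta>"
    let ?Y = "moments \<chi>"
    let ?\<alpha> = "left_trace (Kdrift X (?Y 0)) \<zeta>" and ?\<beta> = "right_trace (Kdrift X (?Y 0)) \<zeta>"
    let ?RY = "\<Sum>k\<le>N. (2 * real k + 1) * form2 R (\<lambda>i j. ?Y k i * ?Y k j)"
    let ?YY = "\<Sum>k\<le>N. (2 * real k + 1) * (\<Sum>i<2. (?Y k i)\<^sup>2)"
    let ?RX = "form2 R (\<lambda>i j. ip (\<chi> i) (\<chi> j))"
    let ?E = "\<Sum>i<2. ip (\<chi> i) (\<chi> i)"
    have b0: "\<chi> i 0 = ?\<alpha> i" and b1: "\<chi> i 1 = ?\<beta> i" if "i < 2" for i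
      using bc that unfolding boundary_coupling_def by blast+
    have L: "\<chi> i \<in> L2" for i by (rule primitive_in_L2[OF \<chi>])
    have zd: "zvec (drift X (?Y 0)) (\<lambda>i x. c * \<chi>' i x) = drift X (?Y 0) @\<^sub>v blocks (N + 1)
        (\<lambda>k r. c * (?\<beta> r - (- 1) ^ k * ?\<alpha> r - (\<Sum>l\<le>N. ell k l * ?Y l r)))"
    proof -
      have "blocks (N + 1) (moments (\<lambda>i x. c * \<chi>' i x))
        = blocks (N + 1) (\<lambda>k r. c * (?\<beta> r - (- 1) ^ k * ?\<alpha> r - (\<Sum>l\<le>N. ell k l * ?Y l r)))"
        unfolding blocks_def
      proof (intro eq_vecI)
        fix i
        assume "i < dim_vec (vec (2 * (N + 1)) (\<lambda>j. c * (?\<beta> (j mod 2) - (- 1) ^ (j div 2) * ?\<alpha> (j mod 2)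
            - (\<Sum>l\<le>N. ell (j div 2) l * ?Y l (j mod 2)))))"
        then have i: "i < 2 * (N + 1)" by simp
        then have k: "i div 2 \<le> N" and m: "i mod 2 < 2" by auto
        have "ip (\<lambda>x. c * \<chi>' (i mod 2) x) (legendre (i div 2)) = c * (?\<beta> (i mod 2) - (- 1) ^ (i div 2) * ?\<alpha> (i mod 2)
            - (\<Sum>l\<le>N. ell (i div 2) l * ip (\<chi> (i mod 2)) (legendre l)))"
          unfolding ip_cmult_left ip_deriv_legendre[OF \<chi>] ip_dlegendre_atMost[OF L k] b0[OF m] b1[OF m] ..
        then show "vec (2 * (N + 1)) (\<lambda>j. moments (\<lambda>i x. c * \<chi>' i x) (j div 2) (j mod 2)) $ i
          = vec (2 * (N + 1)) (\<lambda>j. c * (?\<beta> (j mod 2) - (- 1) ^ (j div 2) * ?\<alpha> (j mod 2)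
            - (\<Sum>l\<le>N. ell (j div 2) l * ?Y l (j mod 2)))) $ i"
          using i by (simp add: moments_def)
      qed simp
      then show ?thesis unfolding zvec_def by simp
    qed
    have "(\<Sum>i<2. \<Sum>j<2. ip (\<lambda>x. c * \<chi>' i x) (\<lambda>x. weight i j x * \<chi> j x)
          + ip (\<chi> i) (\<lambda>x. weight i j x * (c * \<chi>' j x)))
       = (\<Sum>i<2. \<Sum>j<2. c * ((S $$ (i, j) + R $$ (i, j)) * (?\<beta> i * ?\<beta> j) - S $$ (i, j) * (?\<alpha> i * ?\<alpha> j)
           - R $$ (i, j) * ip (\<chi> i) (\<chi> j)))"
    proof (intro sum.cong refl)
      fix i j :: nat assume ij: "i \<in> {..<2}" "j \<in> {..<2}"
      have "ip (\<chi> i) (\<lambda>x. weight i j x * (c * \<chi>' j x)) = c * ip (\<chi> i) (\<lambda>x. weight i j x * \<chi>' j x)"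
        unfolding ip_cmult_right[symmetric] by (rule ip_cong) (simp add: mult.left_commute)
      then have "ip (\<lambda>x. c * \<chi>' i x) (\<lambda>x. weight i j x * \<chi> j x) + ip (\<chi> i) (\<lambda>x. weight i j x * (c * \<chi>' j x))
        = c * (ip (\<chi>' i) (\<lambda>x. weight i j x * \<chi> j x) + ip (\<chi> i) (\<lambda>x. weight i j x * \<chi>' j x))"
        by (simp add: ip_cmult_left distrib_left)
      then show "ip (\<lambda>x. c * \<chi>' i x) (\<lambda>x. weight i j x * \<chi> j x) + ip (\<chi> i) (\<lambda>x. weight i j x * (c * \<chi>' j x))
        = c * ((S $$ (i, j) + R $$ (i, j)) * (?\<beta> i * ?\<beta> j) - S $$ (i, j) * (?\<alpha> i * ?\<alpha> j)
           - R $$ (i, j) * ip (\<chi> i) (\<chi> j))"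
        unfolding weighted_form_by_parts[of \<chi> \<chi>', OF \<chi>] using b0 b1 ij by simp
    qed
    also have "\<dots> = c * (form2 (S + R) (\<lambda>i j. ?\<beta> i * ?\<beta> j)
          - form2 S (\<lambda>i j. ?\<alpha> i * ?\<alpha> j)) - c * ?RX"
      using R_carrier S_carrier by (simp add: form2_def sum_distrib_left sum_subtractf right_diff_distrib)
    finally have "lyap_deriv X \<chi> (drift X (?Y 0)) (\<lambda>i x. c * \<chi>' i x)
       = quad_form Psim (xi X ?Y \<zeta>) + c * ?RY - c * ?RX"
      unfolding lyap_deriv_def zd Psi_xi[OF X] zvec_def[of X] by simp
    moreover have "quad_form Psim (xi X ?Y \<zeta>) \<le> - \<epsilon> * (X \<bullet> X + (\<Sum>k\<le>N. \<Sum>i<2. (?Y k i)\<^sup>2))"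
    proof -
      have "xi X ?Y \<zeta> \<bullet> xi X ?Y \<zeta> = X \<bullet> X + (blocks (N + 1) ?Y \<bullet> blocks (N + 1) ?Y + vec 2 \<zeta> \<bullet> vec 2 \<zeta>)"
        unfolding xi_def
        using scalar_prod_append[OF X append_carrier_vec[OF blocks_carrier[of "N+1" ?Y] vec_carrier[of 2 \<zeta>]]
            X append_carrier_vec[OF blocks_carrier[of "N+1" ?Y] vec_carrier[of 2 \<zeta>]]]
          scalar_prod_append[OF blocks_carrier[of "N+1" ?Y] vec_carrier[of 2 \<zeta>] blocks_carrier[of "N+1" ?Y] vec_carrier[of 2 \<zeta>]]
        by simp
      moreover have "0 \<le> vec 2 \<zeta> \<bullet> vec 2 \<zeta>"
        unfolding scalar_prod_self[OF vec_carrier] by (intro sum_nonneg) auto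
      moreover have "blocks (N + 1) ?Y \<bullet> blocks (N + 1) ?Y = (\<Sum>k\<le>N. \<Sum>i<2. (?Y k i)\<^sup>2)"
        unfolding blocks_scalar_prod by (simp add: lessThan_Suc_atMost)
      ultimately have "X \<bullet> X + (\<Sum>k\<le>N. \<Sum>i<2. (?Y k i)\<^sup>2) \<le> xi X ?Y \<zeta> \<bullet> xi X ?Y \<zeta>" by linarith
      then have "\<epsilon> * (X \<bullet> X + (\<Sum>k\<le>N. \<Sum>i<2. (?Y k i)\<^sup>2)) \<le> \<epsilon> * (xi X ?Y \<zeta> \<bullet> xi X ?Y \<zeta>)"
        using e(1) by simp
      also have "\<dots> \<le> - quad_form Psim (xi X ?Y \<zeta>)" by (rule e(2)[OF xi_carrier[OF X]])
      finally show ?thesis by simp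
    qed
    moreover have "c * ?RY - c * ?RX \<le> c * \<theta> * ?YY - c * \<theta> * ?E"
    proof -
      define M where "M = mat 2 2 (\<lambda>(i, j). R $$ (i, j) - (if i = j then \<theta> else 0))"
      have diag: "form2 M f = form2 R f - \<theta> * (\<Sum>i<2. f i i)" for f
        by (simp add: form2_def M_def sum_lessThan_2 algebra_simps)
      have psd: "0 \<le> form2 M (\<lambda>i j. a i * a j)" for a :: "nat \<Rightarrow> real"
      proof -
        have "\<theta> * (\<Sum>i<2. (a i)\<^sup>2) \<le> r * (\<Sum>i<2. (a i)\<^sup>2)"
          using th(2) by (intro mult_right_mono sum_nonneg) auto
        also have "\<dots> \<le> form2 R (\<lambda>i j. a i * a j)" by (rule r(2))
        finally show ?thesis unfolding diag by (simp add: power2_eq_square)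
      qed
      have "(\<Sum>k\<le>N. (2 * real k + 1) * form2 M (\<lambda>i j. ip (\<chi> i) (legendre k) * ip (\<chi> j) (legendre k)))
         \<le> form2 M (\<lambda>i j. ip (\<chi> i) (\<chi> j))"
        by (rule bessel_quadratic[OF L psd])
      also have "(\<Sum>k\<le>N. (2 * real k + 1) * form2 M (\<lambda>i j. ip (\<chi> i) (legendre k) * ip (\<chi> j) (legendre k)))
         = ?RY - \<theta> * ?YY"
        unfolding diag moments_def
        by (simp add: right_diff_distrib sum_subtractf sum_distrib_left power2_eq_square mult.left_commute)
      also have "form2 M (\<lambda>i j. ip (\<chi> i) (\<chi> j)) = ?RX - \<theta> * ?E"
        by (rule diag)
      finally have "c * (?RY - \<theta> * ?YY) \<le> c * (?RX - \<theta> * ?E)" using c_pos by (intro mult_left_mono) auto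
      then show ?thesis by (simp add: algebra_simps)
    qed
    moreover have "c * \<theta> * ?YY \<le> \<epsilon> * (\<Sum>k\<le>N. \<Sum>i<2. (?Y k i)\<^sup>2)"
    proof -
      have "c * \<theta> * ?YY = (\<Sum>k\<le>N. (c * \<theta> * (2 * real k + 1)) * (\<Sum>i<2. (?Y k i)\<^sup>2))"
        unfolding sum_distrib_left[of _ _ "{..N}"] by (simp add: mult.assoc)
      also have "\<dots> \<le> (\<Sum>k\<le>N. \<epsilon> * (\<Sum>i<2. (?Y k i)\<^sup>2))"
      proof (intro sum_mono mult_right_mono)
        fix k assume "k \<in> {..N}"
        then have "c * \<theta> * (2 * real k + 1) \<le> c * \<theta> * (2 * real N + 1)"
          using c_pos th(1) by (intro mult_left_mono) auto
        then show "c * \<theta> * (2 * real k + 1) \<le> \<epsilon>" using th(3) by linarith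
      qed (auto intro: sum_nonneg)
      finally show ?thesis by (simp add: sum_distrib_left)
    qed
    ultimately have "lyap_deriv X \<chi> (drift X (?Y 0)) (\<lambda>i x. c * \<chi>' i x) \<le> - \<epsilon> * (X \<bullet> X) - c * \<theta> * ?E"
      by (simp add: algebra_simps)
    also have "\<dots> \<le> - min \<epsilon> (c * \<theta>) * energy X \<chi>"
    proof -
      have "0 \<le> X \<bullet> X" unfolding scalar_prod_self[OF X] by (intro sum_nonneg) auto
      then have "min \<epsilon> (c * \<theta>) * (X \<bullet> X) \<le> \<epsilon> * (X \<bullet> X)" by (intro mult_right_mono) auto
      moreover have "0 \<le> ?E" by (intro sum_nonneg ip_self_nonneg)
      then have "min \<epsilon> (c * \<theta>) * ?E \<le> c * \<theta> * ?E" by (intro mult_right_mono) auto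
      ultimately show ?thesis unfolding energy_def by (simp add: distrib_left)
    qed
    finally show "lyap_deriv X \<chi> (drift X (?Y 0)) (\<lambda>i x. c * \<chi>' i x) \<le> - min \<epsilon> (c * \<theta>) * energy X \<chi>" .
  qed
qed

lemma weighted_form_integral:
  assumes L: "\<And>i. \<chi> i \<in> L2"
  shows "(\<Sum>i<2. \<Sum>j<2. ip (\<chi> i) (\<lambda>x. weight i j x * \<chi> j x))
     = (LINT x|leb01. form2 S (\<lambda>i j. \<chi> i x * \<chi> j x) + x * form2 R (\<lambda>i j. \<chi> i x * \<chi> j x))"
    and "integrable leb01 (\<lambda>x. form2 S (\<lambda>i j. \<chi> i x * \<chi> j x) + x * form2 R (\<lambda>i j. \<chi> i x * \<chi> j x))"
proof -
  have int: "integrable leb01 (\<lambda>x. \<chi> i x * (weight i j x * \<chi> j x))" for i j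
    by (rule L2_mult_integrable[OF L weighted_L2[OF L]])
  have "(\<lambda>x. form2 S (\<lambda>i j. \<chi> i x * \<chi> j x) + x * form2 R (\<lambda>i j. \<chi> i x * \<chi> j x))
     = (\<lambda>x. \<Sum>i<2. \<Sum>j<2. \<chi> i x * (weight i j x * \<chi> j x))"
    by (rule ext) (simp add: form2_def sum_lessThan_2 weight_def algebra_simps)
  then show "(\<Sum>i<2. \<Sum>j<2. ip (\<chi> i) (\<lambda>x. weight i j x * \<chi> j x))
     = (LINT x|leb01. form2 S (\<lambda>i j. \<chi> i x * \<chi> j x) + x * form2 R (\<lambda>i j. \<chi> i x * \<chi> j x))"
    "integrable leb01 (\<lambda>x. form2 S (\<lambda>i j. \<chi> i x * \<chi> j x) + x * form2 R (\<lambda>i j. \<chi> i x * \<chi> j x))"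
    using int by (simp_all add: ip_def Bochner_Integration.integral_sum)
qed

lemma energy_integral:
  assumes L: "\<And>i. \<chi> i \<in> L2"
  shows "a * (\<Sum>i<2. ip (\<chi> i) (\<chi> i)) = (LINT x|leb01. a * (\<Sum>i<2. (\<chi> i x)\<^sup>2))"
    and "integrable leb01 (\<lambda>x. a * (\<Sum>i<2. (\<chi> i x)\<^sup>2))"
  using L2_mult_integrable[OF L L]
  by (simp_all add: ip_def Bochner_Integration.integral_sum power2_eq_square)

lemma lyap_lower:
  obtains \<kappa> where "\<kappa> > 0"
    "\<And>X \<chi>. X \<in> carrier_vec n \<Longrightarrow> (\<And>i. \<chi> i \<in> L2) \<Longrightarrow> \<kappa> * energy X \<chi> \<le> lyap X \<chi>"
proof -
  obtain p where p: "p > 0" "\<And>x. x \<in> carrier_vec dz \<Longrightarrow> p * (x \<bullet> x) \<le> x \<bullet> (P *\<^sub>v x)"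
    using positive_form_coercive[OF P_carrier] P unfolding sym_pos_def_def by blast
  obtain s where s: "s > 0" "\<And>a. s * (\<Sum>i<2. (a i)\<^sup>2) \<le> form2 S (\<lambda>i j. a i * a j)"
    using form2_coercive[OF S] by blast
  obtain r where r: "r > 0" "\<And>a. r * (\<Sum>i<2. (a i)\<^sup>2) \<le> form2 R (\<lambda>i j. a i * a j)"
    using form2_coercive[OF R] by blast
  show ?thesis
  proof (rule that)
    show "0 < min p s" using p s by simp
    fix X :: "real vec" and \<chi> :: "nat \<Rightarrow> real \<Rightarrow> real"
    assume X: "X \<in> carrier_vec n" and L: "\<And>i. \<chi> i \<in> L2"
    have X0: "0 \<le> X \<bullet> X" unfolding scalar_prod_self[OF X] by (intro sum_nonneg) auto
    have E0: "0 \<le> (\<Sum>i<2. ip (\<chi> i) (\<chi> i))" by (intro sum_nonneg ip_self_nonneg)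
    have "X \<bullet> X \<le> zvec X \<chi> \<bullet> zvec X \<chi>"
    proof -
      have "0 \<le> blocks (N + 1) (moments \<chi>) \<bullet> blocks (N + 1) (moments \<chi>)"
        unfolding blocks_scalar_prod by (intro sum_nonneg) auto
      then show ?thesis unfolding zvec_def scalar_prod_append[OF X blocks_carrier X blocks_carrier] by simp
    qed
    then have "p * (X \<bullet> X) \<le> p * (zvec X \<chi> \<bullet> zvec X \<chi>)" using p by simp
    also have "\<dots> \<le> zvec X \<chi> \<bullet> (P *\<^sub>v zvec X \<chi>)" by (rule p(2)[OF zvec_carrier[OF X]])
    finally have 1: "min p s * (X \<bullet> X) \<le> zvec X \<chi> \<bullet> (P *\<^sub>v zvec X \<chi>)"
      using mult_right_mono[OF min.cobounded1[of p s] X0] by linarith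
    have "s * (\<Sum>i<2. ip (\<chi> i) (\<chi> i)) \<le> (\<Sum>i<2. \<Sum>j<2. ip (\<chi> i) (\<lambda>x. weight i j x * \<chi> j x))"
      unfolding energy_integral(1)[of \<chi>, OF L] weighted_form_integral(1)[of \<chi>, OF L]
    proof (rule integral_mono[OF energy_integral(2)[of \<chi>, OF L] weighted_form_integral(2)[of \<chi>, OF L]])
      fix x assume "x \<in> space leb01"
      then have x: "0 \<le> x" by simp
      have "0 \<le> r * (\<Sum>i<2. (\<chi> i x)\<^sup>2)" using r(1) by (intro mult_nonneg_nonneg sum_nonneg) auto
      then have "0 \<le> x * form2 R (\<lambda>i j. \<chi> i x * \<chi> j x)"
        using r(2)[of "\<lambda>i. \<chi> i x"] x by (intro mult_nonneg_nonneg) auto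
      then show "s * (\<Sum>i<2. (\<chi> i x)\<^sup>2)
         \<le> form2 S (\<lambda>i j. \<chi> i x * \<chi> j x) + x * form2 R (\<lambda>i j. \<chi> i x * \<chi> j x)"
        using s(2)[of "\<lambda>i. \<chi> i x"] by linarith
    qed
    then have 2: "min p s * (\<Sum>i<2. ip (\<chi> i) (\<chi> i)) \<le> (\<Sum>i<2. \<Sum>j<2. ip (\<chi> i) (\<lambda>x. weight i j x * \<chi> j x))"
      using mult_right_mono[OF min.cobounded2[of p s] E0] by linarith
    show "min p s * energy X \<chi> \<le> lyap X \<chi>"
      unfolding energy_def lyap_def distrib_left using 1 2 by linarith
  qed
qed

lemma lyap_upper:
  obtains C where "C > 0"
    "\<And>X \<chi>. X \<in> carrier_vec n \<Longrightarrow> (\<And>i. \<chi> i \<in> L2) \<Longrightarrow> lyap X \<chi> \<le> C * energy X \<chi>"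
proof -
  obtain p where p: "p \<ge> 0" "\<And>x. x \<in> carrier_vec dz \<Longrightarrow> x \<bullet> (P *\<^sub>v x) \<le> p * (x \<bullet> x)"
    using quadratic_form_bounded[OF P_carrier] by blast
  obtain s where s: "s \<ge> 0" "\<And>x. x \<in> carrier_vec 2 \<Longrightarrow> x \<bullet> (S *\<^sub>v x) \<le> s * (x \<bullet> x)"
    using quadratic_form_bounded[OF S_carrier] by blast
  obtain r where r: "r \<ge> 0" "\<And>x. x \<in> carrier_vec 2 \<Longrightarrow> x \<bullet> (R *\<^sub>v x) \<le> r * (x \<bullet> x)"
    using quadratic_form_bounded[OF R_carrier] by blast
  have s2: "form2 S (\<lambda>i j. a i * a j) \<le> s * (\<Sum>i<2. (a i)\<^sup>2)"
    and r2: "form2 R (\<lambda>i j. a i * a j) \<le> r * (\<Sum>i<2. (a i)\<^sup>2)" for a :: "nat \<Rightarrow> real"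
    using s(2)[OF vec_carrier[of 2 a]] r(2)[OF vec_carrier[of 2 a]]
    unfolding form2_vec[OF S_carrier] form2_vec[OF R_carrier] vec_2_scalar_prod by simp_all
  let ?C = "p * (real N + 2) + s + r + 1"
  show ?thesis
  proof (rule that)
    show "0 < ?C" using p s r by (simp add: add_nonneg_pos)
    fix X :: "real vec" and \<chi> :: "nat \<Rightarrow> real \<Rightarrow> real"
    assume X: "X \<in> carrier_vec n" and L: "\<And>i. \<chi> i \<in> L2"
    let ?E = "\<Sum>i<2. ip (\<chi> i) (\<chi> i)"
    have X0: "0 \<le> X \<bullet> X" unfolding scalar_prod_self[OF X] by (intro sum_nonneg) auto
    have E0: "0 \<le> ?E" by (intro sum_nonneg ip_self_nonneg)
    have "zvec X \<chi> \<bullet> zvec X \<chi> \<le> X \<bullet> X + (real N + 1) * ?E"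
    proof -
      have m: "(moments \<chi> k i)\<^sup>2 \<le> ip (\<chi> i) (\<chi> i)" for k i
      proof -
        have "\<bar>ip (\<chi> i) (legendre k)\<bar>\<^sup>2 \<le> (L2_nrm (\<chi> i) * L2_nrm (legendre k))\<^sup>2"
          by (intro power_mono cauchy_schwarz L legendre_L2) simp
        also have "\<dots> = ip (\<chi> i) (\<chi> i) * (1 / (2 * real k + 1))"
          by (simp add: power_mult_distrib L2_nrm_sq legendre_orthogonal)
        also have "\<dots> \<le> ip (\<chi> i) (\<chi> i) * 1"
          using ip_self_nonneg by (intro mult_left_mono) auto
        finally show ?thesis by (simp add: moments_def)
      qed
      have "(\<Sum>k<N + 1. \<Sum>i<2. (moments \<chi> k i)\<^sup>2) \<le> (\<Sum>k<N + 1. ?E)"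
        by (intro sum_mono m)
      then show ?thesis
        unfolding zvec_def scalar_prod_append[OF X blocks_carrier X blocks_carrier] blocks_scalar_prod
        by (simp add: add.commute)
    qed
    then have "zvec X \<chi> \<bullet> (P *\<^sub>v zvec X \<chi>) \<le> p * (X \<bullet> X + (real N + 1) * ?E)"
      using p(2)[OF zvec_carrier[OF X, of \<chi>]] p(1) by (meson mult_left_mono order_trans)
    moreover have "(\<Sum>i<2. \<Sum>j<2. ip (\<chi> i) (\<lambda>x. weight i j x * \<chi> j x)) \<le> (s + r) * ?E"
      unfolding energy_integral(1)[of \<chi>, OF L] weighted_form_integral(1)[of \<chi>, OF L]
    proof (rule integral_mono[OF weighted_form_integral(2)[of \<chi>, OF L] energy_integral(2)[of \<chi>, OF L]])
      fix x assume "x \<in> space leb01"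
      then have x: "0 \<le> x" "x \<le> 1" by simp_all
      have "x * form2 R (\<lambda>i j. \<chi> i x * \<chi> j x) \<le> x * (r * (\<Sum>i<2. (\<chi> i x)\<^sup>2))"
        using r2[of "\<lambda>i. \<chi> i x"] x by (intro mult_left_mono) auto
      also have "\<dots> \<le> 1 * (r * (\<Sum>i<2. (\<chi> i x)\<^sup>2))"
        using x r(1) by (intro mult_right_mono mult_nonneg_nonneg sum_nonneg) auto
      finally show "form2 S (\<lambda>i j. \<chi> i x * \<chi> j x) + x * form2 R (\<lambda>i j. \<chi> i x * \<chi> j x)
         \<le> (s + r) * (\<Sum>i<2. (\<chi> i x)\<^sup>2)"
        using s2[of "\<lambda>i. \<chi> i x"] by (simp add: distrib_right)
    qed
    moreover have "p * (X \<bullet> X + (real N + 1) * ?E) = p * (X \<bullet> X) + p * (real N + 1) * ?E"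
      by (simp add: algebra_simps)
    ultimately have "lyap X \<chi> \<le> p * (X \<bullet> X) + p * (real N + 1) * ?E + (s + r) * ?E"
      unfolding lyap_def by linarith
    also have "\<dots> \<le> ?C * (X \<bullet> X) + ?C * ?E"
    proof -
      have c1: "p \<le> ?C" "p * (real N + 1) + (s + r) \<le> ?C"
        using p s r mult_nonneg_nonneg[OF p(1) of_nat_0_le_iff[of N]] by (simp_all add: distrib_left)
      have "p * (X \<bullet> X) \<le> ?C * (X \<bullet> X)" by (rule mult_right_mono[OF c1(1) X0])
      moreover have "p * (real N + 1) * ?E + (s + r) * ?E \<le> ?C * ?E"
        using mult_right_mono[OF c1(2) E0] by (simp add: distrib_right)
      ultimately show ?thesis by linarith
    qed
    finally show "lyap X \<chi> \<le> ?C * energy X \<chi>" unfolding energy_def by (simp add: distrib_left)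
  qed
qed

end

section \<open>Decay along regular solutions\<close>

lemma exponential_decay:
  fixes f f' :: "real \<Rightarrow> real"
  assumes d: "\<And>s. 0 \<le> s \<Longrightarrow> (f has_real_derivative f' s) (at s within {0..})"
    and le: "\<And>s. 0 \<le> s \<Longrightarrow> f' s \<le> - \<delta> * f s" and t: "0 \<le> t"
  shows "f t \<le> exp (- \<delta> * t) * f 0"
proof -
  let ?g = "\<lambda>s. exp (\<delta> * s) * f s"
  have dg: "(?g has_real_derivative exp (\<delta> * s) * (\<delta> * f s + f' s)) (at s within {0..})" if "0 \<le> s" for s
    using d[OF that] by (auto intro!: derivative_eq_intros simp: algebra_simps)
  have "?g t \<le> ?g 0"
  proof (rule DERIV_nonpos_imp_decreasing_open[OF t])
    fix s assume s: "0 < s" "s < t"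
    have "at s within {0..} = at s" using s by (intro at_within_interior) simp
    then have "DERIV ?g s :> exp (\<delta> * s) * (\<delta> * f s + f' s)" using dg[of s] s by simp
    moreover have "exp (\<delta> * s) * (\<delta> * f s + f' s) \<le> 0"
      using le[of s] s by (intro mult_nonneg_nonpos) auto
    ultimately show "\<exists>y. DERIV ?g s :> y \<and> y \<le> 0" by blast
  next
    have "continuous_on {0..} ?g"
      unfolding continuous_on_eq_continuous_within using dg by (auto intro: DERIV_continuous)
    then show "continuous_on {0..t} ?g" by (rule continuous_on_subset) auto
  qed
  then have "exp (- \<delta> * t) * ?g t \<le> exp (- \<delta> * t) * ?g 0" by (intro mult_left_mono) auto
  then show ?thesis by (simp add: mult.assoc[symmetric] exp_add[symmetric])
qed

lemma deriv_cong_nonneg: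
  assumes "(f has_real_derivative D) (at t within {0..})" "0 \<le> t" "\<And>s. 0 \<le> s \<Longrightarrow> f s = g s"
  shows "(g has_real_derivative D) (at t within {0..})"
  by (rule has_field_derivative_transform_within[OF assms(1), of 1]) (use assms in auto)

lemma L2_deriv_const: "g \<in> L2 \<Longrightarrow> L2_deriv (\<lambda>s. g) (\<lambda>x. 0) t"
  unfolding L2_deriv_def by (simp add: L2_tendsto_const L2_const)

lemma L2_deriv_ip_const:
  assumes f: "L2_deriv f f' t" and g: "g \<in> L2" and t: "0 \<le> t"
  shows "((\<lambda>s. ip (f s) g) has_real_derivative ip f' g) (at t within {0..})"
  using L2_deriv_ip[OF f L2_deriv_const[OF g] t] by (simp add: ip_def)

text \<open>The error of the difference quotient, tested against \<open>\<psi>\<close>, is estimated by the mean value theorem for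
  the real function \<open>\<tau> \<mapsto> ip (f \<tau>) \<psi> - \<tau> * ip (g t) \<psi>\<close>. The bound depends on \<open>\<psi>\<close> only through its norm,
  so \<open>\<psi>\<close> may be the error itself.\<close>

lemma L2_deriv_weak_to_strong:
  assumes f: "\<And>s. 0 \<le> s \<Longrightarrow> f s \<in> L2" and g: "\<And>s. 0 \<le> s \<Longrightarrow> g s \<in> L2"
    and d: "\<And>s \<psi>. 0 \<le> s \<Longrightarrow> \<psi> \<in> L2 \<Longrightarrow> ((\<lambda>s. ip (f s) \<psi>) has_real_derivative ip (g s) \<psi>) (at s within {0..})"
    and cont: "L2_tendsto g (g t) (at t within {0..})" and t: "0 \<le> t"
  shows "L2_deriv f (g t) t"
proof -
  let ?D = "\<lambda>s x. (f s x - f t x) / (s - t) - g t x"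
  have DL: "?D s \<in> L2" if "0 \<le> s" for s
    using f[OF that] f[OF t] g[OF t] by (intro L2_diff L2_divide)
  have "((\<lambda>s. L2_nrm (?D s)) \<longlongrightarrow> 0) (at t within {0..})"
    unfolding tendsto_iff
  proof (intro allI impI)
    fix e :: real assume e: "0 < e"
    obtain d where dd: "d > 0"
      and near: "\<And>s. 0 \<le> s \<Longrightarrow> \<bar>s - t\<bar> < d \<Longrightarrow> L2_nrm (\<lambda>x. g s x - g t x) \<le> e / 2"
      using L2_tendsto_neighbourhood[of g t "e / 2"] cont e by auto
    have "L2_nrm (?D s) < e" if s: "0 \<le> s" "s \<noteq> t" "\<bar>s - t\<bar> < d" for s
    proof -
      \<comment> \<open>the error of the difference quotient as its own test function\<close>
      let ?\<psi> = "?D s"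
      note psi = DL[OF s(1)]
      let ?G = "\<lambda>\<tau>. ip (f \<tau>) ?\<psi> - \<tau> * ip (g t) ?\<psi>"
      let ?I = "{min s t..max s t}"
      have "norm (?G s - ?G t) \<le> (e / 2 * L2_nrm ?\<psi>) * norm (s - t)"
      proof (rule field_differentiable_bound[of ?I ?G "\<lambda>\<tau>. ip (g \<tau>) ?\<psi> - ip (g t) ?\<psi>"])
        fix \<tau> assume tau: "\<tau> \<in> ?I"
        then have t0: "0 \<le> \<tau>" "\<bar>\<tau> - t\<bar> < d" using s t by (auto simp: min_def max_def split: if_splits)
        show "(?G has_field_derivative ip (g \<tau>) ?\<psi> - ip (g t) ?\<psi>) (at \<tau> within ?I)"
        proof (rule DERIV_subset)
          show "(?G has_field_derivative ip (g \<tau>) ?\<psi> - ip (g t) ?\<psi>) (at \<tau> within {0..})"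
            using d[OF t0(1) psi] by (auto intro!: derivative_eq_intros)
          show "?I \<subseteq> {0..}" using s t by auto
        qed
        have "\<bar>ip (g \<tau>) ?\<psi> - ip (g t) ?\<psi>\<bar> \<le> L2_nrm (\<lambda>x. g \<tau> x - g t x) * L2_nrm ?\<psi>"
          by (rule ip_diff_bound[OF g[OF t0(1)] g[OF t] psi])
        also have "\<dots> \<le> e / 2 * L2_nrm ?\<psi>"
          by (rule mult_right_mono[OF near[OF t0]]) simp
        finally show "norm (ip (g \<tau>) ?\<psi> - ip (g t) ?\<psi>) \<le> e / 2 * L2_nrm ?\<psi>" by simp
      qed auto
      moreover have "?G s - ?G t = (s - t) * (L2_nrm ?\<psi>)\<^sup>2"
      proof -
        have "(L2_nrm ?\<psi>)\<^sup>2 = ip (\<lambda>x. (f s x - f t x) / (s - t)) ?\<psi> - ip (g t) ?\<psi>"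
          unfolding L2_nrm_sq
          by (rule ip_diff_left[OF L2_divide[OF L2_diff[OF f[OF s(1)] f[OF t]]] g[OF t] psi])
        also have "ip (\<lambda>x. (f s x - f t x) / (s - t)) ?\<psi> = (ip (f s) ?\<psi> - ip (f t) ?\<psi>) / (s - t)"
          unfolding ip_divide_left ip_diff_left[OF f[OF s(1)] f[OF t] psi] ..
        finally have "(s - t) * (L2_nrm ?\<psi>)\<^sup>2 = (s - t) * ((ip (f s) ?\<psi> - ip (f t) ?\<psi>) / (s - t)) - (s - t) * ip (g t) ?\<psi>"
          by (simp only: right_diff_distrib)
        also have "(s - t) * ((ip (f s) ?\<psi> - ip (f t) ?\<psi>) / (s - t)) = ip (f s) ?\<psi> - ip (f t) ?\<psi>"
          using s(2) by simp
        also have "ip (f s) ?\<psi> - ip (f t) ?\<psi> - (s - t) * ip (g t) ?\<psi> = ?G s - ?G t"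
          by (simp only: left_diff_distrib)
        finally show ?thesis by simp
      qed
      ultimately have "\<bar>s - t\<bar> * (L2_nrm ?\<psi>)\<^sup>2 \<le> \<bar>s - t\<bar> * (e / 2 * L2_nrm ?\<psi>)"
        by (simp only: real_norm_def abs_mult abs_power2 power2_abs mult.commute)
      then have "(L2_nrm ?\<psi>)\<^sup>2 \<le> e / 2 * L2_nrm ?\<psi>" using s(2) by simp
      then have "L2_nrm ?\<psi> \<le> e / 2" by (rule L2_nrm_le_if_dual) (use e in simp)
      then show ?thesis using e by simp
    qed
    then show "\<forall>\<^sub>F s in at t within {0..}. dist (L2_nrm (?D s)) 0 < e"
      unfolding eventually_at dist_real_def using dd by auto
  qed
  moreover have "\<forall>\<^sub>F s in at t within {0..}. (\<lambda>x. (f s x - f t x) / (s - t)) \<in> L2"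
    unfolding eventually_at_filter
    using f f[OF t] by (auto intro!: always_eventually L2_divide L2_diff)
  ultimately show ?thesis
    using f g[OF t] unfolding L2_deriv_def L2_tendsto_def by blast
qed

context lyapunov_data begin

lemma zvec_index:
  assumes "X \<in> carrier_vec n" "j < dz"
  shows "zvec X \<chi> $ j = (if j < n then X $ j else ip (\<chi> ((j - n) mod 2)) (legendre ((j - n) div 2)))"
proof -
  have "dim_vec X = n" using assms(1) by (rule carrier_vecD)
  then show ?thesis using assms(2) by (simp add: zvec_def blocks_def moments_def)
qed

lemma P_symmetric: "i < dz \<Longrightarrow> j < dz \<Longrightarrow> P $$ (i, j) = P $$ (j, i)"
  using P P_carrier unfolding sym_pos_def_def by (metis carrier_matD index_transpose_mat(1))

lemma lyap_has_derivative:
  assumes X: "\<And>s. 0 \<le> s \<Longrightarrow> X s \<in> carrier_vec n" and Xd: "Xd \<in> carrier_vec n"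
    and dX: "\<And>i. i < n \<Longrightarrow> ((\<lambda>s. X s $ i) has_real_derivative Xd $ i) (at t within {0..})"
    and d\<chi>: "\<And>i. L2_deriv (\<lambda>s. \<chi> s i) (\<chi>d i) t" and t: "0 \<le> t"
  shows "((\<lambda>s. lyap (X s) (\<chi> s)) has_real_derivative lyap_deriv (X t) (\<chi> t) Xd \<chi>d) (at t within {0..})"
proof -
  let ?d = "dz" and ?F = "at t within {0..}"
  let ?z = "\<lambda>s. zvec (X s) (\<chi> s)" and ?zd = "zvec Xd \<chi>d"
  have dz: "((\<lambda>s. ?z s $ j) has_real_derivative ?zd $ j) ?F" if j: "j < ?d" for j
  proof (cases "j < n")
    case True
    have "((\<lambda>s. X s $ j) has_real_derivative ?zd $ j) ?F"
      using dX[OF True] zvec_index[OF Xd j] True by simp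
    then show ?thesis
      by (rule deriv_cong_nonneg[OF _ t]) (use zvec_index[OF X j] True in simp)
  next
    case False
    have "((\<lambda>s. ip (\<chi> s ((j - n) mod 2)) (legendre ((j - n) div 2))) has_real_derivative ?zd $ j) ?F"
      using L2_deriv_ip_const[OF d\<chi> legendre_L2 t] zvec_index[OF Xd j] False by simp
    then show ?thesis
      by (rule deriv_cong_nonneg[OF _ t]) (use zvec_index[OF X j] False in simp)
  qed
  have q: "((\<lambda>s. \<Sum>i<?d. \<Sum>j<?d. P $$ (i, j) * (?z s $ i * ?z s $ j)) has_real_derivative
      (\<Sum>i<?d. \<Sum>j<?d. P $$ (i, j) * (?zd $ i * ?z t $ j + ?z t $ i * ?zd $ j))) ?F"
    by (intro DERIV_sum) (auto intro!: derivative_eq_intros dz simp: algebra_simps)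
  have "(\<Sum>i<?d. \<Sum>j<?d. P $$ (i, j) * (?zd $ i * ?z t $ j + ?z t $ i * ?zd $ j))
      = (\<Sum>i<?d. \<Sum>j<?d. P $$ (i, j) * (?zd $ i * ?z t $ j)) + (\<Sum>i<?d. \<Sum>j<?d. P $$ (i, j) * (?z t $ i * ?zd $ j))"
    by (simp add: distrib_left sum.distrib)
  also have "(\<Sum>i<?d. \<Sum>j<?d. P $$ (i, j) * (?z t $ i * ?zd $ j)) = (\<Sum>i<?d. \<Sum>j<?d. P $$ (i, j) * (?zd $ i * ?z t $ j))"
    by (subst sum.swap) (intro sum.cong refl, simp add: P_symmetric mult.commute)
  also have "(\<Sum>i<?d. \<Sum>j<?d. P $$ (i, j) * (?zd $ i * ?z t $ j)) = ?zd \<bullet> (P *\<^sub>v ?z t)"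
    by (rule scalar_prod_mult_mat_vec[OF P_carrier zvec_carrier[OF Xd] zvec_carrier[OF X[OF t]], symmetric])
  finally have "((\<lambda>s. \<Sum>i<?d. \<Sum>j<?d. P $$ (i, j) * (?z s $ i * ?z s $ j)) has_real_derivative
      2 * (?zd \<bullet> (P *\<^sub>v ?z t))) ?F"
    using q by simp
  then have 1: "((\<lambda>s. ?z s \<bullet> (P *\<^sub>v ?z s)) has_real_derivative 2 * (?zd \<bullet> (P *\<^sub>v ?z t))) ?F"
  proof (rule deriv_cong_nonneg[OF _ t])
    fix s :: real assume s: "0 \<le> s"
    show "(\<Sum>i<?d. \<Sum>j<?d. P $$ (i, j) * (?z s $ i * ?z s $ j)) = ?z s \<bullet> (P *\<^sub>v ?z s)"
      by (rule scalar_prod_mult_mat_vec[OF P_carrier zvec_carrier[OF X[OF s]] zvec_carrier[OF X[OF s]], symmetric])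
  qed
  have 2: "((\<lambda>s. \<Sum>i<2. \<Sum>j<2. ip (\<chi> s i) (\<lambda>x. weight i j x * \<chi> s j x)) has_real_derivative
     (\<Sum>i<2. \<Sum>j<2. ip (\<chi>d i) (\<lambda>x. weight i j x * \<chi> t j x) + ip (\<chi> t i) (\<lambda>x. weight i j x * \<chi>d j x))) ?F"
    by (intro DERIV_sum L2_deriv_ip[OF d\<chi> L2_deriv_weight[OF d\<chi> weight_continuous] t])
  show ?thesis unfolding lyap_def lyap_deriv_def by (rule DERIV_add[OF 1 2])
qed

lemma lyap_tendsto:
  assumes X: "\<forall>\<^sub>F h in F. X h \<in> carrier_vec n" and X0: "X0 \<in> carrier_vec n"
    and tX: "\<And>i. i < n \<Longrightarrow> ((\<lambda>h. X h $ i) \<longlongrightarrow> X0 $ i) F"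
    and t\<chi>: "\<And>i. L2_tendsto (\<lambda>h. \<chi> h i) (\<chi>0 i) F"
  shows "((\<lambda>h. lyap (X h) (\<chi> h)) \<longlongrightarrow> lyap X0 \<chi>0) F"
proof -
  let ?d = "dz"
  have tz: "((\<lambda>h. zvec (X h) (\<chi> h) $ j) \<longlongrightarrow> zvec X0 \<chi>0 $ j) F" if j: "j < ?d" for j
  proof -
    have "((\<lambda>h. if j < n then X h $ j else ip (\<chi> h ((j - n) mod 2)) (legendre ((j - n) div 2)))
        \<longlongrightarrow> zvec X0 \<chi>0 $ j) F"
      unfolding zvec_index[OF X0 j] using tX L2_tendsto_ip[OF t\<chi> L2_tendsto_const[OF legendre_L2]] by auto
    moreover have "\<forall>\<^sub>F h in F. (if j < n then X h $ j else ip (\<chi> h ((j - n) mod 2)) (legendre ((j - n) div 2)))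
        = zvec (X h) (\<chi> h) $ j"
      using X by eventually_elim (simp only: zvec_index[OF _ j])
    ultimately show ?thesis by (rule Lim_transform_eventually)
  qed
  have "((\<lambda>h. \<Sum>i<?d. \<Sum>j<?d. P $$ (i, j) * (zvec (X h) (\<chi> h) $ i * zvec (X h) (\<chi> h) $ j))
     \<longlongrightarrow> (\<Sum>i<?d. \<Sum>j<?d. P $$ (i, j) * (zvec X0 \<chi>0 $ i * zvec X0 \<chi>0 $ j))) F"
    by (intro tendsto_sum tendsto_mult tendsto_const tz) auto
  moreover have "\<forall>\<^sub>F h in F. (\<Sum>i<?d. \<Sum>j<?d. P $$ (i, j) * (zvec (X h) (\<chi> h) $ i * zvec (X h) (\<chi> h) $ j))
      = zvec (X h) (\<chi> h) \<bullet> (P *\<^sub>v zvec (X h) (\<chi> h))"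
    using X
  proof eventually_elim
    case (elim h)
    show ?case by (rule scalar_prod_mult_mat_vec[OF P_carrier zvec_carrier[OF elim] zvec_carrier[OF elim], symmetric])
  qed
  ultimately have 1: "((\<lambda>h. zvec (X h) (\<chi> h) \<bullet> (P *\<^sub>v zvec (X h) (\<chi> h))) \<longlongrightarrow> zvec X0 \<chi>0 \<bullet> (P *\<^sub>v zvec X0 \<chi>0)) F"
    unfolding scalar_prod_mult_mat_vec[OF P_carrier zvec_carrier[OF X0] zvec_carrier[OF X0]]
    by (rule Lim_transform_eventually)
  show ?thesis unfolding lyap_def
    by (intro tendsto_add 1 tendsto_sum L2_tendsto_ip t\<chi> L2_tendsto_weight weight_continuous)
qed

text \<open>A solution in Riemann coordinates that is smooth enough to have traces and a velocity in \<open>L2\<close>.\<close>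

definition regular_solution ::
  "(real \<Rightarrow> real vec) \<Rightarrow> (real \<Rightarrow> nat \<Rightarrow> real \<Rightarrow> real) \<Rightarrow> (real \<Rightarrow> nat \<Rightarrow> real \<Rightarrow> real) \<Rightarrow> bool" where
  "regular_solution X \<chi> \<chi>' \<longleftrightarrow> (\<forall>s\<ge>0. X s \<in> carrier_vec n \<and>
     (\<forall>i<n. ((\<lambda>s. X s $ i) has_real_derivative drift (X s) (moments (\<chi> s) 0) $ i) (at s within {0..})) \<and>
     (\<forall>i. primitive (\<chi> s i) (\<chi>' s i)) \<and> (\<forall>i. L2_deriv (\<lambda>s. \<chi> s i) (\<lambda>x. c * \<chi>' s i x) s) \<and>
     (\<exists>\<zeta>. boundary_coupling (X s) (\<chi> s) \<zeta>))"

lemma regular_decay: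
  obtains \<delta> where "\<delta> > 0"
   "\<And>X \<chi> \<chi>' t. regular_solution X \<chi> \<chi>' \<Longrightarrow> 0 \<le> t \<Longrightarrow>
      lyap (X t) (\<chi> t) \<le> exp (- \<delta> * t) * lyap (X 0) (\<chi> 0)"
proof -
  obtain \<eta> where eta: "\<eta> > 0"
    "\<And>X \<chi> \<chi>' \<zeta>. X \<in> carrier_vec n \<Longrightarrow> (\<And>i. primitive (\<chi> i) (\<chi>' i)) \<Longrightarrow> boundary_coupling X \<chi> \<zeta> \<Longrightarrow>
       lyap_deriv X \<chi> (drift X (moments \<chi> 0)) (\<lambda>i x. c * \<chi>' i x) \<le> - \<eta> * energy X \<chi>"
    using dissipation by blast
  obtain C where C: "C > 0"
    "\<And>X \<chi>. X \<in> carrier_vec n \<Longrightarrow> (\<And>i. \<chi> i \<in> L2) \<Longrightarrow> lyap X \<chi> \<le> C * energy X \<chi>"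
    using lyap_upper by blast
  show ?thesis
  proof (rule that)
    show "0 < \<eta> / C" using eta C by simp
    fix X \<chi> \<chi>' and t :: real
    assume reg: "regular_solution X \<chi> \<chi>'" and t: "0 \<le> t"
    have X: "X s \<in> carrier_vec n"
      and dX: "\<And>i. i < n \<Longrightarrow>
        ((\<lambda>s. X s $ i) has_real_derivative drift (X s) (moments (\<chi> s) 0) $ i) (at s within {0..})"
      and pr: "\<And>i. primitive (\<chi> s i) (\<chi>' s i)"
      and d\<chi>: "\<And>i. L2_deriv (\<lambda>s. \<chi> s i) (\<lambda>x. c * \<chi>' s i x) s"
      and bc: "\<exists>\<zeta>. boundary_coupling (X s) (\<chi> s) \<zeta>" if "0 \<le> s" for s
      using reg that unfolding regular_solution_def by blast+
    show "lyap (X t) (\<chi> t) \<le> exp (- (\<eta> / C) * t) * lyap (X 0) (\<chi> 0)"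
    proof (rule exponential_decay[OF _ _ t])
      fix s :: real assume s: "0 \<le> s"
      show "((\<lambda>s. lyap (X s) (\<chi> s)) has_real_derivative
         lyap_deriv (X s) (\<chi> s) (drift (X s) (moments (\<chi> s) 0)) (\<lambda>i x. c * \<chi>' s i x)) (at s within {0..})"
        by (rule lyap_has_derivative[OF X drift_carrier dX[OF s] d\<chi>[OF s] s])
      obtain \<zeta> where z: "boundary_coupling (X s) (\<chi> s) \<zeta>" using bc[OF s] by blast
      have "lyap_deriv (X s) (\<chi> s) (drift (X s) (moments (\<chi> s) 0)) (\<lambda>i x. c * \<chi>' s i x) \<le> - \<eta> * energy (X s) (\<chi> s)"
        by (rule eta(2)[OF X[OF s] pr[OF s] z])
      also have "\<dots> \<le> - (\<eta> / C) * lyap (X s) (\<chi> s)"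
        using C(2)[OF X[OF s], of "\<chi> s"] primitive_in_L2[OF pr[OF s]] C(1) eta(1)
        by (simp add: field_simps)
      finally show "lyap_deriv (X s) (\<chi> s) (drift (X s) (moments (\<chi> s) 0)) (\<lambda>i x. c * \<chi>' s i x)
         \<le> - (\<eta> / C) * lyap (X s) (\<chi> s)" .
    qed
  qed
qed

end

section \<open>Riemann coordinates\<close>

lemma ip_reflect: "ip (\<lambda>x. f (1 - x)) (\<lambda>x. g (1 - x)) = ip f g"
  unfolding ip_def by (rule integral_leb01_reflect[of "\<lambda>x. f x * g x"])

text \<open>The second coordinate is reflected, so that both are transported in the same direction. The minus sign
  is kept on the coefficient to treat both cases as \<open>v + a w\<close>.\<close>

definition riemann :: "real \<Rightarrow> (real \<Rightarrow> real) \<Rightarrow> (real \<Rightarrow> real) \<Rightarrow> nat \<Rightarrow> real \<Rightarrow> real" where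
  "riemann c v w i = (if i = 0 then (\<lambda>x. v x + c * w x) else (\<lambda>x. v (1 - x) + (- c) * w (1 - x)))"

definition riemann_dx :: "real \<Rightarrow> (real \<Rightarrow> real) \<Rightarrow> (real \<Rightarrow> real) \<Rightarrow> nat \<Rightarrow> real \<Rightarrow> real" where
  "riemann_dx c v' w' i = (if i = 0 then (\<lambda>x. v' x + c * w' x) else (\<lambda>x. - (v' (1 - x) + (- c) * w' (1 - x))))"

lemma riemann_L2: "v \<in> L2 \<Longrightarrow> w \<in> L2 \<Longrightarrow> riemann c v w i \<in> L2"
  unfolding riemann_def by (auto intro!: L2_add L2_cmult L2_reflect L2_uminus simp del: mult_minus_left)

lemma riemann_primitive:
  assumes "primitive v v'" "primitive w w'"
  shows "primitive (riemann c v w i) (riemann_dx c v' w' i)"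
proof (cases "i = 0")
  case True
  then show ?thesis unfolding riemann_def riemann_dx_def
    using primitive_add[OF assms(1) primitive_cmult[OF assms(2), of c]] by simp
next
  case False
  then show ?thesis unfolding riemann_def riemann_dx_def
    using primitive_reflect[OF primitive_add[OF assms(1) primitive_cmult[OF assms(2), of "- c"]]] by simp
qed

text \<open>The wave equation as a first order system, \<open>v\<^sub>t = c\<^sup>2 w\<^sub>x\<close> and \<open>w\<^sub>t = v\<^sub>x\<close>, becomes a transport equation.\<close>

lemma riemann_deriv:
  assumes "L2_deriv v (\<lambda>x. c\<^sup>2 * w' x) t" "L2_deriv w v' t"
  shows "L2_deriv (\<lambda>s. riemann c (v s) (w s) i) (\<lambda>x. c * riemann_dx c v' w' i x) t"
proof (cases "i = 0")
  case True
  have "L2_deriv (\<lambda>s x. v s x + c * w s x) (\<lambda>x. c\<^sup>2 * w' x + c * v' x) t"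
    by (rule L2_deriv_add[OF assms(1) L2_deriv_cmult[OF assms(2)]])
  moreover have "(\<lambda>x. c\<^sup>2 * w' x + c * v' x) = (\<lambda>x. c * riemann_dx c v' w' i x)"
    using True by (auto simp: riemann_dx_def power2_eq_square algebra_simps)
  ultimately show ?thesis using True by (simp add: riemann_def)
next
  case False
  have "L2_deriv (\<lambda>s x. v s (1 - x) + (- c) * w s (1 - x)) (\<lambda>x. c\<^sup>2 * w' (1 - x) + (- c) * v' (1 - x)) t"
    by (rule L2_deriv_reflect[OF L2_deriv_add[OF assms(1) L2_deriv_cmult[OF assms(2)]]])
  moreover have "(\<lambda>x. c\<^sup>2 * w' (1 - x) + (- c) * v' (1 - x)) = (\<lambda>x. c * riemann_dx c v' w' i x)"
    using False by (auto simp: riemann_dx_def power2_eq_square algebra_simps)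
  ultimately show ?thesis using False by (simp add: riemann_def)
qed

lemma riemann_tendsto:
  assumes "L2_tendsto v v0 F" "L2_tendsto w w0 F"
  shows "L2_tendsto (\<lambda>s. riemann c (v s) (w s) i) (riemann c v0 w0 i) F"
proof (cases "i = 0")
  case True
  then show ?thesis unfolding riemann_def
    using L2_tendsto_add[OF assms(1) L2_tendsto_cmult[OF assms(2), of c]] by simp
next
  case False
  then show ?thesis unfolding riemann_def
    using L2_tendsto_reflect[OF L2_tendsto_add[OF assms(1) L2_tendsto_cmult[OF assms(2), of "- c"]]] by simp
qed

lemma ip_linear_comb_self:
  assumes "v \<in> L2" "w \<in> L2"
  shows "ip (\<lambda>x. v x + a * w x) (\<lambda>x. v x + a * w x) = ip v v + 2 * a * ip v w + a\<^sup>2 * ip w w"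
proof -
  have aw: "(\<lambda>x. a * w x) \<in> L2" by (rule L2_cmult[OF assms(2)])
  have s: "(\<lambda>x. v x + a * w x) \<in> L2" by (rule L2_add[OF assms(1) aw])
  show ?thesis
    unfolding ip_add_left[OF assms(1) aw s] ip_add_right[OF assms(1) aw assms(1)] ip_add_right[OF assms(1) aw aw]
      ip_cmult_left ip_cmult_right ip_commute[of w v]
    by (simp add: power2_eq_square algebra_simps)
qed

lemma riemann_energy:
  assumes "v \<in> L2" "w \<in> L2"
  shows "(\<Sum>i<2. ip (riemann c v w i) (riemann c v w i)) = 2 * ip v v + 2 * c\<^sup>2 * ip w w"
proof -
  have "ip (riemann c v w (Suc 0)) (riemann c v w (Suc 0)) = ip v v + 2 * (- c) * ip v w + (- c)\<^sup>2 * ip w w"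
    unfolding riemann_def ip_linear_comb_self[OF assms, symmetric]
    by (simp add: ip_reflect[of "\<lambda>x. v x + - (c * w x)" "\<lambda>x. v x + - (c * w x)"] ip_reflect[of "\<lambda>x. v x - c * w x" "\<lambda>x. v x - c * w x"])
  moreover have "ip (riemann c v w 0) (riemann c v w 0) = ip v v + 2 * c * ip v w + c\<^sup>2 * ip w w"
    unfolding riemann_def by (simp add: ip_linear_comb_self[OF assms])
  ultimately show ?thesis by (simp add: sum_lessThan_2)
qed

lemma legendre_0_eq: "legendre 0 = (\<lambda>x. 1)" by auto

lemma riemann_mean:
  assumes "v \<in> L2" "w \<in> L2"
  shows "ip (riemann c v w 0) (legendre 0) - ip (riemann c v w (Suc 0)) (legendre 0) = 2 * c * ip w (\<lambda>x. 1)"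
proof -
  have 1: "ip (riemann c v w 0) (\<lambda>x. 1) = ip v (\<lambda>x. 1) + c * ip w (\<lambda>x. 1)"
    unfolding riemann_def using ip_add_left[OF assms(1) L2_cmult[OF assms(2)] L2_const] by (simp add: ip_cmult_left)
  have "ip (riemann c v w (Suc 0)) (\<lambda>x. 1) = ip (\<lambda>x. v x + (- c) * w x) (\<lambda>x. 1)"
    unfolding riemann_def using ip_reflect[of "\<lambda>x. v x + (- c) * w x" "\<lambda>x. 1"] by simp
  also have "\<dots> = ip v (\<lambda>x. 1) + (- c) * ip w (\<lambda>x. 1)"
    unfolding ip_add_left[OF assms(1) L2_cmult[OF assms(2)] L2_const] ip_cmult_left ..
  finally show ?thesis unfolding legendre_0_eq 1 by simp
qed

section \<open>Averages over a time window\<close>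

definition avg :: "real \<Rightarrow> (real \<Rightarrow> real) \<Rightarrow> real \<Rightarrow> real" where
  "avg h f t = integral {t..t + h} f / h"

text \<open>Any antiderivative on the half-line may be used, in particular the one that the weak formulation
  provides.\<close>

lemma avg_antiderivative:
  assumes F: "\<And>s. 0 \<le> s \<Longrightarrow> (F has_real_derivative f s) (at s within {0..})" and "0 \<le> t" "0 < h"
  shows "avg h f t = (F (t + h) - F t) / h" and "f integrable_on {t..t + h}"
proof -
  have "(f has_integral (F (t + h) - F t)) {t..t + h}"
  proof (rule fundamental_theorem_of_calculus)
    show "t \<le> t + h" using assms by simp
    fix s assume "s \<in> {t..t + h}"
    then have "(F has_real_derivative f s) (at s within {0..})" using assms by (intro F) simp
    then have "(F has_real_derivative f s) (at s within {t..t + h})"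
      by (rule DERIV_subset) (use assms in auto)
    then show "(F has_vector_derivative f s) (at s within {t..t + h})"
      by (simp add: has_real_derivative_iff_has_vector_derivative)
  qed
  then show "avg h f t = (F (t + h) - F t) / h" "f integrable_on {t..t + h}"
    by (auto simp: avg_def integral_unique)
qed

lemma antiderivative_nonneg:
  fixes f :: "real \<Rightarrow> real"
  assumes f: "continuous_on {0..} f" and t: "0 \<le> t"
  shows "((\<lambda>s. integral {0..s} f) has_real_derivative f t) (at t within {0..})"
proof -
  have "((\<lambda>s. integral {0..s} f) has_real_derivative f t) (at t within {0..t + 1})"
    by (rule integral_has_real_derivative[OF continuous_on_subset[OF f]]) (use t in auto)
  moreover have "at t within {0..t + 1} = at t within {0..}"
    by (rule at_within_nhd[of t "{..<t + 1}"]) auto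
  ultimately show ?thesis by simp
qed

lemma filterlim_shift: "0 < h \<Longrightarrow> 0 \<le> t \<Longrightarrow> filterlim (\<lambda>s. s + h) (at (t + h) within {0..}) (at t within {0..})"
  for h t :: real
  unfolding filterlim_at
  by (auto simp: eventually_at_filter intro!: tendsto_intros always_eventually)

lemma filterlim_shift_right: "0 \<le> t \<Longrightarrow> filterlim (\<lambda>h. t + h) (at t within {0..}) (at_right 0)"
  for t :: real
proof -
  assume t: "0 \<le> t"
  have "((\<lambda>h. t + h) \<longlongrightarrow> t + 0) (at_right 0)" by (intro tendsto_intros)
  moreover have "\<forall>\<^sub>F h in at_right 0. t + h \<in> {0..} \<and> t + h \<noteq> t"
    using t by (auto simp: eventually_at_filter intro!: always_eventually)
  ultimately show ?thesis unfolding filterlim_at by simp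
qed

lemma L2_tendsto_compose:
  assumes "L2_tendsto f g F" "filterlim k F F'" shows "L2_tendsto (\<lambda>s. f (k s)) g F'"
  using assms unfolding L2_tendsto_def
  by (auto intro: eventually_compose_filterlim filterlim_compose[of "\<lambda>s. L2_nrm (\<lambda>x. f s x - g x)" "nhds 0" F k F'])

lemma avg_deriv:
  assumes f: "continuous_on {0..} f" and t: "0 \<le> t" and h: "0 < h"
  shows "(avg h f has_real_derivative (f (t + h) - f t) / h) (at t within {0..})"
proof -
  let ?F = "\<lambda>s. integral {0..s} f"
  note dF = antiderivative_nonneg[OF f]
  have "((\<lambda>y. (?F y - ?F (t + h)) / (y - (t + h))) \<longlongrightarrow> f (t + h)) (at (t + h) within {0..})"
    using dF[of "t + h"] t h by (simp add: has_field_derivative_iff)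
  from filterlim_compose[OF this filterlim_shift[OF h t]]
  have "((\<lambda>s. ?F (s + h)) has_real_derivative f (t + h)) (at t within {0..})"
    by (simp add: has_field_derivative_iff)
  from DERIV_cdivide[OF DERIV_diff[OF this dF[OF t]], of h]
  show ?thesis
    by (rule deriv_cong_nonneg[OF _ t]) (simp add: avg_antiderivative(1)[OF dF _ h])
qed

lemma avg_tendsto:
  assumes f: "continuous_on {0..} f" and t: "0 \<le> t"
  shows "((\<lambda>h. avg h f t) \<longlongrightarrow> f t) (at_right 0)"
proof -
  let ?F = "\<lambda>s. integral {0..s} f"
  note dF = antiderivative_nonneg[OF f]
  have "((\<lambda>y. (?F y - ?F t) / (y - t)) \<longlongrightarrow> f t) (at t within {0..})"
    using dF[OF t] by (simp add: has_field_derivative_iff)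
  from filterlim_compose[OF this filterlim_shift_right[OF t]]
  have "((\<lambda>h. (?F (t + h) - ?F t) / h) \<longlongrightarrow> f t) (at_right 0)" by simp
  moreover have "\<forall>\<^sub>F h in at_right 0. (?F (t + h) - ?F t) / h = avg h f t"
    using avg_antiderivative(1)[OF dF t] by (auto simp: eventually_at_filter intro!: always_eventually)
  ultimately show ?thesis by (rule Lim_transform_eventually)
qed

lemma avg_bound:
  assumes f: "continuous_on {0..} f" and t: "0 \<le> t" and h: "0 < h"
    and b: "\<And>s. t \<le> s \<Longrightarrow> s \<le> t + h \<Longrightarrow> \<bar>f s - a\<bar> \<le> e"
  shows "\<bar>avg h f t - a\<bar> \<le> e"
proof -
  have "f integrable_on {t..t + h}" by (rule avg_antiderivative(2)[OF antiderivative_nonneg[OF f] t h])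
  then have fi: "(f has_integral (h * avg h f t)) {t..t + h}"
    using h by (simp add: avg_def has_integral_integral)
  have ci: "((\<lambda>s. k) has_integral (h * k)) {t..t + h}" for k :: real
    using has_integral_const_real[of k t "t + h"] h by simp
  have "h * avg h f t \<le> h * (a + e)"
    by (rule has_integral_le[OF fi ci]) (use b in \<open>auto simp: abs_le_iff algebra_simps\<close>)
  moreover have "h * (a - e) \<le> h * avg h f t"
    by (rule has_integral_le[OF ci fi]) (use b in \<open>auto simp: abs_le_iff algebra_simps\<close>)
  ultimately have "avg h f t \<le> a + e" "a - e \<le> avg h f t" using h by simp_all
  then show ?thesis by (simp add: abs_le_iff)
qed

lemma avg_linear:
  assumes "\<And>j. j \<in> J \<Longrightarrow> continuous_on {0..} (f j)" "0 \<le> t" "0 < h" "finite J"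
  shows "avg h (\<lambda>s. \<Sum>j\<in>J. a j * f j s) t = (\<Sum>j\<in>J. a j * avg h (f j) t)"
proof -
  let ?F = "\<lambda>s. \<Sum>j\<in>J. a j * integral {0..s} (f j)"
  have "(?F has_real_derivative (\<Sum>j\<in>J. a j * f j s)) (at s within {0..})" if "0 \<le> s" for s
    using antiderivative_nonneg[OF assms(1) that]
    by (intro DERIV_sum DERIV_cmult) auto
  from avg_antiderivative(1)[OF this assms(2,3)]
  have "avg h (\<lambda>s. \<Sum>j\<in>J. a j * f j s) t = (\<Sum>j\<in>J. a j * ((integral {0..t + h} (f j) - integral {0..t} (f j)) / h))"
    by (simp add: sum_subtractf[symmetric] sum_divide_distrib right_diff_distrib[symmetric])
  also have "\<dots> = (\<Sum>j\<in>J. a j * avg h (f j) t)"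
  proof (intro sum.cong refl)
    fix j assume "j \<in> J"
    then show "a j * ((integral {0..t + h} (f j) - integral {0..t} (f j)) / h) = a j * avg h (f j) t"
      using avg_antiderivative(1)[OF antiderivative_nonneg[OF assms(1)] assms(2,3)] by simp
  qed
  finally show ?thesis .
qed

lemma avg_cong: "(\<And>s. t \<le> s \<Longrightarrow> s \<le> t + h \<Longrightarrow> f s = g s) \<Longrightarrow> avg h f t = avg h g t"
  unfolding avg_def by (intro arg_cong[where f="\<lambda>z. z / h"] Henstock_Kurzweil_Integration.integral_cong) auto

lemma avg_add:
  assumes "continuous_on {0..} f" "continuous_on {0..} g" "0 \<le> t" "0 < h"
  shows "avg h (\<lambda>s. f s + a * g s) t = avg h f t + a * avg h g t"
proof -
  let ?F = "\<lambda>s. integral {0..s} f + a * integral {0..s} g"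
  note fg = antiderivative_nonneg[OF assms(1)] antiderivative_nonneg[OF assms(2)]
  have "(?F has_real_derivative f s + a * g s) (at s within {0..})" if "0 \<le> s" for s
    by (intro DERIV_add DERIV_cmult fg that)
  then have "avg h (\<lambda>s. f s + a * g s) t = (?F (t + h) - ?F t) / h"
    by (rule avg_antiderivative(1)[OF _ assms(3,4)])
  also have "\<dots> = (integral {0..t + h} f - integral {0..t} f) / h + a * ((integral {0..t + h} g - integral {0..t} g) / h)"
    using assms(4) by (simp add: field_simps)
  also have "(integral {0..t + h} f - integral {0..t} f) / h = avg h f t"
    by (rule avg_antiderivative(1)[OF fg(1) assms(3,4), symmetric])
  also have "(integral {0..t + h} g - integral {0..t} g) / h = avg h g t"
    by (rule avg_antiderivative(1)[OF fg(2) assms(3,4), symmetric])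
  finally show ?thesis .
qed

section \<open>Time averages of a weak solution\<close>

text \<open>The properties of a solution on which its decay rests, with a representative \<open>w\<close> of \<open>u\<^sub>x\<close> fixed. A test function \<open>\<phi>\<close> in
  \<open>H\<^sup>1\<close> that vanishes at \<open>0\<close> is the primitive of its derivative \<open>\<psi>\<close>, so the weak formulation is indexed
  by \<open>\<psi>\<close>.\<close>

locale weak_solution =
  fixes n :: nat and A B K :: "real mat" and c c0 :: real
    and X :: "real \<Rightarrow> real vec" and u v w :: "real \<Rightarrow> real \<Rightarrow> real"
  assumes A': "A \<in> carrier_mat n n" and B': "B \<in> carrier_mat n 1" and K': "K \<in> carrier_mat 1 n"
    and c_pos': "c > 0"
    and X_carrier: "\<And>t. 0 \<le> t \<Longrightarrow> X t \<in> carrier_vec n"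
    and u_primitive: "\<And>t. 0 \<le> t \<Longrightarrow> primitive (u t) (w t)"
    and w_cont: "\<And>t. 0 \<le> t \<Longrightarrow> L2_tendsto w (w t) (at t within {0..})"
    and v_L2: "\<And>t. 0 \<le> t \<Longrightarrow> v t \<in> L2"
    and u_deriv: "\<And>t. 0 \<le> t \<Longrightarrow> L2_deriv u (v t) t"
    and X_deriv: "\<And>t i. 0 \<le> t \<Longrightarrow> i < n \<Longrightarrow>
        ((\<lambda>s. X s $ i) has_real_derivative ((A *\<^sub>v X t) $ i + B $$ (i, 0) * u t 1)) (at t within {0..})"
    and u_left: "\<And>t. 0 \<le> t \<Longrightarrow> u t 0 = (K *\<^sub>v X t) $ 0"
    and weak: "\<And>t \<psi>. 0 \<le> t \<Longrightarrow> \<psi> \<in> L2 \<Longrightarrow>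
        ((\<lambda>s. ip (v s) (\<lambda>x. integral {0..x} \<psi>) + c\<^sup>2 * c0 * u s 1 * integral {0..1} \<psi>)
          has_real_derivative - c\<^sup>2 * ip (w t) \<psi>) (at t within {0..})"
begin

lemma w_L2: "0 \<le> t \<Longrightarrow> w t \<in> L2"
  by (rule primitive_L2[OF u_primitive])

lemma ip_w_continuous: "\<psi> \<in> L2 \<Longrightarrow> continuous_on {0..} (\<lambda>s. ip (w s) \<psi>)"
  unfolding continuous_on_def by (auto intro!: L2_tendsto_ip w_cont L2_tendsto_const)

lemma X_continuous: "i < n \<Longrightarrow> continuous_on {0..} (\<lambda>s. X s $ i)"
  unfolding continuous_on_eq_continuous_within using X_deriv by (auto intro: DERIV_continuous)

lemma u_right: "0 \<le> t \<Longrightarrow> u t 1 = (K *\<^sub>v X t) $ 0 + ip (w t) (\<lambda>x. 1)"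
  using primitive_diff_eq[OF u_primitive, of t 0 1] u_left[of t] ip_one_eq_integral[OF w_L2, of t] by simp

lemma K_X: "Y \<in> carrier_vec n \<Longrightarrow> (K *\<^sub>v Y) $ 0 = (\<Sum>j<n. K $$ (0, j) * Y $ j)"
  using K' by (auto simp: scalar_prod_def atLeast0LessThan intro!: sum.cong)

lemma A_X: "Y \<in> carrier_vec n \<Longrightarrow> i < n \<Longrightarrow> (A *\<^sub>v Y) $ i = (\<Sum>j<n. A $$ (i, j) * Y $ j)"
  using A' by (auto simp: scalar_prod_def atLeast0LessThan intro!: sum.cong)

definition moll_X :: "real \<Rightarrow> real \<Rightarrow> real vec" where
  "moll_X h t = vec n (\<lambda>i. avg h (\<lambda>s. X s $ i) t)"

text \<open>The average of \<open>v = u\<^sub>t\<close> over the window; as a difference quotient of \<open>u\<close> it has a derivative in \<open>x\<close>.\<close>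

definition moll_v :: "real \<Rightarrow> real \<Rightarrow> real \<Rightarrow> real" where
  "moll_v h t x = (u (t + h) x - u t x) / h"

definition moll_v' :: "real \<Rightarrow> real \<Rightarrow> real \<Rightarrow> real" where
  "moll_v' h t x = (w (t + h) x - w t x) / h"

definition moll_w' :: "real \<Rightarrow> real \<Rightarrow> real \<Rightarrow> real" where
  "moll_w' h t x = (v (t + h) x - v t x) / (c\<^sup>2 * h)"

text \<open>The average of \<open>w\<close> over the window, rebuilt from its derivative in \<open>x\<close> and its value at \<open>x = 1\<close>. Both are what
  the wave equation and the boundary condition at \<open>x = 1\<close> demand; \<open>moll_w_avg\<close> below justifies the name.\<close>

definition moll_w :: "real \<Rightarrow> real \<Rightarrow> real \<Rightarrow> real" where
  "moll_w h t x = (- c0 * moll_v h t 1 - integral {0..1} (moll_w' h t)) + integral {0..x} (moll_w' h t)"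

lemma moll_X_carrier: "moll_X h t \<in> carrier_vec n"
  by (simp add: moll_X_def)

lemma moll_v_primitive: "0 \<le> t \<Longrightarrow> 0 < h \<Longrightarrow> primitive (moll_v h t) (moll_v' h t)"
  using primitive_cmult[OF primitive_diff[OF u_primitive[of "t + h"] u_primitive[of t]], of "1 / h"]
  by (simp add: moll_v_def[abs_def] moll_v'_def[abs_def])

lemma moll_w'_L2: "0 \<le> t \<Longrightarrow> 0 < h \<Longrightarrow> moll_w' h t \<in> L2"
  unfolding moll_w'_def by (intro L2_divide L2_diff v_L2) auto

lemma moll_w_primitive: "0 \<le> t \<Longrightarrow> 0 < h \<Longrightarrow> primitive (moll_w h t) (moll_w' h t)"
  unfolding moll_w_def by (rule primitive_integral[OF moll_w'_L2])

lemma moll_w_right: "moll_w h t 1 = - c0 * moll_v h t 1"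
  by (simp add: moll_w_def)

text \<open>The weak formulation exhibits an antiderivative of \<open>\<lambda>s. ip (w s) \<psi>\<close>, so its average is an increment of
  that antiderivative over the window. Integration by parts in \<open>x\<close> turns the increment into the left-hand side; the
  terms at \<open>x = 1\<close> cancel because of \<open>moll_w_right\<close>.\<close>

lemma moll_w_avg:
  assumes t: "0 \<le> t" and h: "0 < h" and psi: "\<psi> \<in> L2"
  shows "ip (moll_w h t) \<psi> = avg h (\<lambda>s. ip (w s) \<psi>) t"
proof -
  let ?\<phi> = "\<lambda>x. integral {0..x} \<psi>"
  have phi: "primitive ?\<phi> \<psi>" using primitive_integral[OF psi, of 0] by simp
  note phiL = primitive_in_L2[OF phi]
  let ?Q = "\<lambda>s. ip (v s) ?\<phi> + c\<^sup>2 * c0 * u s 1 * integral {0..1} \<psi>"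
  have "((\<lambda>s. ?Q s / (- c\<^sup>2)) has_real_derivative ip (w s) \<psi>) (at s within {0..})" if "0 \<le> s" for s
    using DERIV_cdivide[OF weak[OF that psi], of "- c\<^sup>2"] c_pos' by simp
  note avg = avg_antiderivative(1)[OF this t h]
  have avg: "avg h (\<lambda>s. ip (w s) \<psi>) t = - (?Q (t + h) - ?Q t) / (c\<^sup>2 * h)"
  proof -
    have "(p / (- k) - q / (- k)) / h = - (p - q) / (k * h)" if "k \<noteq> 0" for p q k :: real
      using that h by (simp add: field_simps)
    from this[of "c\<^sup>2" "?Q (t + h)" "?Q t"] avg show ?thesis using c_pos' by simp
  qed
  have th: "0 \<le> t + h" using t h by simp
  have "ip (moll_w' h t) ?\<phi> = (ip (v (t + h)) ?\<phi> - ip (v t) ?\<phi>) / (c\<^sup>2 * h)"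
    unfolding moll_w'_def ip_divide_left ip_diff_left[OF v_L2[OF th] v_L2[OF t] phiL] ..
  then have 1: "ip (v (t + h)) ?\<phi> - ip (v t) ?\<phi> = c\<^sup>2 * h * ip (moll_w' h t) ?\<phi>"
    using c_pos' h by simp
  have 2: "u (t + h) 1 - u t 1 = h * moll_v h t 1" using h by (simp add: moll_v_def)
  have "ip (moll_w' h t) ?\<phi> + ip (moll_w h t) \<psi> = - c0 * moll_v h t 1 * integral {0..1} \<psi>"
    using ip_by_parts[OF moll_w_primitive[OF t h] phi] moll_w_right[of h t] by simp
  then have 3: "ip (moll_w h t) \<psi> = - (ip (moll_w' h t) ?\<phi> + c0 * moll_v h t 1 * integral {0..1} \<psi>)" by simp
  have "?Q (t + h) - ?Q t = (ip (v (t + h)) ?\<phi> - ip (v t) ?\<phi>) + c\<^sup>2 * c0 * (u (t + h) 1 - u t 1) * integral {0..1} \<psi>"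
    by (simp add: algebra_simps)
  also have "\<dots> = - (c\<^sup>2 * h) * ip (moll_w h t) \<psi>"
    unfolding 1 2 3 by (simp add: algebra_simps)
  finally show ?thesis unfolding avg using c_pos' h by simp
qed

lemma moll_v_deriv:
  assumes t: "0 \<le> t" and h: "0 < h"
  shows "L2_deriv (moll_v h) (\<lambda>x. c\<^sup>2 * moll_w' h t x) t"
proof -
  have th: "0 \<le> t + h" using t h by simp
  have "L2_deriv (\<lambda>s. u (s + h)) (v (t + h)) t"
    unfolding L2_deriv_def
  proof
    show "\<forall>s\<ge>0. u (s + h) \<in> L2" using u_deriv[OF th] h unfolding L2_deriv_def by auto
    have "L2_tendsto (\<lambda>s x. (u s x - u (t + h) x) / (s - (t + h))) (v (t + h)) (at (t + h) within {0..})"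
      using u_deriv[OF th] unfolding L2_deriv_def by blast
    from L2_tendsto_compose[OF this filterlim_shift[OF h t]]
    show "L2_tendsto (\<lambda>s x. (u (s + h) x - u (t + h) x) / (s - t)) (v (t + h)) (at t within {0..})" by simp
  qed
  from L2_deriv_cmult[OF L2_deriv_add[OF this L2_deriv_cmult[OF u_deriv[OF t], of "- 1"]], of "1 / h"]
  have "L2_deriv (\<lambda>s x. 1 / h * (u (s + h) x + - 1 * u s x)) (\<lambda>x. 1 / h * (v (t + h) x + - 1 * v t x)) t" .
  moreover have "(\<lambda>s x. 1 / h * (u (s + h) x + - 1 * u s x)) = moll_v h" by (simp add: moll_v_def[abs_def])
  moreover have "(\<lambda>x. 1 / h * (v (t + h) x + - 1 * v t x)) = (\<lambda>x. c\<^sup>2 * moll_w' h t x)"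
    using c_pos' by (simp add: moll_w'_def[abs_def])
  ultimately show ?thesis by simp
qed

lemma moll_v'_cont:
  assumes t: "0 \<le> t" and h: "0 < h"
  shows "L2_tendsto (moll_v' h) (moll_v' h t) (at t within {0..})"
proof -
  have th: "0 \<le> t + h" using t h by simp
  from L2_tendsto_cmult[OF L2_tendsto_add[OF L2_tendsto_compose[OF w_cont[OF th] filterlim_shift[OF h t]]
      L2_tendsto_cmult[OF w_cont[OF t], of "- 1"]], of "1 / h"]
  show ?thesis by (simp add: moll_v'_def[abs_def])
qed

text \<open>By \<open>moll_w_avg\<close> the time derivative is known only when tested against functions in \<open>L2\<close>.\<close>

lemma moll_w_deriv:
  assumes t: "0 \<le> t" and h: "0 < h"
  shows "L2_deriv (moll_w h) (moll_v' h t) t"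
proof (rule L2_deriv_weak_to_strong[where g="moll_v' h"])
  show "moll_w h s \<in> L2" "moll_v' h s \<in> L2" if "0 \<le> s" for s :: real
    by (rule primitive_in_L2[OF moll_w_primitive[OF that h]], rule primitive_L2[OF moll_v_primitive[OF that h]])
  fix s :: real and \<psi> assume s: "0 \<le> s" and psi: "\<psi> \<in> L2"
  have sh: "0 \<le> s + h" using s h by simp
  have "(avg h (\<lambda>s. ip (w s) \<psi>) has_real_derivative (ip (w (s + h)) \<psi> - ip (w s) \<psi>) / h) (at s within {0..})"
    by (rule avg_deriv[OF ip_w_continuous[OF psi] s h])
  moreover have "(ip (w (s + h)) \<psi> - ip (w s) \<psi>) / h = ip (moll_v' h s) \<psi>"
    unfolding moll_v'_def ip_divide_left ip_diff_left[OF w_L2[OF sh] w_L2[OF s] psi] ..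
  ultimately have "(avg h (\<lambda>s. ip (w s) \<psi>) has_real_derivative ip (moll_v' h s) \<psi>) (at s within {0..})" by simp
  then show "((\<lambda>s. ip (moll_w h s) \<psi>) has_real_derivative ip (moll_v' h s) \<psi>) (at s within {0..})"
    by (rule deriv_cong_nonneg[OF _ s]) (simp add: moll_w_avg[OF _ h psi])
qed (use moll_v'_cont[OF t h] t in auto)

lemma moll_v_tendsto: assumes t: "0 \<le> t" shows "L2_tendsto (\<lambda>h. moll_v h t) (v t) (at_right 0)"
proof -
  have "L2_tendsto (\<lambda>s x. (u s x - u t x) / (s - t)) (v t) (at t within {0..})"
    using u_deriv[OF t] unfolding L2_deriv_def by blast
  from L2_tendsto_compose[OF this filterlim_shift_right[OF t]]
  show ?thesis by (simp add: moll_v_def[abs_def])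
qed

text \<open>As in \<open>L2_deriv_weak_to_strong\<close>, the identity \<open>moll_w_avg\<close> is tested against the error itself.\<close>

lemma moll_w_tendsto: assumes t: "0 \<le> t" shows "L2_tendsto (\<lambda>h. moll_w h t) (w t) (at_right 0)"
  unfolding L2_tendsto_def
proof (intro conjI)
  show "w t \<in> L2" by (rule w_L2[OF t])
  have mwL: "moll_w h t \<in> L2" if "0 < h" for h by (rule primitive_in_L2[OF moll_w_primitive[OF t that]])
  show "\<forall>\<^sub>F h in at_right 0. moll_w h t \<in> L2"
    using mwL by (auto simp: eventually_at_filter intro!: always_eventually)
  show "((\<lambda>h. L2_nrm (\<lambda>x. moll_w h t x - w t x)) \<longlongrightarrow> 0) (at_right 0)"
    unfolding tendsto_iff
  proof (intro allI impI)
    fix e :: real assume e: "0 < e"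
    obtain d where dd: "d > 0"
      and near: "\<And>s. 0 \<le> s \<Longrightarrow> \<bar>s - t\<bar> < d \<Longrightarrow> L2_nrm (\<lambda>x. w s x - w t x) \<le> e / 2"
      using L2_tendsto_neighbourhood[of w t "e / 2"] w_cont[OF t] e by auto
    have "L2_nrm (\<lambda>x. moll_w h t x - w t x) < e" if h: "0 < h" "h < d" for h
    proof -
      let ?\<psi> = "\<lambda>x. moll_w h t x - w t x"
      have psi: "?\<psi> \<in> L2" by (rule L2_diff[OF mwL[OF h(1)] w_L2[OF t]])
      have "(L2_nrm ?\<psi>)\<^sup>2 = ip (moll_w h t) ?\<psi> - ip (w t) ?\<psi>"
        unfolding L2_nrm_sq by (rule ip_diff_left[OF mwL[OF h(1)] w_L2[OF t] psi])
      also have "\<dots> = avg h (\<lambda>s. ip (w s) ?\<psi>) t - ip (w t) ?\<psi>"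
        unfolding moll_w_avg[OF t h(1) psi] ..
      also have "\<dots> \<le> e / 2 * L2_nrm ?\<psi>"
      proof (rule order_trans[OF abs_ge_self avg_bound[OF ip_w_continuous[OF psi] t h(1)]])
        fix s assume s: "t \<le> s" "s \<le> t + h"
        then have s0: "0 \<le> s" "\<bar>s - t\<bar> < d" using t h by auto
        have "\<bar>ip (w s) ?\<psi> - ip (w t) ?\<psi>\<bar> \<le> L2_nrm (\<lambda>x. w s x - w t x) * L2_nrm ?\<psi>"
          by (rule ip_diff_bound[OF w_L2[OF s0(1)] w_L2[OF t] psi])
        also have "\<dots> \<le> e / 2 * L2_nrm ?\<psi>"
          by (rule mult_right_mono[OF near[OF s0]]) simp
        finally show "\<bar>ip (w s) ?\<psi> - ip (w t) ?\<psi>\<bar> \<le> e / 2 * L2_nrm ?\<psi>" .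
      qed
      finally have "L2_nrm ?\<psi> \<le> e / 2" by (rule L2_nrm_le_if_dual) (use e in simp)
      then show ?thesis using e by simp
    qed
    then show "\<forall>\<^sub>F h in at_right 0. dist (L2_nrm (\<lambda>x. moll_w h t x - w t x)) 0 < e"
      unfolding eventually_at dist_real_def using dd by (auto intro!: exI[of _ d])
  qed
qed

lemma moll_X_deriv:
  assumes t: "0 \<le> t" and h: "0 < h" and i: "i < n"
  shows "((\<lambda>s. moll_X h s $ i) has_real_derivative (X (t + h) $ i - X t $ i) / h) (at t within {0..})"
  using avg_deriv[OF X_continuous[OF i] t h] i by (simp add: moll_X_def)

lemma moll_X_tendsto: "0 \<le> t \<Longrightarrow> i < n \<Longrightarrow> ((\<lambda>h. moll_X h t $ i) \<longlongrightarrow> X t $ i) (at_right 0)"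
  using avg_tendsto[OF X_continuous] by (simp add: moll_X_def)

text \<open>The differential equation for the averages: it passes to them because it is linear.\<close>

lemma moll_X_increment:
  assumes t: "0 \<le> t" and h: "0 < h" and i: "i < n"
  shows "(X (t + h) $ i - X t $ i) / h
     = (A *\<^sub>v moll_X h t) $ i + B $$ (i, 0) * ((K *\<^sub>v moll_X h t) $ 0 + ip (moll_w h t) (\<lambda>x. 1))"
proof -
  have cw: "continuous_on {0..} (\<lambda>s. ip (w s) (\<lambda>x. 1))" by (rule ip_w_continuous[OF L2_const])
  have cs: "continuous_on {0..} (\<lambda>s. \<Sum>j<n. a j * X s $ j)" for a :: "nat \<Rightarrow> real"
    by (intro continuous_intros X_continuous) auto
  have lin: "avg h (\<lambda>s. \<Sum>j<n. a j * X s $ j) t = (\<Sum>j<n. a j * moll_X h t $ j)" for a :: "nat \<Rightarrow> real"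
    using avg_linear[of "{..<n}" "\<lambda>j s. X s $ j" t h a] X_continuous t h by (simp add: moll_X_def)
  have cK: "continuous_on {0..} (\<lambda>s. (\<Sum>j<n. K $$ (0, j) * X s $ j) + 1 * ip (w s) (\<lambda>x. 1))"
    by (intro continuous_on_add continuous_on_mult continuous_on_const cs cw)
  have "(X (t + h) $ i - X t $ i) / h = avg h (\<lambda>s. (A *\<^sub>v X s) $ i + B $$ (i, 0) * u s 1) t"
    by (rule avg_antiderivative(1)[OF X_deriv[OF _ i] t h, symmetric])
  also have "\<dots> = avg h (\<lambda>s. (\<Sum>j<n. A $$ (i, j) * X s $ j)
      + B $$ (i, 0) * ((\<Sum>j<n. K $$ (0, j) * X s $ j) + 1 * ip (w s) (\<lambda>x. 1))) t"
  proof (rule avg_cong)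
    fix s assume "t \<le> s"
    then have s: "0 \<le> s" using t by simp
    show "(A *\<^sub>v X s) $ i + B $$ (i, 0) * u s 1 = (\<Sum>j<n. A $$ (i, j) * X s $ j)
      + B $$ (i, 0) * ((\<Sum>j<n. K $$ (0, j) * X s $ j) + 1 * ip (w s) (\<lambda>x. 1))"
      unfolding u_right[OF s] A_X[OF X_carrier[OF s] i] K_X[OF X_carrier[OF s]] by simp
  qed
  also have "\<dots> = (\<Sum>j<n. A $$ (i, j) * moll_X h t $ j)
      + B $$ (i, 0) * ((\<Sum>j<n. K $$ (0, j) * moll_X h t $ j) + 1 * avg h (\<lambda>s. ip (w s) (\<lambda>x. 1)) t)"
    unfolding avg_add[OF cs cK t h] avg_add[OF cs cw t h] lin ..
  finally show ?thesis
    unfolding A_X[OF moll_X_carrier i] K_X[OF moll_X_carrier] moll_w_avg[OF t h L2_const] by simp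
qed

lemma moll_v_left:
  assumes t: "0 \<le> t" and h: "0 < h"
  shows "moll_v h t 0 = (\<Sum>j<n. K $$ (0, j) * ((X (t + h) $ j - X t $ j) / h))"
proof -
  have th: "0 \<le> t + h" using t h by simp
  show ?thesis
    unfolding moll_v_def u_left[OF t] u_left[OF th] K_X[OF X_carrier[OF t]] K_X[OF X_carrier[OF th]]
    by (simp add: sum_subtractf[symmetric] sum_divide_distrib right_diff_distrib)
qed

end

section \<open>Decay of weak solutions\<close>

context lyapunov_data begin

lemma drift_index:
  assumes X: "X \<in> carrier_vec n" and i: "i < n"
  shows "drift X y $ i = (A *\<^sub>v X) $ i + B $$ (i, 0) * ((K *\<^sub>v X) $ 0 + (y 0 - y (Suc 0)) / (2 * c))"
proof -
  have BK: "(A + B * K) *\<^sub>v X = A *\<^sub>v X + B *\<^sub>v (K *\<^sub>v X)"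
    unfolding add_mult_distrib_mat_vec[OF A mult_carrier_mat[OF B K] X] assoc_mult_mat_vec[OF B K X] ..
  have KX: "K *\<^sub>v X \<in> carrier_vec 1" by (rule mult_mat_vec_carrier[OF K X])
  have BKi: "(B *\<^sub>v (K *\<^sub>v X)) $ i = B $$ (i, 0) * (K *\<^sub>v X) $ 0"
    using B i carrier_vecD[OF KX] by (simp add: scalar_prod_def)
  have Bt: "(B_tilde B c *\<^sub>v vec 2 y) $ i = B $$ (i, 0) * ((y 0 - y (Suc 0)) / (2 * c))"
    using B i
    by (simp add: B_tilde_def scalar_prod_def atLeast0LessThan sum_lessThan_2 mat_of_rows_list_def
        diff_divide_distrib right_diff_distrib)
  show ?thesis
    unfolding drift_def BK using A B i B_tilde_carrier Bt BKi by (simp add: distrib_left)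
qed

text \<open>For each \<open>h > 0\<close> the averages form a regular solution, and the functional is continuous along
  \<open>h \<rightarrow> 0\<close>. The rate is chosen before the solution and does not depend on \<open>h\<close>.\<close>

lemma solution_decay:
  obtains \<delta> where "\<delta> > 0"
   "\<And>X u v w t. weak_solution n A B K c c0 X u v w \<Longrightarrow> 0 \<le> t \<Longrightarrow>
      lyap (X t) (riemann c (v t) (w t)) \<le> exp (- \<delta> * t) * lyap (X 0) (riemann c (v 0) (w 0))"
proof (rule regular_decay)
  fix \<delta> :: real
  assume \<delta>: "\<delta> > 0"
   and reg: "\<And>X \<chi> \<chi>' t. regular_solution X \<chi> \<chi>' \<Longrightarrow> 0 \<le> t \<Longrightarrow>
      lyap (X t) (\<chi> t) \<le> exp (- \<delta> * t) * lyap (X 0) (\<chi> 0)"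
  show ?thesis
  proof (rule that[OF \<delta>])
    fix X u v w and t :: real
    assume "weak_solution n A B K c c0 X u v w" and t: "0 \<le> t"
    then interpret W: weak_solution n A B K c c0 X u v w by simp
    let ?\<chi> = "\<lambda>h s. riemann c (W.moll_v h s) (W.moll_w h s)"
    let ?\<zeta> = "\<lambda>h s i. if i = (0::nat) then W.moll_v h s 1 else c * W.moll_w h s 0"
    have step: "lyap (W.moll_X h t) (?\<chi> h t) \<le> exp (- \<delta> * t) * lyap (W.moll_X h 0) (?\<chi> h 0)" if h: "0 < h" for h
    proof -
      have L: "W.moll_v h s \<in> L2" "W.moll_w h s \<in> L2" if "0 \<le> s" for s
        by (rule primitive_in_L2[OF W.moll_v_primitive[OF that h]], rule primitive_in_L2[OF W.moll_w_primitive[OF that h]])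
      have dr: "drift (W.moll_X h s) (moments (?\<chi> h s) 0) $ i = (X (s + h) $ i - X s $ i) / h"
        if s: "0 \<le> s" and i: "i < n" for s i
        unfolding drift_index[OF W.moll_X_carrier i] W.moll_X_increment[OF s h i] moments_def riemann_mean[OF L[OF s]]
        using c_pos by simp
      have Kd: "Kdrift (W.moll_X h s) (moments (?\<chi> h s) 0) = W.moll_v h s 0" if s: "0 \<le> s" for s
        unfolding Kdrift_def W.K_X[OF drift_carrier] W.moll_v_left[OF s h]
        by (intro sum.cong refl) (simp add: dr[OF s])
      have "regular_solution (W.moll_X h) (?\<chi> h) (\<lambda>s. riemann_dx c (W.moll_v' h s) (W.moll_w' h s))"
        unfolding regular_solution_def
      proof (intro allI impI conjI)
        fix s :: real and i :: nat assume s: "0 \<le> s"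
        show "W.moll_X h s \<in> carrier_vec n" by (rule W.moll_X_carrier)
        show "primitive (?\<chi> h s i) (riemann_dx c (W.moll_v' h s) (W.moll_w' h s) i)"
          by (rule riemann_primitive[OF W.moll_v_primitive[OF s h] W.moll_w_primitive[OF s h]])
        show "L2_deriv (\<lambda>s. ?\<chi> h s i) (\<lambda>x. c * riemann_dx c (W.moll_v' h s) (W.moll_w' h s) i x) s"
          by (rule riemann_deriv[OF W.moll_v_deriv[OF s h] W.moll_w_deriv[OF s h]])
        show "((\<lambda>s. W.moll_X h s $ i) has_real_derivative drift (W.moll_X h s) (moments (?\<chi> h s) 0) $ i) (at s within {0..})"
          if "i < n"
          unfolding dr[OF s that] by (rule W.moll_X_deriv[OF s h that])
        have "boundary_coupling (W.moll_X h s) (?\<chi> h s) (?\<zeta> h s)"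
          unfolding boundary_coupling_def Kd[OF s] left_trace_def right_trace_def riemann_def
          using W.moll_w_right[of h s] by (auto simp: algebra_simps)
        then show "\<exists>\<zeta>. boundary_coupling (W.moll_X h s) (?\<chi> h s) \<zeta>" by blast
      qed
      then show ?thesis by (rule reg[OF _ t])
    qed
    have lim: "((\<lambda>h. lyap (W.moll_X h s) (?\<chi> h s)) \<longlongrightarrow> lyap (X s) (riemann c (v s) (w s))) (at_right 0)"
      if s: "0 \<le> s" for s
      by (intro lyap_tendsto always_eventually allI W.moll_X_carrier W.X_carrier[OF s] W.moll_X_tendsto[OF s]
          riemann_tendsto[OF W.moll_v_tendsto[OF s] W.moll_w_tendsto[OF s]])
    show "lyap (X t) (riemann c (v t) (w t)) \<le> exp (- \<delta> * t) * lyap (X 0) (riemann c (v 0) (w 0))"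
    proof (rule tendsto_le[OF _ tendsto_mult[OF tendsto_const lim] lim])
      show "\<forall>\<^sub>F h in at_right 0. lyap (W.moll_X h t) (?\<chi> h t) \<le> exp (- \<delta> * t) * lyap (W.moll_X h 0) (?\<chi> h 0)"
        using step by (auto simp: eventually_at_filter intro!: always_eventually)
    qed (use t in auto)
  qed
qed

end

lemma Hnrm_sq:
  assumes "X \<in> carrier_vec n"
  shows "(Hnrm c (X, u, v))\<^sup>2 = X \<bullet> X + (L2_nrm u)\<^sup>2 + c\<^sup>2 * (L2_nrm (wderiv u))\<^sup>2 + (L2_nrm v)\<^sup>2"
proof -
  have "0 \<le> X \<bullet> X" unfolding scalar_prod_self[OF assms] by (intro sum_nonneg) auto
  then show ?thesis unfolding Hnrm_def by simp
qed

lemmas is_solutionD = is_solution_def[THEN iffD1]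
lemmas is_solutionD2 = is_solutionD[THEN conjunct2]
lemmas is_solutionD3 = is_solutionD2[THEN conjunct2]
lemmas is_solutionD4 = is_solutionD3[THEN conjunct2]
lemmas is_solutionD5 = is_solutionD4[THEN conjunct2]
lemmas is_solutionD6 = is_solutionD5[THEN conjunct2]
lemmas is_solutionD7 = is_solutionD6[THEN conjunct2]
lemmas is_solutionD8 = is_solutionD7[THEN conjunct2]

lemmas is_solution_state = is_solutionD[THEN conjunct1, rule_format]
lemmas is_solution_continuous = is_solutionD2[THEN conjunct1, rule_format]
lemmas is_solution_velocity = is_solutionD3[THEN conjunct1, rule_format]
lemmas is_solution_ode = is_solutionD4[THEN conjunct1]
lemmas is_solution_initial =
  is_solutionD5[THEN conjunct1] is_solutionD6[THEN conjunct1] is_solutionD7[THEN conjunct1]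
lemmas is_solution_left = is_solutionD8[THEN conjunct1, rule_format]
lemmas is_solution_weak =
  is_solutionD8[THEN conjunct2, THEN bspec, THEN mp, THEN conjunct1, THEN spec, THEN mp]

text \<open>Continuity in the energy norm is continuity of the components, once the weak derivative of a difference is
  identified with the difference of weak derivatives up to a null set.\<close>

lemma is_solution_weak_solution:
  assumes A: "A \<in> carrier_mat n n" and B: "B \<in> carrier_mat n 1" and K: "K \<in> carrier_mat 1 n" and c: "c > 0"
    and sol: "is_solution n A B K c c0 X0 u0 v0 X u v"
  shows "weak_solution n A B K c c0 X u v (\<lambda>t. wderiv (u t))"
proof
  let ?H = "\<lambda>s t. Hnrm c (X s - X t, \<lambda>x. u s x - u t x, \<lambda>x. v s x - v t x)"
  let ?W = "\<lambda>s t. L2_nrm (\<lambda>x. wderiv (u s) x - wderiv (u t) x)"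
  show "A \<in> carrier_mat n n" "B \<in> carrier_mat n 1" "K \<in> carrier_mat 1 n" "c > 0" by fact+
  note sp = is_solution_state[OF sol] and HN = is_solution_continuous[OF sol]
  show Xc: "X t \<in> carrier_vec n" if "0 \<le> t" for t
    using sp[OF that] unfolding Hspace_def by blast
  show vL: "v t \<in> L2" if "0 \<le> t" for t
    using sp[OF that] unfolding Hspace_def by blast
  show up: "primitive (u t) (wderiv (u t))" if "0 \<le> t" for t
  proof -
    have "u t \<in> sobolev 1" using sp[OF that] unfolding Hspace_def by blast
    then show ?thesis unfolding sobolev_1_primitive using primitive_wderiv by blast
  qed
  have uL: "u t \<in> L2" if "0 \<le> t" for t by (rule primitive_in_L2[OF up[OF that]])
  have wL: "wderiv (u t) \<in> L2" if "0 \<le> t" for t by (rule primitive_L2[OF up[OF that]])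
  have Hsq: "(?H s t)\<^sup>2
     = (X s - X t) \<bullet> (X s - X t) + (L2_nrm (\<lambda>x. u s x - u t x))\<^sup>2
       + c\<^sup>2 * (?W s t)\<^sup>2 + (L2_nrm (\<lambda>x. v s x - v t x))\<^sup>2"
    (is "_ = ?a + ?b + ?d + ?e")
    and Hpos: "0 \<le> (X s - X t) \<bullet> (X s - X t)" if s: "0 \<le> s" and t: "0 \<le> t" for s t
  proof -
    note p = primitive_diff[OF up[OF s] up[OF t]]
    have "L2_nrm (wderiv (\<lambda>x. u s x - u t x)) = ?W s t"
      by (rule L2_nrm_cong_AE[OF wderiv_AE_eq[OF p] primitive_L2[OF primitive_wderiv[OF p]] primitive_L2[OF p]])
    moreover have X: "X s - X t \<in> carrier_vec n" using Xc[OF s] Xc[OF t] by (rule minus_carrier_vec)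
    ultimately show "(?H s t)\<^sup>2 = ?a + ?b + ?d + ?e"
      using Hnrm_sq[OF X] by simp
    show "0 \<le> ?a" unfolding scalar_prod_self[OF X] by (intro sum_nonneg) auto
  qed
  have H0: "0 \<le> Hnrm c (Y, a, b)" if "Y \<in> carrier_vec n" for Y a b
  proof -
    have "0 \<le> Y \<bullet> Y" unfolding scalar_prod_self[OF that] by (intro sum_nonneg) auto
    then show ?thesis unfolding Hnrm_def by simp
  qed
  have ev: "\<forall>\<^sub>F s in at t within {0..}. Q s" if "\<And>s. 0 \<le> s \<Longrightarrow> Q s" for Q and t :: real
    using that by (auto simp: eventually_at_filter intro!: always_eventually)
  show "L2_tendsto (\<lambda>t. wderiv (u t)) (wderiv (u t)) (at t within {0..})" if t: "0 \<le> t" for t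
    unfolding L2_tendsto_def
  proof (intro conjI wL[OF t] ev wL tendsto_sandwich[where f="\<lambda>_. 0" and g="\<lambda>s. ?W s t"])
    show "((\<lambda>s. ?H s t / c) \<longlongrightarrow> 0) (at t within {0..})"
      using tendsto_divide[OF HN[OF t] tendsto_const[of c]] c by simp
    fix s :: real assume s: "0 \<le> s"
    have "c * ?W s t \<le> ?H s t"
    proof (rule power2_le_imp_le[OF _ H0[OF minus_carrier_vec[OF Xc[OF s] Xc[OF t]]]])
      show "(c * ?W s t)\<^sup>2 \<le> (?H s t)\<^sup>2"
        unfolding Hsq[OF s t] power_mult_distrib using Hpos[OF s t] by simp
    qed
    then show "?W s t \<le> ?H s t / c" using c by (simp add: field_simps)
  qed auto
  show "L2_deriv u (v t) t" if t: "0 \<le> t" for t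
    unfolding L2_deriv_def L2_tendsto_def
  proof (intro conjI allI impI uL vL[OF t] ev L2_divide L2_diff)
    show "((\<lambda>s. L2_nrm (\<lambda>x. (u s x - u t x) / (s - t) - v t x)) \<longlongrightarrow> 0) (at t within {0..})"
      by (rule is_solution_velocity[OF sol t])
  qed (use t in auto)
  show "((\<lambda>s. X s $ i) has_real_derivative (A *\<^sub>v X t) $ i + B $$ (i, 0) * u t 1) (at t within {0..})"
    if t: "0 \<le> t" and i: "i < n" for t i
  proof -
    obtain X' where X': "\<forall>t\<ge>0. \<forall>i<n. ((\<lambda>s. X s $ i) has_real_derivative X' t $ i) (at t within {0..})"
      "\<forall>t\<ge>0. X' t = A *\<^sub>v X t + B *\<^sub>v vec_of_list [u t 1]"
      using is_solution_ode[OF sol] by blast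
    have "X' t = A *\<^sub>v X t + B *\<^sub>v vec_of_list [u t 1]" using X'(2) t by blast
    moreover have "(A *\<^sub>v X t + B *\<^sub>v vec_of_list [u t 1]) $ i = (A *\<^sub>v X t) $ i + B $$ (i, 0) * u t 1"
    proof -
      have "vec_of_list [u t 1] $ 0 = u t 1" by simp
      then show ?thesis using A B i by (simp add: scalar_prod_def del: vec_of_list_Cons)
    qed
    ultimately show ?thesis using X'(1) t i by metis
  qed
  show "u t 0 = (K *\<^sub>v X t) $ 0" if "0 \<le> t" for t
    by (rule is_solution_left[OF sol that])
  show "((\<lambda>s. ip (v s) (\<lambda>x. integral {0..x} \<psi>) + c\<^sup>2 * c0 * u s 1 * integral {0..1} \<psi>)
          has_real_derivative - c\<^sup>2 * ip (wderiv (u t)) \<psi>) (at t within {0..})"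
    if t: "0 \<le> t" and psi: "\<psi> \<in> L2" for t \<psi>
  proof -
    let ?\<phi> = "\<lambda>x. integral {0..x} \<psi>"
    have p: "primitive ?\<phi> \<psi>" using primitive_integral[OF psi, of 0] by simp
    then have s1: "?\<phi> \<in> sobolev 1" unfolding sobolev_1_primitive by blast
    have p0: "?\<phi> 0 = 0" by simp
    have "((\<lambda>s. (LINT x|leb01. v s x * ?\<phi> x) + c\<^sup>2 * c0 * u s 1 * ?\<phi> 1)
        has_real_derivative - c\<^sup>2 * (LINT x|leb01. wderiv (u t) x * wderiv ?\<phi> x)) (at t within {0..})"
      by (rule is_solution_weak[OF sol s1 p0 t])
    moreover have "ip (wderiv (u t)) (wderiv ?\<phi>) = ip (wderiv (u t)) \<psi>"
      unfolding ip_commute[of "wderiv (u t)"]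
      by (rule ip_cong_AE[OF wderiv_AE_eq[OF p] primitive_L2[OF primitive_wderiv[OF p]] psi wL[OF t]])
    ultimately show ?thesis unfolding ip_def by simp
  qed
qed

text \<open>A Poincare inequality: the increment of \<open>u\<close> from \<open>0\<close> to \<open>x\<close> is at most the norm of \<open>w\<close>.\<close>

lemma primitive_L2_nrm_bound:
  assumes "primitive u w" shows "(L2_nrm u)\<^sup>2 \<le> 2 * (u 0)\<^sup>2 + 2 * (L2_nrm w)\<^sup>2"
proof -
  have wL: "w \<in> L2" and uL: "u \<in> L2" by (rule primitive_L2[OF assms], rule primitive_in_L2[OF assms])
  have pt: "(u x)\<^sup>2 \<le> 2 * (u 0)\<^sup>2 + 2 * (L2_nrm w)\<^sup>2" if x: "x \<in> {0..1}" for x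
  proof -
    have "(u x - u 0)\<^sup>2 \<le> (L2_nrm w)\<^sup>2"
    proof (cases "x = 0")
      case False
      have "\<bar>u x - u 0\<bar> \<le> integral {0..x} (\<lambda>s. \<bar>w s\<bar>)"
        using primitive_diff_eq[OF assms, of 0 x] x L2_integrable_on[OF wL, of 0 x] L2_integrable_on[OF L2_abs[OF wL], of 0 x]
          integral_norm_bound_integral[of w "{0..x}" "\<lambda>s. \<bar>w s\<bar>"] by simp
      then have "\<bar>u x - u 0\<bar>\<^sup>2 \<le> (integral {0..x} (\<lambda>s. \<bar>w s\<bar>))\<^sup>2" by (rule power_mono) simp
      also have "\<dots> \<le> (x - 0) * integral {0..x} (\<lambda>s. (w s)\<^sup>2)"
        by (rule integral_abs_sq_le[OF wL]) (use x False in auto)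
      also have "\<dots> \<le> 1 * integral {0..1} (\<lambda>s. (w s)\<^sup>2)"
      proof (rule mult_mono)
        show "integral {0..x} (\<lambda>s. (w s)\<^sup>2) \<le> integral {0..1} (\<lambda>s. (w s)\<^sup>2)"
          using x L2_sq_integrable_on[OF wL wL, of 0 x] L2_sq_integrable_on[OF wL wL, of 0 1]
          by (intro integral_subset_le) (auto simp: power2_eq_square)
        show "0 \<le> integral {0..x} (\<lambda>s. (w s)\<^sup>2)"
          using x L2_sq_integrable_on[OF wL wL, of 0 x] by (intro integral_nonneg) (auto simp: power2_eq_square)
      qed (use x in auto)
      also have "\<dots> = (L2_nrm w)\<^sup>2"
        unfolding L2_nrm_sq ip_eq_integral[OF wL wL] by (simp add: power2_eq_square)
      finally show ?thesis by simp
    qed simp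
    moreover have "(u x)\<^sup>2 \<le> 2 * (u 0)\<^sup>2 + 2 * (u x - u 0)\<^sup>2"
      using zero_le_power2[of "u x - 2 * u 0"] by (simp add: power2_eq_square algebra_simps)
    ultimately show ?thesis by simp
  qed
  have "(L2_nrm u)\<^sup>2 = integral {0..1} (\<lambda>x. u x * u x)" by (simp add: L2_nrm_sq ip_eq_integral[OF uL uL])
  also have "\<dots> \<le> integral {0..1} (\<lambda>x::real. 2 * (u 0)\<^sup>2 + 2 * (L2_nrm w)\<^sup>2)"
    using pt by (intro integral_le L2_sq_integrable_on[OF uL uL]) (auto simp: power2_eq_square)
  finally show ?thesis by simp
qed

theorem theorem2:
  fixes n N :: nat and A B K :: "real mat" and c c0 :: real
  assumes "n \<ge> 1"
    and "A \<in> carrier_mat n n" and "B \<in> carrier_mat n 1" and "K \<in> carrier_mat 1 n"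
    and "c > 0" and "c0 > 0"
    and "\<exists>P S R. sym_pos_def (n + 2 * (N + 1)) P \<and> sym_pos_def 2 S \<and> sym_pos_def 2 R \<and>
           sym_neg_def (n + 2 * (N + 1) + 2) (Psi_mat n N A B K c c0 P S R)"
  shows "\<exists>\<gamma> \<delta> :: real. \<gamma> > 1 \<and> \<delta> > 0 \<and>
           (\<forall>X0 u0 v0 X u v.
              (X0, u0, v0) \<in> DT n K c0 \<longrightarrow>
              is_solution n A B K c c0 X0 u0 v0 X u v \<longrightarrow>
              (\<forall>t>0. (Hnrm c (X t, u t, v t))\<^sup>2
                       \<le> \<gamma> * exp (- \<delta> * t) * (Hnrm c (X0, u0, v0))\<^sup>2))"
proof -
  obtain P S R where "sym_pos_def (n + 2 * (N + 1)) P" "sym_pos_def 2 S" "sym_pos_def 2 R"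
    "sym_neg_def (n + 2 * (N + 1) + 2) (Psi_mat n N A B K c c0 P S R)"
    using assms(7) by blast
  then interpret lyapunov_data n N A B K c c0 P S R
    using assms(2-5) by unfold_locales
  obtain \<delta> where \<delta>: "\<delta> > 0"
    "\<And>X u v w t. weak_solution n A B K c c0 X u v w \<Longrightarrow> 0 \<le> t \<Longrightarrow>
      lyap (X t) (riemann c (v t) (w t)) \<le> exp (- \<delta> * t) * lyap (X 0) (riemann c (v 0) (w 0))"
    using solution_decay by blast
  obtain \<kappa> where \<kappa>: "\<kappa> > 0"
    "\<And>X \<chi>. X \<in> carrier_vec n \<Longrightarrow> (\<And>i. \<chi> i \<in> L2) \<Longrightarrow> \<kappa> * energy X \<chi> \<le> lyap X \<chi>"
    using lyap_lower by blast
  obtain C where C: "C > 0"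
    "\<And>X \<chi>. X \<in> carrier_vec n \<Longrightarrow> (\<And>i. \<chi> i \<in> L2) \<Longrightarrow> lyap X \<chi> \<le> C * energy X \<chi>"
    using lyap_upper by blast
  define k where "k = (\<Sum>j<n. (K $$ (0, j))\<^sup>2)"
  \<comment> \<open>\<open>2 k\<close> and \<open>1 / c\<^sup>2\<close> pay for \<open>u\<close> itself, which the energy does not contain.\<close>
  define M where "M = 1 + 2 * k + 1 / c\<^sup>2"
  \<comment> \<open>\<open>M\<close> compares the squared norm with the energy, \<open>2 C / \<kappa>\<close> the energy at time \<open>t\<close> with the initial squared norm; the summand \<open>1\<close> only makes \<open>\<gamma>\<close> exceed \<open>1\<close>.\<close>
  define \<gamma> where "\<gamma> = 1 + M * (2 * C / \<kappa>)"
  have k0: "0 \<le> k" unfolding k_def by (intro sum_nonneg) auto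
  have M: "M \<ge> 1" "0 < M" unfolding M_def using k0 assms(5) by (simp_all add: add_pos_nonneg)
  show ?thesis
  proof (intro exI conjI allI impI)
    show "1 < \<gamma>" unfolding \<gamma>_def using M C \<kappa> by simp
    show "0 < \<delta>" by (rule \<delta>(1))
    fix X0 u0 v0 X u v and t :: real
    assume D: "(X0, u0, v0) \<in> DT n K c0" and sol: "is_solution n A B K c c0 X0 u0 v0 X u v" and t: "0 < t"
    define w where "w t = wderiv (u t)" for t
    have ws: "weak_solution n A B K c c0 X u v w"
      using is_solution_weak_solution[OF assms(2-5) sol] by (simp add: w_def[abs_def])
    then interpret W: weak_solution n A B K c c0 X u v w .
    have t0: "0 \<le> t" using t by simp
    let ?E = "\<lambda>s. X s \<bullet> X s + 2 * (L2_nrm (v s))\<^sup>2 + 2 * c\<^sup>2 * (L2_nrm (w s))\<^sup>2"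
    have en: "energy (X s) (riemann c (v s) (w s)) = ?E s" if "0 \<le> s" for s
      unfolding energy_def riemann_energy[OF W.v_L2[OF that] W.w_L2[OF that]] L2_nrm_sq by simp
    have XX: "0 \<le> X s \<bullet> X s" if "0 \<le> s" for s
      unfolding scalar_prod_self[OF W.X_carrier[OF that]] by (intro sum_nonneg) auto
    have up: "(Hnrm c (X s, u s, v s))\<^sup>2 \<le> M * ?E s" if s: "0 \<le> s" for s
    proof -
      have "(u s 0)\<^sup>2 \<le> k * (X s \<bullet> X s)"
        unfolding W.u_left[OF s] W.K_X[OF W.X_carrier[OF s]] scalar_prod_self[OF W.X_carrier[OF s]] k_def
        by (rule Cauchy_Schwarz_ineq_sum)
      then have u: "(L2_nrm (u s))\<^sup>2 \<le> 2 * k * (X s \<bullet> X s) + 2 * (L2_nrm (w s))\<^sup>2"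
        using primitive_L2_nrm_bound[OF W.u_primitive[OF s]] by simp
      have "(Hnrm c (X s, u s, v s))\<^sup>2 = X s \<bullet> X s + (L2_nrm (u s))\<^sup>2 + c\<^sup>2 * (L2_nrm (w s))\<^sup>2 + (L2_nrm (v s))\<^sup>2"
        unfolding Hnrm_sq[OF W.X_carrier[OF s]] w_def ..
      also have "\<dots> \<le> (1 + 2 * k) * (X s \<bullet> X s) + (1 + 1 / c\<^sup>2) * (2 * c\<^sup>2 * (L2_nrm (w s))\<^sup>2) + 2 * (L2_nrm (v s))\<^sup>2"
      proof -
        have "(1 + 1 / c\<^sup>2) * (2 * c\<^sup>2 * (L2_nrm (w s))\<^sup>2) = 2 * (c\<^sup>2 * (L2_nrm (w s))\<^sup>2) + 2 * (L2_nrm (w s))\<^sup>2"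
          using assms(5) by (simp add: field_simps)
        moreover have "0 \<le> c\<^sup>2 * (L2_nrm (w s))\<^sup>2" "0 \<le> (L2_nrm (v s))\<^sup>2" by simp_all
        moreover have "(1 + 2 * k) * (X s \<bullet> X s) = X s \<bullet> X s + 2 * k * (X s \<bullet> X s)" by (simp add: distrib_right)
        ultimately show ?thesis using u by linarith
      qed
      also have "\<dots> \<le> M * (X s \<bullet> X s) + M * (2 * c\<^sup>2 * (L2_nrm (w s))\<^sup>2) + M * (2 * (L2_nrm (v s))\<^sup>2)"
      proof (intro add_mono)
        show "(1 + 2 * k) * (X s \<bullet> X s) \<le> M * (X s \<bullet> X s)"
          by (rule mult_right_mono[OF _ XX[OF s]]) (simp add: M_def)
        show "(1 + 1 / c\<^sup>2) * (2 * c\<^sup>2 * (L2_nrm (w s))\<^sup>2) \<le> M * (2 * c\<^sup>2 * (L2_nrm (w s))\<^sup>2)"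
          by (rule mult_right_mono) (simp_all add: M_def k0)
        show "2 * (L2_nrm (v s))\<^sup>2 \<le> M * (2 * (L2_nrm (v s))\<^sup>2)"
          using mult_right_mono[OF M(1), of "2 * (L2_nrm (v s))\<^sup>2"] by simp
      qed
      finally show ?thesis by (simp add: distrib_left)
    qed
    have init: "Hnrm c (X 0, u 0, v 0) = Hnrm c (X0, u0, v0)"
    proof -
      have i: "X 0 = X0" "\<forall>x\<in>{0..1}. u 0 x = u0 x" "AE x in leb01. v 0 x = v0 x"
        by (rule is_solution_initial[OF sol])+
      have "v0 \<in> sobolev 1" using D unfolding DT_def by blast
      then have "v0 \<in> L2" unfolding sobolev_1_primitive using primitive_in_L2 by blast
      then have "L2_nrm (v 0) = L2_nrm v0" by (rule L2_nrm_cong_AE[OF i(3) W.v_L2[OF order_refl]])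
      moreover have "wderiv (u 0) = wderiv u0" using i(2) by (intro wderiv_cong) blast
      moreover have "L2_nrm (u 0) = L2_nrm u0" using i(2) by (intro L2_nrm_cong) blast
      ultimately show ?thesis unfolding Hnrm_def i(1) by simp
    qed
    have low: "?E 0 \<le> 2 * (Hnrm c (X0, u0, v0))\<^sup>2"
      unfolding init[symmetric] Hnrm_sq[OF W.X_carrier[OF order_refl]] w_def[symmetric]
      using XX[OF order_refl] zero_le_power2[of "L2_nrm (u 0)"] by (simp add: algebra_simps)
    have L: "riemann c (v s) (w s) i \<in> L2" if "0 \<le> s" for s i
      by (rule riemann_L2[OF W.v_L2[OF that] W.w_L2[OF that]])
    have "\<kappa> * ?E t \<le> lyap (X t) (riemann c (v t) (w t))"
      using \<kappa>(2)[OF W.X_carrier[OF t0], of "riemann c (v t) (w t)", OF L[OF t0]] unfolding en[OF t0] .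
    also have "\<dots> \<le> exp (- \<delta> * t) * lyap (X 0) (riemann c (v 0) (w 0))" by (rule \<delta>(2)[OF ws t0])
    also have "\<dots> \<le> exp (- \<delta> * t) * (C * ?E 0)"
      using C(2)[OF W.X_carrier[OF order_refl], of "riemann c (v 0) (w 0)", OF L[OF order_refl]] unfolding en[OF order_refl]
      by (intro mult_left_mono) auto
    also have "\<dots> \<le> exp (- \<delta> * t) * (C * (2 * (Hnrm c (X0, u0, v0))\<^sup>2))"
      using low C(1) by (intro mult_left_mono) auto
    finally have "?E t \<le> exp (- \<delta> * t) * (C * (2 * (Hnrm c (X0, u0, v0))\<^sup>2)) / \<kappa>"
      using \<kappa>(1) by (simp add: pos_le_divide_eq mult.commute)
    then have "M * ?E t \<le> M * (exp (- \<delta> * t) * (C * (2 * (Hnrm c (X0, u0, v0))\<^sup>2)) / \<kappa>)"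
      using M(2) by (intro mult_left_mono) auto
    also have "\<dots> = M * (2 * C / \<kappa>) * exp (- \<delta> * t) * (Hnrm c (X0, u0, v0))\<^sup>2"
      by (simp add: field_simps)
    also have "\<dots> \<le> \<gamma> * exp (- \<delta> * t) * (Hnrm c (X0, u0, v0))\<^sup>2"
      unfolding \<gamma>_def by (intro mult_right_mono) auto
    finally show "(Hnrm c (X t, u t, v t))\<^sup>2 \<le> \<gamma> * exp (- \<delta> * t) * (Hnrm c (X0, u0, v0))\<^sup>2"
      using up[OF t0] by linarith
  qed
qed

end
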